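(* Let $x=(x_1,\dots,x_n)$, let $f$ be a vector of polynomials in $x$, let $P$ be a first-order real arithmetic formula written in normal form, and let a normal form of $\neg P$ be fixed. Then the following rule (sAI) is a derived rule of the extended calculus $\mathcal{C}_1$: from the premises $P\vdash\mathrm{Prog}_f(P)$ and $\neg P\vdash\mathrm{Prog}_{-f}(\neg P)$ infer $P\vdash[x'=f(x)]P$.
   Context: A normal form is a formula $\bigvee_{i=0}^{M}\big(\bigwedge_{j=0}^{m(i)}p_{ij}\geq0\wedge\bigwedge_{j=0}^{n(i)}q_{ij}>0\big)$ with polynomials $p_{ij},q_{ij}$. Lie derivatives: $L_f(p)=\sum_i\frac{\partial p}{\partial x_i}f_i$, $L^0_f(p)=p$, $L^{i+1}_f(p)=L_f(L^i_f(p))$. The rank of $p$ (w.r.t. $f$) is the smallest $N\ge1$ with $L^N_f(p)=\sum_{i<N}g_iL^i_f(p)$ for some polynomials $g_i$. For $p$ of rank $N$: $\mathrm{Rad}_f(p)\equiv\bigwedge_{i=0}^{N-1}L^i_f(p)=0$; $\mathrm{Prog}_f^{>}(p)\equiv p\geq0\wedge\bigwedge_{k=1}^{N-2}\big(\bigwedge_{i=0}^{k-1}L^i_f(p)=0\to L^k_f(p)\geq0\big)\wedge\big(\bigwedge_{i=0}^{N-2}L^i_f(p)=0\to L^{N-1}_f(p)>0\big)$ (for $N=1$ this is $p>0$); $\mathrm{Prog}_f^{\geq}(p)\equiv\mathrm{Prog}_f^{>}(p)\vee\mathrm{Rad}_f(p)$. For a formula in the normal form above, $\mathrm{Prog}_f\equiv\bigvee_i\big(\bigwedge_j\mathrm{Prog}_f^{\geq}(p_{ij})\wedge\bigwedge_j\mathrm{Prog}_f^{>}(q_{ij})\big)$;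 $\mathrm{Prog}_{-f}$ is the same with Lie derivatives taken w.r.t. $x'=-f(x)$. Differential dynamic logic (dL): terms are polynomials with rational coefficients. Formulas are built from $e_1\sim e_2$ ($\sim\in\{=,\geq,>\}$) with $\neg,\wedge,\vee,\to,\leftrightarrow,\forall,\exists$ and modalities $[\alpha]\phi$, $\langle\alpha\rangle\phi$. Hybrid programs: $x:=e \mid\, ?\phi \mid x'=f(x)\,\&\,Q \mid \alpha\cup\beta \mid \alpha;\beta \mid \alpha^*$ ($x'=f(x)$ abbreviates $x'=f(x)\&\mathit{true}$). $(\omega,\nu)$ is a transition of $x'=f(x)\,\&\,Q$ iff there are $T\ge 0$ and a solution $\varphi:[0,T]\to$ states of $x'=f(x)$ (other variables constant) with $\varphi(0)=\omega$, $\varphi(T)=\nu$, $Q$ true along $\varphi$; $[\alpha]\phi$/$\langle\alpha\rangle\phi$: in all/some successors. A sequent $\Gamma\vdash\phi$ means $\bigwedge\Gamma\to\phi$. The base calculus $\mathcal{C}_0$: a classical sequent calculus for first-order logic (cut, weakening, connective rules, real witnesses for $\exists$) in which every valid formula of first-order real arithmetic is an axiom, plus all instances of: $\langle\alpha\rangle\phi\leftrightarrow\neg[\alpha]\neg\phi$; $[x:=e]\phi(x)\leftrightarrow\phi(e)$; $[?\psi]\phi\leftrightarrow(\psi\to\phi)$; $[\alpha\cup\beta]\phi\leftrightarrow[\alpha]\phi\wedge[\beta]\phi$; $[\alpha;\beta]\phi\leftrightarrow[\alpha][\beta]\phi$; $[\alpha^*]\phi\leftrightarrow\phi\wedge[\alpha][\alpha^*]\phi$;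 (K) $[\alpha](\phi\to\psi)\to([\alpha]\phi\to[\alpha]\psi)$; (I) $[\alpha^*]\phi\leftrightarrow\phi\wedge[\alpha^*](\phi\to[\alpha]\phi)$; (V) $\phi\to[\alpha]\phi$ if no free variable of $\phi$ is changed by $\alpha$; (G) from $\vdash\phi$ infer $\vdash[\alpha]\phi$; (DW) $[x'=f(x)\,\&\,Q]Q$; (DI, with Lie derivatives in place of differential terms) $(Q\to[x'=f(x)\,\&\,Q]L_f(p)\geq0)\to([x'=f(x)\,\&\,Q]p\succcurlyeq0\leftrightarrow(Q\to p\succcurlyeq0))$ for $\succcurlyeq\in\{\geq,>\}$, and the same with $=$; (DMP) $[x'=f(x)\,\&\,Q](Q\to R)\to([x'=f(x)\,\&\,R]\phi\to[x'=f(x)\,\&\,Q]\phi)$; (DG) $[x'=f(x)\,\&\,Q]\phi\leftrightarrow\exists y\,[x'=f(x),y'=a(x)y+b(x)\,\&\,Q]\phi$ for fresh $y$ and polynomial $a(x),b(x)$ not mentioning $y$; (B$'$) $\langle x'=f(x)\,\&\,Q\rangle\exists y\,\phi\leftrightarrow\exists y\,\langle x'=f(x)\,\&\,Q\rangle\phi$ for $y$ not among $x$. The extended calculus $\mathcal{C}_1$ is $\mathcal{C}_0$ plus all instances of the following axioms, where $y$ is a vector of fresh variables and, for (Cont) and (RI), the ODE contains an equation $x_1'=1$: (Uniq) $\langle x'=f(x)\&Q_1\rangle P_1\wedge\langle x'=f(x)\&Q_2\rangle P_2\to\langle x'=f(x)\&Q_1\wedge Q_2\rangle(P_1\vee P_2)$;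 (Cont) $x=y\to(p>0\to\langle x'=f(x)\&p>0\rangle x\neq y)$; (Dadj) $\langle x'=f(x)\&Q(x)\rangle x=y\leftrightarrow\langle y'=-f(y)\&Q(y)\rangle y=x$; (RI) $[x'=f(x)]P\leftrightarrow\forall y\,[x'=f(x)\&P\vee x=y](x=y\to P\wedge\langle x'=f(x)\&P\rangle x\neq y)$. *)

theory Defs
  imports Complex_Main "HOL-Library.Poly_Mapping"
begin

section \<open>Polynomial terms\<close>

text \<open>
  Variables are natural numbers. A term is a multivariate polynomial with rational coefficients,
  i.e. a finitely supported map from monomials (finitely supported exponent vectors) to rationals,
  with the convolution product. Equality of terms is therefore identity of polynomials.
\<close>

type_synonym trm = "(nat \<Rightarrow>\<^sub>0 nat) \<Rightarrow>\<^sub>0 rat"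
type_synonym state = "nat \<Rightarrow> real"

definition tvar :: "nat \<Rightarrow> trm" where
  "tvar x = Poly_Mapping.single (Poly_Mapping.single x 1) 1"

definition tvars :: "trm \<Rightarrow> nat set" where
  "tvars p = (\<Union>m\<in>Poly_Mapping.keys p. Poly_Mapping.keys m)"

definition teval :: "trm \<Rightarrow> state \<Rightarrow> real" where
  "teval p \<omega> = (\<Sum>m\<in>Poly_Mapping.keys p. of_rat (Poly_Mapping.lookup p m) *
     (\<Prod>x\<in>Poly_Mapping.keys m. \<omega> x ^ Poly_Mapping.lookup m x))"

definition tsubst :: "(nat \<Rightarrow> trm) \<Rightarrow> trm \<Rightarrow> trm" where
  "tsubst \<sigma> p = (\<Sum>m\<in>Poly_Mapping.keys p. Poly_Mapping.single 0 (Poly_Mapping.lookup p m) *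
     (\<Prod>x\<in>Poly_Mapping.keys m. \<sigma> x ^ Poly_Mapping.lookup m x))"

text \<open>If \<open>x\<close> does not occur in the monomial \<open>m\<close>, the truncated exponent is harmless because the
  coefficient is then \<open>0\<close>.\<close>

definition partial :: "nat \<Rightarrow> trm \<Rightarrow> trm" where
  "partial x p = (\<Sum>m\<in>Poly_Mapping.keys p.
     Poly_Mapping.single (m - Poly_Mapping.single x 1)
       (Poly_Mapping.lookup p m * of_nat (Poly_Mapping.lookup m x)))"


section \<open>Formulas and hybrid programs\<close>

text \<open>The list \<open>[(x\<^sub>1, f\<^sub>1), \<dots>, (x\<^sub>n, f\<^sub>n)]\<close> stands for the system \<open>x\<^sub>1' = f\<^sub>1, \<dots>, x\<^sub>n' = f\<^sub>n\<close>.\<close>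

type_synonym ode = "(nat \<times> trm) list"

datatype fml =
    Eq trm trm
  | Geq trm trm
  | Gt trm trm
  | Neg fml
  | And fml fml
  | Or fml fml
  | Imp fml fml
  | Iff fml fml
  | All nat fml
  | Ex nat fml
  | Box hp fml
  | Dia hp fml
and hp =
    Assign nat trm
  | Test fml
  | Ode ode fml
  | Choice hp hp
  | Seq hp hp
  | Loop hp

definition ode_vars :: "ode \<Rightarrow> nat set" where
  "ode_vars ode = set (map fst ode)"

definition rhs_vars :: "ode \<Rightarrow> nat set" where
  "rhs_vars ode = (\<Union>e\<in>set (map snd ode). tvars e)"

definition wf_ode :: "ode \<Rightarrow> bool" where
  "wf_ode ode \<longleftrightarrow> distinct (map fst ode)"

definition neg_ode :: "ode \<Rightarrow> ode" where
  "neg_ode ode = map (\<lambda>(x, e). (x, - e)) ode"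

definition TT :: fml where
  "TT = Eq 0 0"

definition FF :: fml where
  "FF = Gt 0 0"

fun Conj :: "fml list \<Rightarrow> fml" where
  "Conj [] = TT"
| "Conj [\<phi>] = \<phi>"
| "Conj (\<phi> # \<psi> # \<phi>s) = And \<phi> (Conj (\<psi> # \<phi>s))"

fun Disj :: "fml list \<Rightarrow> fml" where
  "Disj [] = FF"
| "Disj [\<phi>] = \<phi>"
| "Disj (\<phi> # \<psi> # \<phi>s) = Or \<phi> (Disj (\<psi> # \<phi>s))"

definition Alls :: "nat list \<Rightarrow> fml \<Rightarrow> fml" where
  "Alls ys \<phi> = foldr All ys \<phi>"

definition veq :: "nat list \<Rightarrow> nat list \<Rightarrow> fml" where
  "veq xs ys = Conj (map2 (\<lambda>x y. Eq (tvar x) (tvar y)) xs ys)"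


section \<open>Semantics\<close>

primrec sem :: "fml \<Rightarrow> state \<Rightarrow> bool"
  and trans :: "hp \<Rightarrow> state \<Rightarrow> state \<Rightarrow> bool" where
  "sem (Eq p q) \<omega> \<longleftrightarrow> teval p \<omega> = teval q \<omega>"
| "sem (Geq p q) \<omega> \<longleftrightarrow> teval p \<omega> \<ge> teval q \<omega>"
| "sem (Gt p q) \<omega> \<longleftrightarrow> teval p \<omega> > teval q \<omega>"
| "sem (Neg \<phi>) \<omega> \<longleftrightarrow> \<not> sem \<phi> \<omega>"
| "sem (And \<phi> \<psi>) \<omega> \<longleftrightarrow> sem \<phi> \<omega> \<and> sem \<psi> \<omega>"
| "sem (Or \<phi> \<psi>) \<omega> \<longleftrightarrow> sem \<phi> \<omega> \<or> sem \<psi> \<omega>"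
| "sem (Imp \<phi> \<psi>) \<omega> \<longleftrightarrow> (sem \<phi> \<omega> \<longrightarrow> sem \<psi> \<omega>)"
| "sem (Iff \<phi> \<psi>) \<omega> \<longleftrightarrow> (sem \<phi> \<omega> \<longleftrightarrow> sem \<psi> \<omega>)"
| "sem (All x \<phi>) \<omega> \<longleftrightarrow> (\<forall>r. sem \<phi> (\<omega>(x := r)))"
| "sem (Ex x \<phi>) \<omega> \<longleftrightarrow> (\<exists>r. sem \<phi> (\<omega>(x := r)))"
| "sem (Box \<alpha> \<phi>) \<omega> \<longleftrightarrow> (\<forall>\<nu>. trans \<alpha> \<omega> \<nu> \<longrightarrow> sem \<phi> \<nu>)"
| "sem (Dia \<alpha> \<phi>) \<omega> \<longleftrightarrow> (\<exists>\<nu>. trans \<alpha> \<omega> \<nu> \<and> sem \<phi> \<nu>)"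
| "trans (Assign x e) \<omega> \<nu> \<longleftrightarrow> \<nu> = \<omega>(x := teval e \<omega>)"
| "trans (Test \<phi>) \<omega> \<nu> \<longleftrightarrow> \<nu> = \<omega> \<and> sem \<phi> \<omega>"
| "trans (Ode ode Q) \<omega> \<nu> \<longleftrightarrow>
     (\<exists>T F. T \<ge> 0 \<and> F 0 = \<omega> \<and> F T = \<nu> \<and>
        (\<forall>t\<in>{0..T}.
           (\<forall>(x, e)\<in>set ode.
              ((\<lambda>s. F s x) has_real_derivative teval e (F t)) (at t within {0..T})) \<and>
           (\<forall>x. x \<notin> ode_vars ode \<longrightarrow> F t x = \<omega> x) \<and>
           sem Q (F t)))"
| "trans (Choice \<alpha> \<beta>) \<omega> \<nu> \<longleftrightarrow> trans \<alpha> \<omega> \<nu> \<or> trans \<beta> \<omega> \<nu>"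
| "trans (Seq \<alpha> \<beta>) \<omega> \<nu> \<longleftrightarrow> (\<exists>\<mu>. trans \<alpha> \<omega> \<mu> \<and> trans \<beta> \<mu> \<nu>)"
| "trans (Loop \<alpha>) \<omega> \<nu> \<longleftrightarrow> (trans \<alpha>)\<^sup>*\<^sup>* \<omega> \<nu>"

definition valid :: "fml \<Rightarrow> bool" where
  "valid \<phi> \<longleftrightarrow> (\<forall>\<omega>. sem \<phi> \<omega>)"

primrec first_order :: "fml \<Rightarrow> bool" where
  "first_order (Eq p q) \<longleftrightarrow> True"
| "first_order (Geq p q) \<longleftrightarrow> True"
| "first_order (Gt p q) \<longleftrightarrow> True"
| "first_order (Neg \<phi>) \<longleftrightarrow> first_order \<phi>"
| "first_order (And \<phi> \<psi>) \<longleftrightarrow> first_order \<phi> \<and> first_order \<psi>"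
| "first_order (Or \<phi> \<psi>) \<longleftrightarrow> first_order \<phi> \<and> first_order \<psi>"
| "first_order (Imp \<phi> \<psi>) \<longleftrightarrow> first_order \<phi> \<and> first_order \<psi>"
| "first_order (Iff \<phi> \<psi>) \<longleftrightarrow> first_order \<phi> \<and> first_order \<psi>"
| "first_order (All x \<phi>) \<longleftrightarrow> first_order \<phi>"
| "first_order (Ex x \<phi>) \<longleftrightarrow> first_order \<phi>"
| "first_order (Box \<alpha> \<phi>) \<longleftrightarrow> False"
| "first_order (Dia \<alpha> \<phi>) \<longleftrightarrow> False"


section \<open>Static semantics and substitution\<close>

text \<open>Variables possibly changed by a program (\<open>BV\<close>), and changed on every run (\<open>MBV\<close>).\<close>

primrec BV :: "hp \<Rightarrow> nat set" where
  "BV (Assign x e) = {x}"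
| "BV (Test \<phi>) = {}"
| "BV (Ode ode Q) = ode_vars ode"
| "BV (Choice \<alpha> \<beta>) = BV \<alpha> \<union> BV \<beta>"
| "BV (Seq \<alpha> \<beta>) = BV \<alpha> \<union> BV \<beta>"
| "BV (Loop \<alpha>) = BV \<alpha>"

primrec MBV :: "hp \<Rightarrow> nat set" where
  "MBV (Assign x e) = {x}"
| "MBV (Test \<phi>) = {}"
| "MBV (Ode ode Q) = ode_vars ode"
| "MBV (Choice \<alpha> \<beta>) = MBV \<alpha> \<inter> MBV \<beta>"
| "MBV (Seq \<alpha> \<beta>) = MBV \<alpha> \<union> MBV \<beta>"
| "MBV (Loop \<alpha>) = {}"

text \<open>The variables of a differential equation are free in it (initial values) as well as bound.\<close>

primrec FV :: "fml \<Rightarrow> nat set" and FVp :: "hp \<Rightarrow> nat set" where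
  "FV (Eq p q) = tvars p \<union> tvars q"
| "FV (Geq p q) = tvars p \<union> tvars q"
| "FV (Gt p q) = tvars p \<union> tvars q"
| "FV (Neg \<phi>) = FV \<phi>"
| "FV (And \<phi> \<psi>) = FV \<phi> \<union> FV \<psi>"
| "FV (Or \<phi> \<psi>) = FV \<phi> \<union> FV \<psi>"
| "FV (Imp \<phi> \<psi>) = FV \<phi> \<union> FV \<psi>"
| "FV (Iff \<phi> \<psi>) = FV \<phi> \<union> FV \<psi>"
| "FV (All x \<phi>) = FV \<phi> - {x}"
| "FV (Ex x \<phi>) = FV \<phi> - {x}"
| "FV (Box \<alpha> \<phi>) = FVp \<alpha> \<union> (FV \<phi> - MBV \<alpha>)"
| "FV (Dia \<alpha> \<phi>) = FVp \<alpha> \<union> (FV \<phi> - MBV \<alpha>)"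
| "FVp (Assign x e) = tvars e"
| "FVp (Test \<phi>) = FV \<phi>"
| "FVp (Ode ode Q) = ode_vars ode \<union> rhs_vars ode \<union> FV Q"
| "FVp (Choice \<alpha> \<beta>) = FVp \<alpha> \<union> FVp \<beta>"
| "FVp (Seq \<alpha> \<beta>) = FVp \<alpha> \<union> (FVp \<beta> - MBV \<alpha>)"
| "FVp (Loop \<alpha>) = FVp \<alpha>"

definition unsub :: "nat set \<Rightarrow> (nat \<Rightarrow> trm) \<Rightarrow> nat \<Rightarrow> trm" where
  "unsub B \<sigma> = (\<lambda>x. if x \<in> B then tvar x else \<sigma> x)"

text \<open>Simultaneous substitution for the free occurrences of variables. It is meant to be used only
  when it is admissible in the sense of \<open>fadm\<close> below: it does not rename bound variables.\<close>

primrec fsubst :: "(nat \<Rightarrow> trm) \<Rightarrow> fml \<Rightarrow> fml"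
  and psubst :: "(nat \<Rightarrow> trm) \<Rightarrow> hp \<Rightarrow> hp" where
  "fsubst \<sigma> (Eq p q) = Eq (tsubst \<sigma> p) (tsubst \<sigma> q)"
| "fsubst \<sigma> (Geq p q) = Geq (tsubst \<sigma> p) (tsubst \<sigma> q)"
| "fsubst \<sigma> (Gt p q) = Gt (tsubst \<sigma> p) (tsubst \<sigma> q)"
| "fsubst \<sigma> (Neg \<phi>) = Neg (fsubst \<sigma> \<phi>)"
| "fsubst \<sigma> (And \<phi> \<psi>) = And (fsubst \<sigma> \<phi>) (fsubst \<sigma> \<psi>)"
| "fsubst \<sigma> (Or \<phi> \<psi>) = Or (fsubst \<sigma> \<phi>) (fsubst \<sigma> \<psi>)"
| "fsubst \<sigma> (Imp \<phi> \<psi>) = Imp (fsubst \<sigma> \<phi>) (fsubst \<sigma> \<psi>)"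
| "fsubst \<sigma> (Iff \<phi> \<psi>) = Iff (fsubst \<sigma> \<phi>) (fsubst \<sigma> \<psi>)"
| "fsubst \<sigma> (All x \<phi>) = All x (fsubst (unsub {x} \<sigma>) \<phi>)"
| "fsubst \<sigma> (Ex x \<phi>) = Ex x (fsubst (unsub {x} \<sigma>) \<phi>)"
| "fsubst \<sigma> (Box \<alpha> \<phi>) = Box (psubst \<sigma> \<alpha>) (fsubst (unsub (MBV \<alpha>) \<sigma>) \<phi>)"
| "fsubst \<sigma> (Dia \<alpha> \<phi>) = Dia (psubst \<sigma> \<alpha>) (fsubst (unsub (MBV \<alpha>) \<sigma>) \<phi>)"
| "psubst \<sigma> (Assign x e) = Assign x (tsubst \<sigma> e)"
| "psubst \<sigma> (Test \<phi>) = Test (fsubst \<sigma> \<phi>)"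
| "psubst \<sigma> (Ode ode Q) = Ode (map (\<lambda>(x, e). (x, tsubst \<sigma> e)) ode) (fsubst \<sigma> Q)"
| "psubst \<sigma> (Choice \<alpha> \<beta>) = Choice (psubst \<sigma> \<alpha>) (psubst \<sigma> \<beta>)"
| "psubst \<sigma> (Seq \<alpha> \<beta>) = Seq (psubst \<sigma> \<alpha>) (psubst (unsub (MBV \<alpha>) \<sigma>) \<beta>)"
| "psubst \<sigma> (Loop \<alpha>) = Loop (psubst \<sigma> \<alpha>)"

text \<open>\<open>no_capture \<sigma> V B\<close>: in a scope binding \<open>B\<close> whose relevant free variables are \<open>V\<close>, every
  variable actually replaced is itself unbound and so are the variables of its replacement.\<close>

definition no_capture :: "(nat \<Rightarrow> trm) \<Rightarrow> nat set \<Rightarrow> nat set \<Rightarrow> bool" where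
  "no_capture \<sigma> V B \<longleftrightarrow> (\<forall>x\<in>V. \<sigma> x \<noteq> tvar x \<longrightarrow> x \<notin> B \<and> tvars (\<sigma> x) \<inter> B = {})"

primrec fadm :: "(nat \<Rightarrow> trm) \<Rightarrow> fml \<Rightarrow> bool"
  and padm :: "(nat \<Rightarrow> trm) \<Rightarrow> hp \<Rightarrow> bool" where
  "fadm \<sigma> (Eq p q) \<longleftrightarrow> True"
| "fadm \<sigma> (Geq p q) \<longleftrightarrow> True"
| "fadm \<sigma> (Gt p q) \<longleftrightarrow> True"
| "fadm \<sigma> (Neg \<phi>) \<longleftrightarrow> fadm \<sigma> \<phi>"
| "fadm \<sigma> (And \<phi> \<psi>) \<longleftrightarrow> fadm \<sigma> \<phi> \<and> fadm \<sigma> \<psi>"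
| "fadm \<sigma> (Or \<phi> \<psi>) \<longleftrightarrow> fadm \<sigma> \<phi> \<and> fadm \<sigma> \<psi>"
| "fadm \<sigma> (Imp \<phi> \<psi>) \<longleftrightarrow> fadm \<sigma> \<phi> \<and> fadm \<sigma> \<psi>"
| "fadm \<sigma> (Iff \<phi> \<psi>) \<longleftrightarrow> fadm \<sigma> \<phi> \<and> fadm \<sigma> \<psi>"
| "fadm \<sigma> (All x \<phi>) \<longleftrightarrow> no_capture \<sigma> (FV \<phi> - {x}) {x} \<and> fadm (unsub {x} \<sigma>) \<phi>"
| "fadm \<sigma> (Ex x \<phi>) \<longleftrightarrow> no_capture \<sigma> (FV \<phi> - {x}) {x} \<and> fadm (unsub {x} \<sigma>) \<phi>"
| "fadm \<sigma> (Box \<alpha> \<phi>) \<longleftrightarrow>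
     padm \<sigma> \<alpha> \<and> no_capture \<sigma> (FV \<phi> - MBV \<alpha>) (BV \<alpha>) \<and> fadm (unsub (MBV \<alpha>) \<sigma>) \<phi>"
| "fadm \<sigma> (Dia \<alpha> \<phi>) \<longleftrightarrow>
     padm \<sigma> \<alpha> \<and> no_capture \<sigma> (FV \<phi> - MBV \<alpha>) (BV \<alpha>) \<and> fadm (unsub (MBV \<alpha>) \<sigma>) \<phi>"
| "padm \<sigma> (Assign x e) \<longleftrightarrow> True"
| "padm \<sigma> (Test \<phi>) \<longleftrightarrow> fadm \<sigma> \<phi>"
| "padm \<sigma> (Ode ode Q) \<longleftrightarrow> no_capture \<sigma> (FVp (Ode ode Q)) (ode_vars ode) \<and> fadm \<sigma> Q"
| "padm \<sigma> (Choice \<alpha> \<beta>) \<longleftrightarrow> padm \<sigma> \<alpha> \<and> padm \<sigma> \<beta>"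
| "padm \<sigma> (Seq \<alpha> \<beta>) \<longleftrightarrow>
     padm \<sigma> \<alpha> \<and> no_capture \<sigma> (FVp \<beta> - MBV \<alpha>) (BV \<alpha>) \<and> padm (unsub (MBV \<alpha>) \<sigma>) \<beta>"
| "padm \<sigma> (Loop \<alpha>) \<longleftrightarrow> no_capture \<sigma> (FVp \<alpha>) (BV \<alpha>) \<and> padm \<sigma> \<alpha>"

definition sub1 :: "nat \<Rightarrow> trm \<Rightarrow> nat \<Rightarrow> trm" where
  "sub1 x e = tvar(x := e)"

definition rename_vars :: "nat list \<Rightarrow> nat list \<Rightarrow> nat \<Rightarrow> trm" where
  "rename_vars xs ys =
     (\<lambda>v. case map_of (zip xs ys) v of None \<Rightarrow> tvar v | Some w \<Rightarrow> tvar w)"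


section \<open>Lie derivatives, rank and progress formulas\<close>

definition lie :: "ode \<Rightarrow> trm \<Rightarrow> trm" where
  "lie ode p = (\<Sum>(x, e)\<leftarrow>ode. partial x p * e)"

definition lie_n :: "ode \<Rightarrow> nat \<Rightarrow> trm \<Rightarrow> trm" where
  "lie_n ode i p = (lie ode ^^ i) p"

definition lie_rank :: "ode \<Rightarrow> trm \<Rightarrow> nat" where
  "lie_rank ode p =
     (LEAST N. N \<ge> 1 \<and> (\<exists>g :: nat \<Rightarrow> trm. lie_n ode N p = (\<Sum>i<N. g i * lie_n ode i p)))"

definition lie_zero :: "ode \<Rightarrow> trm \<Rightarrow> nat \<Rightarrow> fml" where
  "lie_zero ode p k = Conj (map (\<lambda>i. Eq (lie_n ode i p) 0) [0..<k])"

definition Rad :: "ode \<Rightarrow> trm \<Rightarrow> fml" where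
  "Rad ode p = lie_zero ode p (lie_rank ode p)"

text \<open>The list \<open>[1..<N - 1]\<close> is \<open>1, \<dots>, N - 2\<close>, and \<open>lie_zero ode p (N - 1)\<close> says
  that the Lie derivatives of order \<open>0, \<dots>, N - 2\<close> vanish.\<close>

definition Prog_gt :: "ode \<Rightarrow> trm \<Rightarrow> fml" where
  "Prog_gt ode p = (let N = lie_rank ode p in
     if N = 1 then Gt p 0
     else And (Geq p 0)
           (And (Conj (map (\<lambda>k. Imp (lie_zero ode p k) (Geq (lie_n ode k p) 0)) [1..<N - 1]))
                (Imp (lie_zero ode p (N - 1)) (Gt (lie_n ode (N - 1) p) 0))))"

definition Prog_geq :: "ode \<Rightarrow> trm \<Rightarrow> fml" where
  "Prog_geq ode p = Or (Prog_gt ode p) (Rad ode p)"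

text \<open>A normal form is a nonempty list of disjuncts \<open>(ps, qs)\<close>, where \<open>ps\<close> are the polynomials
  required to be nonnegative and \<open>qs\<close> those required to be positive, both nonempty.\<close>

type_synonym nform = "(trm list \<times> trm list) list"

definition wf_nform :: "nform \<Rightarrow> bool" where
  "wf_nform D \<longleftrightarrow> D \<noteq> [] \<and> (\<forall>(ps, qs)\<in>set D. ps \<noteq> [] \<and> qs \<noteq> [])"

definition nf_fml :: "nform \<Rightarrow> fml" where
  "nf_fml D = Disj (map (\<lambda>(ps, qs).
     And (Conj (map (\<lambda>p. Geq p 0) ps)) (Conj (map (\<lambda>q. Gt q 0) qs))) D)"

definition nform_of :: "nform \<Rightarrow> fml \<Rightarrow> bool" where
  "nform_of D \<phi> \<longleftrightarrow> wf_nform D \<and> valid (Iff (nf_fml D) \<phi>)"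

definition Prog :: "ode \<Rightarrow> nform \<Rightarrow> fml" where
  "Prog ode D = Disj (map (\<lambda>(ps, qs).
     And (Conj (map (Prog_geq ode) ps)) (Conj (map (Prog_gt ode) qs))) D)"


section \<open>Axioms\<close>

inductive axiom_C0 :: "fml \<Rightarrow> bool" where
  Arith: "first_order \<phi> \<Longrightarrow> valid \<phi> \<Longrightarrow> axiom_C0 \<phi>"
| Diamond: "axiom_C0 (Iff (Dia \<alpha> \<phi>) (Neg (Box \<alpha> (Neg \<phi>))))"
| AssignB: "fadm (sub1 x e) \<phi> \<Longrightarrow> axiom_C0 (Iff (Box (Assign x e) \<phi>) (fsubst (sub1 x e) \<phi>))"
| TestB: "axiom_C0 (Iff (Box (Test \<psi>) \<phi>) (Imp \<psi> \<phi>))"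
| ChoiceB: "axiom_C0 (Iff (Box (Choice \<alpha> \<beta>) \<phi>) (And (Box \<alpha> \<phi>) (Box \<beta> \<phi>)))"
| SeqB: "axiom_C0 (Iff (Box (Seq \<alpha> \<beta>) \<phi>) (Box \<alpha> (Box \<beta> \<phi>)))"
| LoopB: "axiom_C0 (Iff (Box (Loop \<alpha>) \<phi>) (And \<phi> (Box \<alpha> (Box (Loop \<alpha>) \<phi>))))"
| K: "axiom_C0 (Imp (Box \<alpha> (Imp \<phi> \<psi>)) (Imp (Box \<alpha> \<phi>) (Box \<alpha> \<psi>)))"
| I: "axiom_C0 (Iff (Box (Loop \<alpha>) \<phi>) (And \<phi> (Box (Loop \<alpha>) (Imp \<phi> (Box \<alpha> \<phi>)))))"
| V: "FV \<phi> \<inter> BV \<alpha> = {} \<Longrightarrow> axiom_C0 (Imp \<phi> (Box \<alpha> \<phi>))"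
| DW: "wf_ode ode \<Longrightarrow> axiom_C0 (Box (Ode ode Q) Q)"
| DI_geq: "wf_ode ode \<Longrightarrow>
    axiom_C0 (Imp (Imp Q (Box (Ode ode Q) (Geq (lie ode p) 0)))
                  (Iff (Box (Ode ode Q) (Geq p 0)) (Imp Q (Geq p 0))))"
| DI_gt: "wf_ode ode \<Longrightarrow>
    axiom_C0 (Imp (Imp Q (Box (Ode ode Q) (Geq (lie ode p) 0)))
                  (Iff (Box (Ode ode Q) (Gt p 0)) (Imp Q (Gt p 0))))"
| DI_eq: "wf_ode ode \<Longrightarrow>
    axiom_C0 (Imp (Imp Q (Box (Ode ode Q) (Eq (lie ode p) 0)))
                  (Iff (Box (Ode ode Q) (Eq p 0)) (Imp Q (Eq p 0))))"
| DMP: "wf_ode ode \<Longrightarrow>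
    axiom_C0 (Imp (Box (Ode ode Q) (Imp Q R))
                  (Imp (Box (Ode ode R) \<phi>) (Box (Ode ode Q) \<phi>)))"
| DG: "wf_ode ode \<Longrightarrow> y \<notin> FVp (Ode ode Q) \<union> FV \<phi> \<Longrightarrow> y \<notin> tvars a \<union> tvars b \<Longrightarrow>
    axiom_C0 (Iff (Box (Ode ode Q) \<phi>) (Ex y (Box (Ode (ode @ [(y, a * tvar y + b)]) Q) \<phi>)))"
| B': "wf_ode ode \<Longrightarrow> y \<notin> FVp (Ode ode Q) \<Longrightarrow>
    axiom_C0 (Iff (Dia (Ode ode Q) (Ex y \<phi>)) (Ex y (Dia (Ode ode Q) \<phi>)))"

definition fresh_vars :: "nat list \<Rightarrow> ode \<Rightarrow> nat set \<Rightarrow> bool" where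
  "fresh_vars ys ode V \<longleftrightarrow> length ys = length ode \<and> distinct ys \<and>
     set ys \<inter> (ode_vars ode \<union> rhs_vars ode \<union> V) = {}"

definition has_clock :: "ode \<Rightarrow> bool" where
  "has_clock ode \<longleftrightarrow> (\<exists>x. (x, 1) \<in> set ode)"

inductive axiom_C1 :: "fml \<Rightarrow> bool" where
  Base: "axiom_C0 \<phi> \<Longrightarrow> axiom_C1 \<phi>"
| Uniq: "wf_ode ode \<Longrightarrow>
    axiom_C1 (Imp (And (Dia (Ode ode Q1) P1) (Dia (Ode ode Q2) P2))
                  (Dia (Ode ode (And Q1 Q2)) (Or P1 P2)))"
| Cont: "wf_ode ode \<Longrightarrow> has_clock ode \<Longrightarrow> xs = map fst ode \<Longrightarrow> fresh_vars ys ode (tvars p) \<Longrightarrow>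
    axiom_C1 (Imp (veq xs ys)
                  (Imp (Gt p 0) (Dia (Ode ode (Gt p 0)) (Neg (veq xs ys)))))"
| Dadj: "wf_ode ode \<Longrightarrow> xs = map fst ode \<Longrightarrow> fresh_vars ys ode (FV Q) \<Longrightarrow>
    \<sigma> = rename_vars xs ys \<Longrightarrow> fadm \<sigma> Q \<Longrightarrow>
    axiom_C1 (Iff (Dia (Ode ode Q) (veq xs ys))
                  (Dia (Ode (zip ys (map (\<lambda>(x, e). - tsubst \<sigma> e) ode)) (fsubst \<sigma> Q)) (veq ys xs)))"
| RI: "wf_ode ode \<Longrightarrow> has_clock ode \<Longrightarrow> xs = map fst ode \<Longrightarrow> fresh_vars ys ode (FV P) \<Longrightarrow>
    axiom_C1 (Iff (Box (Ode ode TT) P)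
                  (Alls ys (Box (Ode ode (Or P (veq xs ys)))
                     (Imp (veq xs ys) (And P (Dia (Ode ode P) (Neg (veq xs ys))))))))"


section \<open>Sequent calculus\<close>

text \<open>\<open>derives A H \<Gamma> \<phi>\<close>: the sequent \<open>\<Gamma> \<turnstile> \<phi>\<close> has a derivation from the axioms \<open>A\<close> whose open leaves
  are sequents in \<open>H\<close>. A rule is derived if its conclusion is derivable with its premises as \<open>H\<close>.
  As \<open>H\<close> consists of whole sequents, generalization and \<open>Goedel\<close> apply to its members.\<close>

inductive derives ::
  "(fml \<Rightarrow> bool) \<Rightarrow> (fml list \<times> fml) set \<Rightarrow> fml list \<Rightarrow> fml \<Rightarrow> bool"
  for A :: "fml \<Rightarrow> bool" and H :: "(fml list \<times> fml) set" where
  Premise: "(\<Gamma>, \<phi>) \<in> H \<Longrightarrow> derives A H \<Gamma> \<phi>"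
| Axiom: "A \<phi> \<Longrightarrow> derives A H \<Gamma> \<phi>"
| Id: "\<phi> \<in> set \<Gamma> \<Longrightarrow> derives A H \<Gamma> \<phi>"
| Weaken: "derives A H \<Gamma> \<phi> \<Longrightarrow> set \<Gamma> \<subseteq> set \<Delta> \<Longrightarrow> derives A H \<Delta> \<phi>"
| Cut: "derives A H \<Gamma> \<phi> \<Longrightarrow> derives A H (\<phi> # \<Gamma>) \<psi> \<Longrightarrow> derives A H \<Gamma> \<psi>"
| Classical: "derives A H (Neg \<phi> # \<Gamma>) FF \<Longrightarrow> derives A H \<Gamma> \<phi>"
| NegL: "derives A H \<Gamma> \<phi> \<Longrightarrow> derives A H (Neg \<phi> # \<Gamma>) \<psi>"
| NegR: "derives A H (\<phi> # \<Gamma>) FF \<Longrightarrow> derives A H \<Gamma> (Neg \<phi>)"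
| AndL: "derives A H (\<phi> # \<psi> # \<Gamma>) \<chi> \<Longrightarrow> derives A H (And \<phi> \<psi> # \<Gamma>) \<chi>"
| AndR: "derives A H \<Gamma> \<phi> \<Longrightarrow> derives A H \<Gamma> \<psi> \<Longrightarrow> derives A H \<Gamma> (And \<phi> \<psi>)"
| OrL: "derives A H (\<phi> # \<Gamma>) \<chi> \<Longrightarrow> derives A H (\<psi> # \<Gamma>) \<chi> \<Longrightarrow> derives A H (Or \<phi> \<psi> # \<Gamma>) \<chi>"
| OrR1: "derives A H \<Gamma> \<phi> \<Longrightarrow> derives A H \<Gamma> (Or \<phi> \<psi>)"
| OrR2: "derives A H \<Gamma> \<psi> \<Longrightarrow> derives A H \<Gamma> (Or \<phi> \<psi>)"
| ImpL: "derives A H \<Gamma> \<phi> \<Longrightarrow> derives A H (\<psi> # \<Gamma>) \<chi> \<Longrightarrow> derives A H (Imp \<phi> \<psi> # \<Gamma>) \<chi>"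
| ImpR: "derives A H (\<phi> # \<Gamma>) \<psi> \<Longrightarrow> derives A H \<Gamma> (Imp \<phi> \<psi>)"
| IffL: "derives A H (Imp \<phi> \<psi> # Imp \<psi> \<phi> # \<Gamma>) \<chi> \<Longrightarrow> derives A H (Iff \<phi> \<psi> # \<Gamma>) \<chi>"
| IffR: "derives A H \<Gamma> (Imp \<phi> \<psi>) \<Longrightarrow> derives A H \<Gamma> (Imp \<psi> \<phi>) \<Longrightarrow> derives A H \<Gamma> (Iff \<phi> \<psi>)"
| AllL: "fadm (sub1 x e) \<phi> \<Longrightarrow> derives A H (fsubst (sub1 x e) \<phi> # \<Gamma>) \<chi> \<Longrightarrow>
    derives A H (All x \<phi> # \<Gamma>) \<chi>"
| AllR: "fadm (sub1 x (tvar y)) \<phi> \<Longrightarrow> y \<notin> FV (All x \<phi>) \<union> \<Union>(FV ` set \<Gamma>) \<Longrightarrow>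
    derives A H \<Gamma> (fsubst (sub1 x (tvar y)) \<phi>) \<Longrightarrow> derives A H \<Gamma> (All x \<phi>)"
| ExL: "fadm (sub1 x (tvar y)) \<phi> \<Longrightarrow> y \<notin> FV (Ex x \<phi>) \<union> \<Union>(FV ` set \<Gamma>) \<union> FV \<chi> \<Longrightarrow>
    derives A H (fsubst (sub1 x (tvar y)) \<phi> # \<Gamma>) \<chi> \<Longrightarrow> derives A H (Ex x \<phi> # \<Gamma>) \<chi>"
| ExR: "fadm (sub1 x e) \<phi> \<Longrightarrow> derives A H \<Gamma> (fsubst (sub1 x e) \<phi>) \<Longrightarrow> derives A H \<Gamma> (Ex x \<phi>)"
| Goedel: "derives A H [] \<phi> \<Longrightarrow> derives A H \<Gamma> (Box \<alpha> \<phi>)"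

end

theory Submission
  imports Defs
begin

text \<open>
  By real induction it suffices that the solution makes some progress inside \<open>P\<close> from every state of
  \<open>P\<close>, and that it cannot leave \<open>P\<close> at a state outside of it. The second condition turns into local
  progress inside \<open>\<not>P\<close> for the time-reversed equation: by (Dadj) a run reaching a state \<open>y\<close> outside
  \<open>P\<close> can be run backwards from \<open>y\<close>, and by (Uniq) it would have to agree with a run staying in
  \<open>\<not>P\<close>, while all its states except \<open>y\<close> lie in \<open>P\<close>. Two clocks, \<open>t' = 1\<close> and \<open>s' = -1\<close>, are added
  so that the reversed equation has a clock as well.

  Local progress into \<open>p > 0\<close> follows from the sign of the first nonvanishing Lie derivative of \<open>p\<close>,
  by (Cont) for that derivative and (DI) down to \<open>p\<close>. If all Lie derivatives below the rank vanish,
  then \<open>p\<close> stays \<open>0\<close>: the sum \<open>S\<close> of their squares satisfies \<open>S' \<le> g S\<close> for a polynomial \<open>g\<close>, by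
  the cofactors that the definition of the rank provides. Those exist because polynomial rings are
  Noetherian.
\<close>


section \<open>Polynomial terms\<close>

text \<open>(Cont) needs a strict inequality at the start, but \<open>Prog_gt\<close> also admits
  starts with \<open>p = 0\<close> and a positive derivative of higher order. Local progress of a
  literal is therefore stated for \<open>Or \<phi> at_start\<close>, which exempts the starting
  point. (DI) alone yields only \<open>p >= 0\<close>; strictness away from the start is gained by
  working with \<open>p\<close> minus a power of the squared distance from the start. The premises
  speak of \<open>f\<close> and of the variables \<open>x\<close>, while the argument runs on the
  system with clocks and on its reversal in renamed variables. Ranks are not computed anew for these
  systems: a sequence of Lie derivatives is carried over together with its cofactors, because
  substitution is a ring homomorphism that commutes with the Lie derivative on the polynomials
  concerned. Between the modal steps there is only propositional logic and real arithmetic. It is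
  settled by a completeness argument that reads modal formulas as propositional letters, so that a
  semantic condition is all that has to be checked.\<close>

definition peval :: "(rat \<Rightarrow> 'a::comm_ring_1) \<Rightarrow> (nat \<Rightarrow> 'a) \<Rightarrow> trm \<Rightarrow> 'a" where
  "peval h \<sigma> p = (\<Sum>m\<in>Poly_Mapping.keys p. h (Poly_Mapping.lookup p m) *
     (\<Prod>x\<in>Poly_Mapping.keys m. \<sigma> x ^ Poly_Mapping.lookup m x))"

lemma teval_peval: "teval p \<omega> = peval of_rat \<omega> p"
  by (simp add: teval_def peval_def)

lemma tsubst_peval: "tsubst \<sigma> p = peval (Poly_Mapping.single 0) \<sigma> p"
  by (simp add: tsubst_def peval_def)

lemma monomial_power_add:
  fixes \<sigma> :: "nat \<Rightarrow> 'a::comm_monoid_mult"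
  shows "(\<Prod>x\<in>Poly_Mapping.keys (m + n). \<sigma> x ^ Poly_Mapping.lookup (m + n) x) =
    (\<Prod>x\<in>Poly_Mapping.keys m. \<sigma> x ^ Poly_Mapping.lookup m x) *
    (\<Prod>x\<in>Poly_Mapping.keys n. \<sigma> x ^ Poly_Mapping.lookup n x)"
proof -
  let ?S = "Poly_Mapping.keys m \<union> Poly_Mapping.keys n"
  have *: "(\<Prod>x\<in>Poly_Mapping.keys l. \<sigma> x ^ Poly_Mapping.lookup l x) =
      (\<Prod>x\<in>?S. \<sigma> x ^ Poly_Mapping.lookup l x)" if "Poly_Mapping.keys l \<subseteq> ?S" for l
    using that by (intro prod.mono_neutral_left) (auto simp: in_keys_iff)
  show ?thesis
    using *[of m] *[of n] *[OF keys_add]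
    by (simp add: lookup_add power_add prod.distrib)
qed

text \<open>\<open>teval\<close> maps coefficients into the reals and \<open>tsubst\<close> into
  constant polynomials; both are evaluations along such an \<open>h\<close>, so the homomorphism
  laws are proved once for both.\<close>

locale rat_hom =
  fixes h :: "rat \<Rightarrow> 'a::comm_ring_1"
  assumes h_add: "h (a + b) = h a + h b" and h_mult: "h (a * b) = h a * h b" and h_1: "h 1 = 1"
begin

lemma h_0: "h 0 = 0"
  using h_add[of 0 0] by simp

lemma peval_single: "peval h \<sigma> (Poly_Mapping.single m c) =
    h c * (\<Prod>x\<in>Poly_Mapping.keys m. \<sigma> x ^ Poly_Mapping.lookup m x)"
  by (simp add: peval_def h_0)

lemma peval_add: "peval h \<sigma> (p + q) = peval h \<sigma> p + peval h \<sigma> q"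
  unfolding peval_def
  by (rule setsum_keys_plus_distrib) (simp_all add: h_0 h_add algebra_simps)

end

lemma trm_monomials: "p = (\<Sum>m\<in>Poly_Mapping.keys p. Poly_Mapping.single m (Poly_Mapping.lookup p m))"
  for p :: trm
  by (rule poly_mapping_eqI)
    (simp add: lookup_sum lookup_single when_def in_keys_iff)

lemma trm_monomial_induct [consumes 1, case_names add single]:
  fixes p :: trm
  assumes V: "tvars p \<subseteq> V"
    and add: "\<And>p q. P p \<Longrightarrow> P q \<Longrightarrow> P (p + q)"
    and single: "\<And>m c. Poly_Mapping.keys m \<subseteq> V \<Longrightarrow> P (Poly_Mapping.single m c)"
  shows "P p"
proof -
  have "P (\<Sum>m\<in>S. Poly_Mapping.single m (Poly_Mapping.lookup p m))"
    if "finite S" "S \<subseteq> Poly_Mapping.keys p" for S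
    using that
  proof (induction S)
    case empty
    then show ?case using single[of 0 0] by simp
  next
    case (insert m S)
    then show ?case using V by (auto simp: tvars_def intro!: add single)
  qed
  from this[OF finite_keys subset_refl] show ?thesis
    by (subst trm_monomials) simp
qed

lemma tvar_mult_single:
  "tvar x * Poly_Mapping.single m c = Poly_Mapping.single (Poly_Mapping.single x 1 + m) c"
  by (simp add: tvar_def mult_single)

text \<open>The set \<open>V\<close> keeps track of the variables, so that the induction also serves
  statements about fresh ones.\<close>

lemma trm_induct [consumes 1, case_names const add mult]:
  fixes p :: trm
  assumes V: "tvars p \<subseteq> V"
    and const: "\<And>c. P (Poly_Mapping.single 0 c)"
    and add: "\<And>p q. P p \<Longrightarrow> P q \<Longrightarrow> P (p + q)"
    and mult: "\<And>x p. x \<in> V \<Longrightarrow> P p \<Longrightarrow> P (tvar x * p)"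
  shows "P p"
  using V
proof (induction rule: trm_monomial_induct)
  case (add p q)
  then show ?case by (rule assms(3))
next
  case (single m c)
  then show ?case
  \<comment> \<open>Induction on the total degree of the monomial.\<close>
  proof (induction "\<Sum>x\<in>Poly_Mapping.keys m. Poly_Mapping.lookup m x" arbitrary: m rule: less_induct)
    case less
    show ?case
    proof (cases "m = 0")
      case True
      then show ?thesis using const by simp
    next
      case False
      then obtain x where x: "x \<in> Poly_Mapping.keys m"
        by (metis poly_mapping_eqI ex_in_conv lookup_zero not_in_keys_iff_lookup_eq_zero)
      define n where "n = m - Poly_Mapping.single x 1"
      have m: "m = Poly_Mapping.single x 1 + n"
        using x by (intro poly_mapping_eqI)
          (auto simp: n_def lookup_add lookup_minus lookup_single when_def in_keys_iff)
      have sub: "Poly_Mapping.keys n \<subseteq> Poly_Mapping.keys m"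
        by (auto simp: n_def in_keys_iff lookup_minus)
      have "(\<Sum>y\<in>Poly_Mapping.keys n. Poly_Mapping.lookup n y) =
          (\<Sum>y\<in>Poly_Mapping.keys m. Poly_Mapping.lookup n y)"
        using sub by (intro sum.mono_neutral_left) (auto simp: in_keys_iff)
      also have "\<dots> < (\<Sum>y\<in>Poly_Mapping.keys m. Poly_Mapping.lookup m y)"
        using x by (intro sum_strict_mono_ex1)
          (auto simp: n_def lookup_minus lookup_single in_keys_iff intro!: bexI[of _ x])
      finally have "P (Poly_Mapping.single n c)"
        using less sub by blast
      then have "P (tvar x * Poly_Mapping.single n c)"
        using mult x less.prems by blast
      then show ?thesis
        by (simp only: tvar_mult_single m[symmetric])
    qed
  qed
qed

context rat_hom begin

text \<open>Multiplying by a variable only shifts exponents. With \<open>trm_induct\<close> this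
  case gives the full product law.\<close>

lemma peval_tvar_mult: "peval h \<sigma> (tvar x * p) = \<sigma> x * peval h \<sigma> p"
proof (induction rule: trm_monomial_induct[OF subset_UNIV])
  case (1 p q)
  then show ?case by (simp add: distrib_left peval_add)
next
  case (2 m c)
  show ?case
    by (simp only: tvar_mult_single peval_single monomial_power_add) (simp add: mult_ac)
qed

lemma peval_const: "peval h \<sigma> (Poly_Mapping.single 0 c) = h c"
  by (simp add: peval_single)

lemma peval_mult: "peval h \<sigma> (p * q) = peval h \<sigma> p * peval h \<sigma> q"
proof (induction p rule: trm_induct[OF subset_UNIV])
  case (1 c)
  show ?case
  proof (induction q rule: trm_induct[OF subset_UNIV])
    case (1 d)
    then show ?case by (simp add: mult_single peval_const h_mult)
  next
    case (2 p q)
    then show ?case by (simp add: distrib_left peval_add)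
  next
    case (3 x p)
    then show ?case by (simp add: peval_tvar_mult mult.left_commute)
  qed
next
  case (2 p q)
  then show ?case by (simp add: distrib_right peval_add)
next
  case (3 x p)
  then show ?case by (simp add: peval_tvar_mult mult.assoc)
qed

lemma peval_tvar: "peval h \<sigma> (tvar x) = \<sigma> x"
  using peval_tvar_mult[of \<sigma> x 1] peval_const[of \<sigma> 1] by (simp add: h_1)

lemma peval_0: "peval h \<sigma> 0 = 0"
  by (simp add: peval_def)

lemma peval_1: "peval h \<sigma> 1 = 1"
  using peval_const[of \<sigma> 1] by (simp add: h_1)

lemma peval_uminus: "peval h \<sigma> (- p) = - peval h \<sigma> p"
  using peval_add[of \<sigma> p "- p"] by (simp add: peval_0 add_eq_0_iff)

lemma peval_diff: "peval h \<sigma> (p - q) = peval h \<sigma> p - peval h \<sigma> q"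
  using peval_add[of \<sigma> p "- q"] by (simp add: peval_uminus)

lemma peval_power: "peval h \<sigma> (p ^ n) = peval h \<sigma> p ^ n"
  by (induction n) (simp_all add: peval_1 peval_mult)

lemma peval_sum: "peval h \<sigma> (sum f S) = (\<Sum>x\<in>S. peval h \<sigma> (f x))"
  by (induction S rule: infinite_finite_induct) (simp_all add: peval_0 peval_add)

lemma peval_sum_list: "peval h \<sigma> (sum_list (map f xs)) = sum_list (map (\<lambda>x. peval h \<sigma> (f x)) xs)"
  by (induction xs) (simp_all add: peval_0 peval_add)

end

interpretation rat_hom_real: rat_hom "of_rat :: rat \<Rightarrow> real"
  by unfold_locales (simp_all add: of_rat_add of_rat_mult)

interpretation rat_hom_trm: rat_hom "Poly_Mapping.single 0 :: rat \<Rightarrow> trm"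
  by unfold_locales (simp_all add: single_add mult_single)

lemmas teval_simps [simp] =
  rat_hom_real.peval_add[folded teval_peval] rat_hom_real.peval_mult[folded teval_peval]
  rat_hom_real.peval_tvar[folded teval_peval] rat_hom_real.peval_const[folded teval_peval]
  rat_hom_real.peval_0[folded teval_peval] rat_hom_real.peval_1[folded teval_peval]
  rat_hom_real.peval_uminus[folded teval_peval] rat_hom_real.peval_diff[folded teval_peval]
  rat_hom_real.peval_power[folded teval_peval] rat_hom_real.peval_sum[folded teval_peval]
  rat_hom_real.peval_sum_list[folded teval_peval]

lemmas tsubst_simps [simp] =
  rat_hom_trm.peval_add[folded tsubst_peval] rat_hom_trm.peval_mult[folded tsubst_peval]
  rat_hom_trm.peval_tvar[folded tsubst_peval] rat_hom_trm.peval_const[folded tsubst_peval]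
  rat_hom_trm.peval_0[folded tsubst_peval] rat_hom_trm.peval_1[folded tsubst_peval]
  rat_hom_trm.peval_uminus[folded tsubst_peval] rat_hom_trm.peval_sum_list[folded tsubst_peval]

lemma tsubst_tvar [simp]: "tsubst tvar p = p"
  by (induction rule: trm_induct[OF subset_UNIV]) simp_all

lemma teval_tsubst [simp]: "teval (tsubst \<sigma> p) \<omega> = teval p (\<lambda>x. teval (\<sigma> x) \<omega>)"
  by (induction p rule: trm_induct[OF subset_UNIV]) simp_all

section \<open>Variables occurring in a term\<close>

lemma tvars_0 [simp]: "tvars 0 = {}"
  and tvars_const [simp]: "tvars (Poly_Mapping.single 0 c) = {}"
  and tvars_1 [simp]: "tvars 1 = {}"
  and tvars_tvar [simp]: "tvars (tvar x) = {x}"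
  and tvars_uminus [simp]: "tvars (- p) = tvars p"
proof -
  have "Poly_Mapping.keys (- p) = Poly_Mapping.keys p"
    by (simp add: set_eq_iff in_keys_iff)
  then show "tvars (- p) = tvars p"
    by (simp add: tvars_def)
qed (simp_all add: tvars_def tvar_def)

lemma tvars_add: "tvars p \<subseteq> V \<Longrightarrow> tvars q \<subseteq> V \<Longrightarrow> tvars (p + q) \<subseteq> V"
  using keys_add[of p q] unfolding tvars_def by blast

lemma tvars_diff: "tvars p \<subseteq> V \<Longrightarrow> tvars q \<subseteq> V \<Longrightarrow> tvars (p - q) \<subseteq> V"
  using tvars_add[of p V "- q"] by simp

lemma tvars_mult:
  assumes "tvars p \<subseteq> V" "tvars q \<subseteq> V"
  shows "tvars (p * q) \<subseteq> V"
proof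
  fix x assume "x \<in> tvars (p * q)"
  then obtain m where m: "m \<in> Poly_Mapping.keys (p * q)" "x \<in> Poly_Mapping.keys m"
    by (auto simp: tvars_def)
  then obtain a b where ab: "m = a + b" "a \<in> Poly_Mapping.keys p" "b \<in> Poly_Mapping.keys q"
    using subsetD[OF keys_mult m(1)] by auto
  then have "x \<in> Poly_Mapping.keys a \<union> Poly_Mapping.keys b"
    using m(2) subsetD[OF keys_add, of x a b] by simp
  then show "x \<in> V" using ab assms by (auto simp: tvars_def)
qed

lemma tvars_sum: "(\<And>x. x \<in> S \<Longrightarrow> tvars (f x) \<subseteq> V) \<Longrightarrow> tvars (sum f S) \<subseteq> V"
  by (induction S rule: infinite_finite_induct) (simp_all add: tvars_add)

lemma tvars_sum_list: "(\<And>x. x \<in> set xs \<Longrightarrow> tvars (f x) \<subseteq> V) \<Longrightarrow> tvars (sum_list (map f xs)) \<subseteq> V"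
  by (induction xs) (simp_all add: tvars_add)

lemma finite_tvars [simp]: "finite (tvars p)"
  by (simp add: tvars_def)

section \<open>Partial and Lie derivatives\<close>

lemma partial_add [simp]: "partial x (p + q) = partial x p + partial x q"
  unfolding partial_def
  by (rule setsum_keys_plus_distrib) (simp_all only: distrib_right single_add mult_zero_left single_zero)

lemma partial_single: "partial x (Poly_Mapping.single m c) =
    Poly_Mapping.single (m - Poly_Mapping.single x 1) (c * of_nat (Poly_Mapping.lookup m x))"
  by (simp add: partial_def)

lemma partial_const [simp]: "partial x (Poly_Mapping.single 0 c) = 0"
  by (simp add: partial_single)

lemma single_diff_cancel:
  fixes m :: "nat \<Rightarrow>\<^sub>0 nat"
  assumes "Poly_Mapping.lookup m x \<noteq> 0"
  shows "Poly_Mapping.single x 1 + (m - Poly_Mapping.single x 1) = m"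
proof (rule poly_mapping_eqI)
  fix k
  show "Poly_Mapping.lookup (Poly_Mapping.single x 1 + (m - Poly_Mapping.single x 1)) k =
      Poly_Mapping.lookup m k"
    using assms by (cases "k = x") (simp_all add: lookup_add lookup_minus lookup_single)
qed

lemma single_add_diff_commute:
  fixes m :: "nat \<Rightarrow>\<^sub>0 nat"
  assumes "Poly_Mapping.lookup m x \<noteq> 0"
  shows "l + m - Poly_Mapping.single x 1 = l + (m - Poly_Mapping.single x 1)"
proof (rule poly_mapping_eqI)
  fix k
  show "Poly_Mapping.lookup (l + m - Poly_Mapping.single x 1) k =
      Poly_Mapping.lookup (l + (m - Poly_Mapping.single x 1)) k"
    using assms by (cases "k = x") (simp_all add: lookup_add lookup_minus lookup_single)
qed

text \<open>Exponents can be compared directly here, and the general product rule follows by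
  \<open>trm_induct\<close>. If \<open>x\<close> occurs in the monomial, truncated subtraction of
  exponents is exact; if not, the derivative of the monomial has coefficient
  \<open>0\<close>.\<close>

lemma partial_tvar_mult:
  "partial x (tvar y * p) = (if x = y then p else 0) + tvar y * partial x p"
proof (induction p rule: trm_monomial_induct[OF subset_UNIV])
  case (1 p q)
  then show ?case by (simp add: distrib_left)
next
  case (2 m c)
  show ?case
  proof (cases "Poly_Mapping.lookup m x = 0")
    case True
    then show ?thesis
      by (auto simp: tvar_mult_single partial_single lookup_add lookup_single)
  next
    case False
    show ?thesis
    proof (cases "x = y")
      case True
      then show ?thesis
        using single_diff_cancel[OF False] single_add_diff_commute[OF False, of "Poly_Mapping.single x 1"]
        by (simp add: tvar_mult_single partial_single lookup_add distrib_left single_add add.commute)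
    next
      case neq: False
      then show ?thesis
        using single_add_diff_commute[OF False, of "Poly_Mapping.single y 1"]
        by (simp add: tvar_mult_single partial_single lookup_add lookup_single)
    qed
  qed
qed

lemma partial_mult: "partial x (p * q) = partial x p * q + p * partial x q"
proof (induction p rule: trm_induct[OF subset_UNIV])
  case (1 c)
  show ?case
  proof (induction q rule: trm_induct[OF subset_UNIV])
    case (1 d)
    then show ?case by (simp add: mult_single)
  next
    case (2 p q)
    then show ?case by (simp add: distrib_left)
  next
    case (3 y p)
    have "Poly_Mapping.single 0 c * (tvar y * p) = tvar y * (Poly_Mapping.single 0 c * p)"
      by (simp add: mult_ac)
    then show ?case using 3 by (simp only: partial_tvar_mult) (simp add: algebra_simps)
  qed
next
  case (2 p p')
  then show ?case by (simp add: algebra_simps)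
next
  case (3 y p)
  then show ?case by (simp add: mult.assoc partial_tvar_mult) (simp add: algebra_simps)
qed

lemma partial_tvar [simp]: "partial x (tvar y) = (if x = y then 1 else 0)"
  using partial_tvar_mult[of x y 1] partial_const[of x 1] by simp

lemma partial_fresh: "x \<notin> tvars p \<Longrightarrow> partial x p = 0"
  unfolding partial_def tvars_def by (intro sum.neutral) (auto simp: in_keys_iff)

lemma partial_diff [simp]: "partial x (p - q) = partial x p - partial x q"
  using partial_add[of x "p - q" q] by (simp add: algebra_simps)

lemma tvars_partial: "tvars p \<subseteq> V \<Longrightarrow> tvars (partial x p) \<subseteq> V"
  unfolding partial_def
proof (intro tvars_sum)
  fix m assume "tvars p \<subseteq> V" and m: "m \<in> Poly_Mapping.keys p"
  moreover have "Poly_Mapping.keys (m - Poly_Mapping.single x 1) \<subseteq> Poly_Mapping.keys m"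
    by (auto simp: in_keys_iff lookup_minus)
  ultimately show "tvars (Poly_Mapping.single (m - Poly_Mapping.single x 1)
      (Poly_Mapping.lookup p m * of_nat (Poly_Mapping.lookup m x))) \<subseteq> V"
    unfolding tvars_def by auto
qed

lemma lie_add [simp]: "lie ode (p + q) = lie ode p + lie ode q"
  by (induction ode) (auto simp: lie_def algebra_simps)

lemma lie_diff [simp]: "lie ode (p - q) = lie ode p - lie ode q"
  by (induction ode) (auto simp: lie_def algebra_simps)

lemma lie_0 [simp]: "lie ode 0 = 0"
  using lie_diff[of ode 0 0] by simp

lemma lie_uminus [simp]: "lie ode (- p) = - lie ode p"
  using lie_diff[of ode 0 p] by simp

lemma lie_sum [simp]: "lie ode (sum f S) = (\<Sum>x\<in>S. lie ode (f x))"
  by (induction S rule: infinite_finite_induct) simp_all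

lemma lie_mult: "lie ode (p * q) = lie ode p * q + p * lie ode q"
  by (induction ode) (auto simp: lie_def partial_mult algebra_simps)

lemma lie_const [simp]: "lie ode (Poly_Mapping.single 0 c) = 0"
  by (induction ode) (auto simp: lie_def)

lemma lie_1 [simp]: "lie ode 1 = 0"
  using lie_const[of ode 1] by simp

lemma lie_append: "lie (ode @ ode') p = lie ode p + lie ode' p"
  by (simp add: lie_def)

lemma lie_Nil: "lie [] p = 0" and lie_Cons: "lie ((x, e) # ode) p = partial x p * e + lie ode p"
  by (simp_all add: lie_def)

lemma lie_fresh: "ode_vars ode \<inter> tvars p = {} \<Longrightarrow> lie ode p = 0"
  by (induction ode) (auto simp: lie_def ode_vars_def partial_fresh)

lemma tvars_lie: "tvars p \<subseteq> V \<Longrightarrow> rhs_vars ode \<subseteq> V \<Longrightarrow> tvars (lie ode p) \<subseteq> V"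
  unfolding lie_def
proof (intro tvars_sum_list)
  fix xe assume V: "tvars p \<subseteq> V" "rhs_vars ode \<subseteq> V" and xe: "xe \<in> set ode"
  have "tvars (snd xe) \<subseteq> V"
    using V(2) xe by (auto simp: rhs_vars_def)
  then show "tvars (case xe of (x, e) \<Rightarrow> partial x p * e) \<subseteq> V"
    using V(1) by (simp add: case_prod_beta tvars_mult tvars_partial)
qed

lemma lie_n_0 [simp]: "lie_n ode 0 p = p"
  and lie_n_Suc: "lie_n ode (Suc i) p = lie ode (lie_n ode i p)"
  by (simp_all add: lie_n_def)

lemma tvars_lie_n: "tvars p \<subseteq> V \<Longrightarrow> rhs_vars ode \<subseteq> V \<Longrightarrow> tvars (lie_n ode i p) \<subseteq> V"
  by (induction i) (simp_all add: lie_n_Suc tvars_lie)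


section \<open>Existence of the rank\<close>

lemma nat_mono_subseq:
  fixes f :: "nat \<Rightarrow> nat"
  shows "\<exists>s :: nat \<Rightarrow> nat. strict_mono s \<and> mono (\<lambda>i. f (s i))"
proof -
  obtain s where s: "strict_mono s" "monoseq (\<lambda>n. f (s n))"
    using seq_monosub[of f] by auto
  from s(2) consider (inc) "\<And>m n. m \<le> n \<Longrightarrow> f (s m) \<le> f (s n)"
    | (dec) "\<And>m n. m \<le> n \<Longrightarrow> f (s n) \<le> f (s m)"
    unfolding monoseq_def by blast
  then show ?thesis
  proof cases
    case inc
    then show ?thesis using s(1) by (auto simp: mono_def)
  next
    case dec
    \<comment> \<open>A nonincreasing sequence of naturals is constant once it has reached its
      minimum.\<close>
    obtain k where k: "\<And>n. f (s k) \<le> f (s n)"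
      using ex_has_least_nat[of "\<lambda>_. True" 0 "\<lambda>n. f (s n)"] by auto
    have "f (s (k + n)) = f (s k)" for n
      using dec[of k "k + n"] k[of "k + n"] by simp
    moreover have "strict_mono (\<lambda>n. s (k + n))"
      using s(1) by (simp add: strict_mono_def)
    ultimately show ?thesis
      by (intro exI[of _ "\<lambda>n. s (k + n)"]) (simp add: mono_def)
  qed
qed

text \<open>Refine once per variable; monotonicity already achieved survives passing to a
  subsequence.\<close>

lemma mono_subseq_finite:
  fixes f :: "nat \<Rightarrow> 'a \<Rightarrow> nat"
  assumes "finite V"
  shows "\<exists>s :: nat \<Rightarrow> nat. strict_mono s \<and> (\<forall>x\<in>V. mono (\<lambda>i. f (s i) x))"
  using assms
proof (induction V)
  case empty
  then show ?case by (auto intro: exI[of _ id] simp: strict_mono_def)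
next
  case (insert x V)
  then obtain s :: "nat \<Rightarrow> nat" where s: "strict_mono s" "\<forall>x\<in>V. mono (\<lambda>i. f (s i) x)"
    by blast
  obtain t :: "nat \<Rightarrow> nat" where t: "strict_mono t" "mono (\<lambda>i. f (s (t i)) x)"
    using nat_mono_subseq[of "\<lambda>i. f (s i) x"] by blast
  have "mono (\<lambda>i. f (s (t i)) y)" if "y \<in> V" for y
    using s(2) that strict_mono_mono[OF t(1)] by (auto simp: mono_def)
  then show ?case
    using s(1) t by (intro exI[of _ "\<lambda>i. s (t i)"]) (auto simp: strict_mono_def)
qed

text \<open>Along a common monotone subsequence any two members are comparable; variables outside
  \<open>V\<close> have exponent \<open>0\<close>.\<close>

lemma dickson:
  fixes m :: "nat \<Rightarrow> nat \<Rightarrow>\<^sub>0 nat"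
  assumes "finite V" "\<And>i. Poly_Mapping.keys (m i) \<subseteq> V"
  shows "\<exists>i j. i < j \<and> (\<forall>x. Poly_Mapping.lookup (m i) x \<le> Poly_Mapping.lookup (m j) x)"
proof -
  obtain s :: "nat \<Rightarrow> nat" where s: "strict_mono s" "\<forall>x\<in>V. mono (\<lambda>i. Poly_Mapping.lookup (m (s i)) x)"
    using mono_subseq_finite[OF assms(1), of "\<lambda>i. Poly_Mapping.lookup (m i)"] by blast
  have "Poly_Mapping.lookup (m (s 0)) x \<le> Poly_Mapping.lookup (m (s 1)) x" for x
  proof (cases "x \<in> V")
    case True
    then show ?thesis using s(2) by (auto dest!: bspec monoD[of _ 0 1])
  next
    case False
    then have "x \<notin> Poly_Mapping.keys (m (s 0))" using assms(2) by blast
    then show ?thesis by (simp add: in_keys_iff)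
  qed
  moreover have "s 0 < s 1" using s(1) by (simp add: strict_mono_def)
  ultimately show ?thesis by blast
qed

section \<open>The lexicographic monomial order\<close>

lemma monomial_nonneg: "0 \<le> (m :: nat \<Rightarrow>\<^sub>0 nat)"
proof (cases "m = 0")
  case False
  then have "Poly_Mapping.keys m \<noteq> {}"
    by (metis empty_iff in_keys_iff lookup_zero poly_mapping_eqI)
  \<comment> \<open>The order compares exponents at the least variable where they differ; against
    \<open>0\<close> this is the least variable of \<open>m\<close>.\<close>
  then have k: "Min (Poly_Mapping.keys m) \<in> Poly_Mapping.keys m"
    by simp
  have "less_fun (Poly_Mapping.lookup 0) (Poly_Mapping.lookup m)"
    unfolding less_fun_def
  proof (intro exI conjI allI impI)
    show "Poly_Mapping.lookup 0 (Min (Poly_Mapping.keys m)) <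
        Poly_Mapping.lookup m (Min (Poly_Mapping.keys m))"
      using k by (simp add: in_keys_iff)
    fix l assume "l < Min (Poly_Mapping.keys m)"
    then have "l \<notin> Poly_Mapping.keys m"
      by (meson Min_le finite_keys not_le)
    then show "Poly_Mapping.lookup 0 l = Poly_Mapping.lookup m l"
      by (simp add: in_keys_iff)
  qed
  then have "0 < m" by (simp add: less_poly_mapping.rep_eq)
  then show ?thesis by simp
qed simp

text \<open>Divisibility implies \<open>\<le>\<close>, since \<open>0\<close> is least and the order
  is compatible with addition.\<close>

lemma monomial_le:
  fixes m n :: "nat \<Rightarrow>\<^sub>0 nat"
  assumes "\<And>x. Poly_Mapping.lookup m x \<le> Poly_Mapping.lookup n x"
  obtains d where "n = d + m" "m \<le> n" "Poly_Mapping.keys d \<subseteq> Poly_Mapping.keys n"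
proof
  show *: "n = (n - m) + m"
    using assms by (intro poly_mapping_eqI) (simp add: lookup_add lookup_minus)
  show "m \<le> n"
    using add_right_mono[OF monomial_nonneg, of m "n - m"] * by simp
  show "Poly_Mapping.keys (n - m) \<subseteq> Poly_Mapping.keys n"
    by (auto simp: in_keys_iff lookup_minus)
qed

text \<open>With infinitely many variables the lexicographic order is not well-founded. Over a
  finite \<open>V\<close> an infinite descent would by \<open>dickson\<close> contain an earlier
  monomial dividing a later one, contradicting \<open>monomial_le\<close>.\<close>

lemma monomial_minimal:
  fixes A :: "(nat \<Rightarrow>\<^sub>0 nat) set"
  assumes "finite V" "\<And>m. m \<in> A \<Longrightarrow> Poly_Mapping.keys m \<subseteq> V" "A \<noteq> {}"
  obtains m where "m \<in> A" "\<And>n. n \<in> A \<Longrightarrow> m \<le> n"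
proof -
  have "\<exists>m\<in>A. \<forall>n\<in>A. m \<le> n"
  proof (rule ccontr)
    assume "\<not> ?thesis"
    then have "\<forall>m\<in>A. \<exists>n\<in>A. n < m" by (meson not_le)
    then obtain g where g: "\<And>m. m \<in> A \<Longrightarrow> g m \<in> A \<and> g m < m" by metis
    obtain a where a: "a \<in> A" using assms(3) by blast
    define f where "f i = (g ^^ i) a" for i
    have f: "f i \<in> A" for i
      by (induction i) (use a g in \<open>auto simp: f_def\<close>)
    have "f (Suc i) < f i" for i
      using g f[of i] by (simp add: f_def)
    then have desc: "i < j \<Longrightarrow> f j < f i" for i j
      by (induction j) (auto simp: less_Suc_eq intro: less_trans)
    obtain i j where ij: "i < j" "\<And>x. Poly_Mapping.lookup (f i) x \<le> Poly_Mapping.lookup (f j) x"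
      using dickson[of V f] assms f by blast
    then have "f i \<le> f j" by (metis monomial_le)
    then show False using desc[OF ij(1)] by simp
  qed
  then show ?thesis using that by blast
qed

section \<open>Leading monomials and the Noetherian property\<close>

lemma lookup_single_mult:
  fixes q :: trm
  shows "Poly_Mapping.lookup (Poly_Mapping.single d c * q) (d + n) = c * Poly_Mapping.lookup q n"
proof (induction rule: trm_monomial_induct[OF subset_UNIV])
  case (1 p q)
  then show ?case by (simp add: distrib_left lookup_add)
next
  case (2 m e)
  then show ?case by (simp add: mult_single lookup_single when_def)
qed

lemma keys_single_mult:
  fixes q :: trm
  assumes "k \<in> Poly_Mapping.keys (Poly_Mapping.single d c * q)"
  obtains n where "k = d + n" "n \<in> Poly_Mapping.keys q"
  using subsetD[OF keys_mult assms] by (auto split: if_splits)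

text \<open>Each \<open>r N\<close> is a representative of \<open>p N\<close> modulo the ideal of its predecessors with least
  possible leading monomial. If that of \<open>r a\<close> divides that of \<open>r b\<close> with \<open>a < b\<close>, a multiple of
  \<open>r a\<close> cancels the leading monomial of \<open>r b\<close>.\<close>

lemma noetherian:
  fixes p :: "nat \<Rightarrow> trm"
  assumes V: "finite V" "\<And>i. tvars (p i) \<subseteq> V"
  shows "\<exists>N\<ge>1. \<exists>g. p N = (\<Sum>i<N. g i * p i)"
proof (rule ccontr)
  assume contra: "\<not> ?thesis"
  define R where "R N = {r. tvars r \<subseteq> V \<and> (\<exists>g. r = p N - (\<Sum>i<N. g i * p i))}" for N
  define lm :: "trm \<Rightarrow> nat \<Rightarrow>\<^sub>0 nat" where "lm r = Max (Poly_Mapping.keys r)" for r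
  \<comment> \<open>\<open>contra\<close> excludes a vanishing representative only for indices at
    least \<open>1\<close>, hence \<open>Suc N\<close> throughout.\<close>
  have nz: "Poly_Mapping.keys r \<noteq> {}" if "r \<in> R (Suc N)" for r N
  proof
    assume "Poly_Mapping.keys r = {}"
    then have "r = 0" by (metis empty_iff in_keys_iff lookup_zero poly_mapping_eqI)
    with that contra show False by (auto simp: R_def simp del: sum.lessThan_Suc)
  qed
  have lm_in: "lm r \<in> Poly_Mapping.keys r" if "r \<in> R (Suc N)" for r N
    using nz[OF that] by (simp add: lm_def)
  have lm_V: "Poly_Mapping.keys (lm r) \<subseteq> V" if "r \<in> R (Suc N)" for r N
    using lm_in[OF that] that by (auto simp: R_def tvars_def)
  have "\<exists>r\<in>R (Suc N). \<forall>r'\<in>R (Suc N). lm r \<le> lm r'" for N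
  proof -
    have "p (Suc N) \<in> R (Suc N)"
      using V(2) by (auto simp: R_def simp del: sum.lessThan_Suc intro!: exI[of _ "\<lambda>_. 0"])
    then have "lm ` R (Suc N) \<noteq> {}" by blast
    then obtain m where "m \<in> lm ` R (Suc N)" "\<And>n. n \<in> lm ` R (Suc N) \<Longrightarrow> m \<le> n"
      by (rule monomial_minimal[OF V(1), rotated]) (auto dest: lm_V)
    then show ?thesis by (metis imageE imageI)
  qed
  then obtain r where r: "\<And>N. r N \<in> R (Suc N)" "\<And>N r'. r' \<in> R (Suc N) \<Longrightarrow> lm (r N) \<le> lm r'"
    by metis
  obtain a b where ab: "a < b"
    "\<And>x. Poly_Mapping.lookup (lm (r a)) x \<le> Poly_Mapping.lookup (lm (r b)) x"
    using dickson[of V "\<lambda>N. lm (r N)"] V(1) lm_V r(1) by blast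
  obtain d where d: "lm (r b) = d + lm (r a)" "Poly_Mapping.keys d \<subseteq> Poly_Mapping.keys (lm (r b))"
    using monomial_le[OF ab(2)] by blast
  \<comment> \<open>The quotient of the leading coefficients, chosen so that the leading terms
    cancel in \<open>r'\<close>.\<close>
  define c where "c = Poly_Mapping.lookup (r b) (lm (r b)) / Poly_Mapping.lookup (r a) (lm (r a))"
  define r' where "r' = r b - Poly_Mapping.single d c * r a"
  have "r' \<in> R (Suc b)"
  proof -
    obtain ga where ga: "r a = p (Suc a) - (\<Sum>i<Suc a. ga i * p i)"
      using r(1)[of a] by (auto simp: R_def simp del: sum.lessThan_Suc)
    obtain gb where gb: "r b = p (Suc b) - (\<Sum>i<Suc b. gb i * p i)"
      using r(1)[of b] by (auto simp: R_def simp del: sum.lessThan_Suc)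
    \<comment> \<open>The coefficients that write \<open>r a\<close> over
      \<open>p 0, ..., p (Suc a)\<close>; as \<open>a < b\<close>, all of these precede
      \<open>p (Suc b)\<close>.\<close>
    let ?h = "\<lambda>i. if i = Suc a then 1 else if i < Suc a then - ga i else 0"
    have "(\<Sum>i<Suc b. ?h i * p i) = (\<Sum>i<Suc (Suc a). ?h i * p i)"
      using ab(1) by (intro sum.mono_neutral_right) auto
    also have "\<dots> = r a"
      by (subst sum.lessThan_Suc, subst sum.cong[of "{..<Suc a}" "{..<Suc a}" _ "\<lambda>i. - (ga i * p i)"])
        (simp_all add: ga sum_negf del: sum.lessThan_Suc)
    finally have "r' = p (Suc b) - (\<Sum>i<Suc b. (gb i + Poly_Mapping.single d c * ?h i) * p i)"
      by (simp only: r'_def gb distrib_right sum.distrib mult.assoc flip: sum_distrib_left)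
        (simp add: algebra_simps del: sum.lessThan_Suc)
    moreover have "tvars r' \<subseteq> V"
      unfolding r'_def using r(1)[of a] r(1)[of b] d(2) lm_V[OF r(1)[of b]]
      by (intro tvars_diff tvars_mult) (auto simp: R_def tvars_def)
    ultimately show ?thesis by (auto simp: R_def simp del: sum.lessThan_Suc)
  qed
  have le: "k \<le> lm (r N)" if "k \<in> Poly_Mapping.keys (r N)" for k N
    using that by (simp add: lm_def)
  have "k < lm (r b)" if k: "k \<in> Poly_Mapping.keys r'" for k
  proof -
    have "k \<in> Poly_Mapping.keys (r b) \<or> k \<in> Poly_Mapping.keys (Poly_Mapping.single d c * r a)"
      using k by (auto simp: r'_def in_keys_iff lookup_minus)
    then have "k \<le> lm (r b)"
    proof
      assume "k \<in> Poly_Mapping.keys (Poly_Mapping.single d c * r a)"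
      then obtain n where "k = d + n" "n \<in> Poly_Mapping.keys (r a)"
        by (rule keys_single_mult)
      then show ?thesis using add_left_mono[OF le] by (simp add: d(1))
    qed (rule le)
    moreover have "Poly_Mapping.lookup r' (lm (r b)) = 0"
      using lm_in[OF r(1)[of a]]
      by (simp add: r'_def lookup_minus) (simp add: d(1) lookup_single_mult c_def in_keys_iff)
    then have "k \<noteq> lm (r b)" using k by (auto simp: in_keys_iff)
    ultimately show ?thesis by simp
  qed
  then have "lm r' < lm (r b)"
    using lm_in[OF \<open>r' \<in> R (Suc b)\<close>] by blast
  then show False using r(2)[OF \<open>r' \<in> R (Suc b)\<close>] by simp
qed

text \<open>All iterated Lie derivatives live over the finitely many variables of \<open>p\<close>
  and of the right-hand sides, so \<open>noetherian\<close> applies and the \<open>LEAST\<close> in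
  the definition of the rank is attained.\<close>

lemma lie_rank:
  shows lie_rank_ge_1: "lie_rank ode p \<ge> 1"
    and lie_rank_cofactors: "\<exists>g. lie_n ode (lie_rank ode p) p =
      (\<Sum>i<lie_rank ode p. g i * lie_n ode i p)"
proof -
  have "finite (tvars p \<union> rhs_vars ode)" by (simp add: rhs_vars_def)
  from noetherian[OF this, of "\<lambda>i. lie_n ode i p"]
  have "\<exists>N. N \<ge> 1 \<and> (\<exists>g. lie_n ode N p = (\<Sum>i<N. g i * lie_n ode i p))"
    by (simp add: tvars_lie_n)
  from LeastI_ex[OF this] show "lie_rank ode p \<ge> 1"
    "\<exists>g. lie_n ode (lie_rank ode p) p = (\<Sum>i<lie_rank ode p. g i * lie_n ode i p)"
    by (simp_all add: lie_rank_def)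
qed


section \<open>Static semantics\<close>

lemma teval_cong: "(\<And>x. x \<in> tvars p \<Longrightarrow> \<omega> x = \<nu> x) \<Longrightarrow> teval p \<omega> = teval p \<nu>"
  unfolding teval_def tvars_def
  by (intro sum.cong prod.cong arg_cong2[where f = "(*)"] arg_cong2[where f = "(^)"] refl) auto

lemma teval_upd_fresh [simp]: "x \<notin> tvars p \<Longrightarrow> teval p (\<omega>(x := r)) = teval p \<omega>"
  by (rule teval_cong) auto

lemma finite_FV [simp]: "finite (FV \<phi>)" and finite_FVp [simp]: "finite (FVp \<alpha>)"
  by (induction \<phi> and \<alpha>) (simp_all add: ode_vars_def rhs_vars_def)

lemma unsub_tvar [simp]: "unsub B tvar = tvar"
  by (simp add: unsub_def)

lemma fsubst_tvar [simp]: "fsubst tvar \<phi> = \<phi>" and psubst_tvar [simp]: "psubst tvar \<alpha> = \<alpha>"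
  by (induction \<phi> and \<alpha>) simp_all

lemma no_capture_tvar [simp]: "no_capture tvar V B"
  by (simp add: no_capture_def)

lemma fadm_tvar [simp]: "fadm tvar \<phi>" and padm_tvar [simp]: "padm tvar \<alpha>"
  by (induction \<phi> and \<alpha>) simp_all

lemma sub1_tvar [simp]: "sub1 x (tvar x) = tvar"
  by (simp add: sub1_def)

lemma first_order_TT [simp]: "first_order TT" and sem_TT [simp]: "sem TT \<omega>" and FV_TT [simp]: "FV TT = {}"
  by (simp_all add: TT_def)

lemma first_order_FF [simp]: "first_order FF" and sem_FF [simp]: "\<not> sem FF \<omega>"
  by (simp_all add: FF_def)

lemma sem_Conj [simp]: "sem (Conj L) \<omega> \<longleftrightarrow> (\<forall>\<phi>\<in>set L. sem \<phi> \<omega>)"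
  by (induction L rule: Conj.induct) auto

lemma first_order_Conj [simp]: "first_order (Conj L) \<longleftrightarrow> (\<forall>\<phi>\<in>set L. first_order \<phi>)"
  by (induction L rule: Conj.induct) auto

lemma FV_Conj [simp]: "FV (Conj L) = \<Union>(FV ` set L)"
  by (induction L rule: Conj.induct) auto

lemma sem_Disj [simp]: "sem (Disj L) \<omega> \<longleftrightarrow> (\<exists>\<phi>\<in>set L. sem \<phi> \<omega>)"
  by (induction L rule: Disj.induct) auto

lemma first_order_Disj [simp]: "first_order (Disj L) \<longleftrightarrow> (\<forall>\<phi>\<in>set L. first_order \<phi>)"
  by (induction L rule: Disj.induct) auto

lemma sem_veq: "sem (veq xs ys) \<omega> \<longleftrightarrow> (\<forall>(x, y)\<in>set (zip xs ys). \<omega> x = \<omega> y)"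
  by (auto simp: veq_def)

lemma first_order_veq [simp]: "first_order (veq xs ys)"
  by (auto simp: veq_def)

lemma FV_veq: "length xs = length ys \<Longrightarrow> FV (veq xs ys) = set xs \<union> set ys"
  unfolding veq_def by (induction xs ys rule: list_induct2) auto

lemma first_order_Alls [simp]: "first_order (Alls xs \<phi>) \<longleftrightarrow> first_order \<phi>"
  by (induction xs) (simp_all add: Alls_def)

lemma FV_Alls [simp]: "FV (Alls xs \<phi>) = FV \<phi> - set xs"
  by (induction xs) (auto simp: Alls_def)

lemma sem_Alls: "sem (Alls xs \<phi>) \<omega> \<longleftrightarrow> (\<forall>\<nu>. (\<forall>x. x \<notin> set xs \<longrightarrow> \<nu> x = \<omega> x) \<longrightarrow> sem \<phi> \<nu>)"
proof (induction xs arbitrary: \<omega>)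
  case Nil
  have "\<nu> = \<omega>" if "\<forall>x. \<nu> x = \<omega> x" for \<nu> :: state
    using that by auto
  then show ?case by (auto simp: Alls_def)
next
  case (Cons x xs)
  have "sem (Alls (x # xs) \<phi>) \<omega> \<longleftrightarrow> (\<forall>r. sem (Alls xs \<phi>) (\<omega>(x := r)))"
    by (simp add: Alls_def)
  also have "\<dots> \<longleftrightarrow> (\<forall>r \<nu>. (\<forall>z. z \<notin> set xs \<longrightarrow> \<nu> z = (\<omega>(x := r)) z) \<longrightarrow> sem \<phi> \<nu>)"
    by (simp only: Cons.IH)
  also have "\<dots> \<longleftrightarrow> (\<forall>\<nu>. (\<forall>z. z \<notin> set (x # xs) \<longrightarrow> \<nu> z = \<omega> z) \<longrightarrow> sem \<phi> \<nu>)"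
  proof (intro iffI allI impI)
    fix \<nu> assume *: "\<forall>r \<nu>. (\<forall>z. z \<notin> set xs \<longrightarrow> \<nu> z = (\<omega>(x := r)) z) \<longrightarrow> sem \<phi> \<nu>"
      and "\<forall>z. z \<notin> set (x # xs) \<longrightarrow> \<nu> z = \<omega> z"
    then show "sem \<phi> \<nu>" by (intro *[rule_format, of \<nu> "\<nu> x"]) auto
  qed auto
  finally show ?case .
qed


section \<open>Derivations up to first-order arithmetic\<close>

abbreviation provable ("(_ \<turnstile>\<^bsub>_\<^esub> _)" [51, 0, 51] 50) where
  "\<Gamma> \<turnstile>\<^bsub>H\<^esub> \<phi> \<equiv> derives axiom_C1 H \<Gamma> \<phi>"

lemma C0: "axiom_C0 \<phi> \<Longrightarrow> \<Gamma> \<turnstile>\<^bsub>H\<^esub> \<phi>"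
  by (intro derives.Axiom axiom_C1.Base)

lemma weaken_Cons: "\<Gamma> \<turnstile>\<^bsub>H\<^esub> \<phi> \<Longrightarrow> \<psi> # \<Gamma> \<turnstile>\<^bsub>H\<^esub> \<phi>"
  by (erule derives.Weaken) auto

lemma ImpD:
  assumes "\<Gamma> \<turnstile>\<^bsub>H\<^esub> Imp \<phi> \<psi>"
  shows "\<phi> # \<Gamma> \<turnstile>\<^bsub>H\<^esub> \<psi>"
proof (rule derives.Cut[OF weaken_Cons[OF assms]])
  show "Imp \<phi> \<psi> # \<phi> # \<Gamma> \<turnstile>\<^bsub>H\<^esub> \<psi>"
    by (rule derives.ImpL; rule derives.Id) simp_all
qed

lemma provable_mp: "\<Gamma> \<turnstile>\<^bsub>H\<^esub> Imp \<phi> \<psi> \<Longrightarrow> \<Gamma> \<turnstile>\<^bsub>H\<^esub> \<phi> \<Longrightarrow> \<Gamma> \<turnstile>\<^bsub>H\<^esub> \<psi>"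
  by (rule derives.Cut[OF _ ImpD])

lemma exchange: "\<phi> # \<psi> # \<Gamma> \<turnstile>\<^bsub>H\<^esub> \<chi> \<Longrightarrow> \<psi> # \<phi> # \<Gamma> \<turnstile>\<^bsub>H\<^esub> \<chi>"
  by (erule derives.Weaken) auto

lemma weaken_second: "\<phi> # \<Gamma> \<turnstile>\<^bsub>H\<^esub> \<chi> \<Longrightarrow> \<phi> # \<psi> # \<Gamma> \<turnstile>\<^bsub>H\<^esub> \<chi>"
  by (erule derives.Weaken) auto

lemma Neg_cong: "\<phi> # \<Gamma> \<turnstile>\<^bsub>H\<^esub> \<psi> \<Longrightarrow> Neg \<psi> # \<Gamma> \<turnstile>\<^bsub>H\<^esub> Neg \<phi>"
  by (intro derives.NegR exchange[OF derives.NegL])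

lemma And_cong: "\<phi> # \<Gamma> \<turnstile>\<^bsub>H\<^esub> \<phi>' \<Longrightarrow> \<psi> # \<Gamma> \<turnstile>\<^bsub>H\<^esub> \<psi>' \<Longrightarrow> And \<phi> \<psi> # \<Gamma> \<turnstile>\<^bsub>H\<^esub> And \<phi>' \<psi>'"
  by (intro derives.AndL derives.AndR) (auto intro: weaken_Cons weaken_second)

lemma Or_cong: "\<phi> # \<Gamma> \<turnstile>\<^bsub>H\<^esub> \<phi>' \<Longrightarrow> \<psi> # \<Gamma> \<turnstile>\<^bsub>H\<^esub> \<psi>' \<Longrightarrow> Or \<phi> \<psi> # \<Gamma> \<turnstile>\<^bsub>H\<^esub> Or \<phi>' \<psi>'"
  by (intro derives.OrL) (auto intro: derives.OrR1 derives.OrR2)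

lemma Imp_cong: "\<phi>' # \<Gamma> \<turnstile>\<^bsub>H\<^esub> \<phi> \<Longrightarrow> \<psi> # \<Gamma> \<turnstile>\<^bsub>H\<^esub> \<psi>' \<Longrightarrow> Imp \<phi> \<psi> # \<Gamma> \<turnstile>\<^bsub>H\<^esub> Imp \<phi>' \<psi>'"
  by (intro derives.ImpR exchange[OF derives.ImpL]) (auto intro: weaken_second)

lemma Iff_cong:
  assumes "\<phi> # \<Gamma> \<turnstile>\<^bsub>H\<^esub> \<phi>'" "\<phi>' # \<Gamma> \<turnstile>\<^bsub>H\<^esub> \<phi>" "\<psi> # \<Gamma> \<turnstile>\<^bsub>H\<^esub> \<psi>'" "\<psi>' # \<Gamma> \<turnstile>\<^bsub>H\<^esub> \<psi>"
  shows "Iff \<phi> \<psi> # \<Gamma> \<turnstile>\<^bsub>H\<^esub> Iff \<phi>' \<psi>'"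
proof (intro derives.IffL derives.IffR)
  show "Imp \<phi> \<psi> # Imp \<psi> \<phi> # \<Gamma> \<turnstile>\<^bsub>H\<^esub> Imp \<phi>' \<psi>'"
    by (rule weaken_second[OF Imp_cong[OF assms(2,3)]])
  show "Imp \<phi> \<psi> # Imp \<psi> \<phi> # \<Gamma> \<turnstile>\<^bsub>H\<^esub> Imp \<psi>' \<phi>'"
    by (rule weaken_Cons[OF Imp_cong[OF assms(4,1)]])
qed

lemma provable_cases:
  assumes "\<phi> # \<Gamma> \<turnstile>\<^bsub>H\<^esub> \<chi>" "Neg \<phi> # \<Gamma> \<turnstile>\<^bsub>H\<^esub> \<chi>"
  shows "\<Gamma> \<turnstile>\<^bsub>H\<^esub> \<chi>"
  by (rule derives.Classical, rule derives.Cut[OF Neg_cong[OF assms(1)] exchange[OF derives.NegL[OF assms(2)]]])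

lemma cut_list: "(\<And>\<psi>. \<psi> \<in> set \<Delta> \<Longrightarrow> \<Gamma> \<turnstile>\<^bsub>H\<^esub> \<psi>) \<Longrightarrow> \<Delta> @ \<Gamma> \<turnstile>\<^bsub>H\<^esub> \<chi> \<Longrightarrow> \<Gamma> \<turnstile>\<^bsub>H\<^esub> \<chi>"
proof (induction \<Delta>)
  case (Cons \<psi> \<Delta>)
  have "\<Delta> @ \<Gamma> \<turnstile>\<^bsub>H\<^esub> \<psi>"
    using Cons.prems(1)[of \<psi>] by (auto elim: derives.Weaken)
  then have "\<Delta> @ \<Gamma> \<turnstile>\<^bsub>H\<^esub> \<chi>"
    using Cons.prems(2) by (simp add: derives.Cut)
  then show ?case using Cons.IH Cons.prems(1) by simp
qed simp

text \<open>\<open>msem v\<close> is the semantics with every outermost subformula outside first-order arithmetic read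
  as a propositional letter valued by \<open>v\<close>.\<close>

primrec msem :: "(fml \<Rightarrow> bool) \<Rightarrow> fml \<Rightarrow> state \<Rightarrow> bool" where
  "msem v (Eq p q) \<omega> \<longleftrightarrow> teval p \<omega> = teval q \<omega>"
| "msem v (Geq p q) \<omega> \<longleftrightarrow> teval p \<omega> \<ge> teval q \<omega>"
| "msem v (Gt p q) \<omega> \<longleftrightarrow> teval p \<omega> > teval q \<omega>"
| "msem v (Neg \<phi>) \<omega> \<longleftrightarrow> \<not> msem v \<phi> \<omega>"
| "msem v (And \<phi> \<psi>) \<omega> \<longleftrightarrow> msem v \<phi> \<omega> \<and> msem v \<psi> \<omega>"
| "msem v (Or \<phi> \<psi>) \<omega> \<longleftrightarrow> msem v \<phi> \<omega> \<or> msem v \<psi> \<omega>"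
| "msem v (Imp \<phi> \<psi>) \<omega> \<longleftrightarrow> (msem v \<phi> \<omega> \<longrightarrow> msem v \<psi> \<omega>)"
| "msem v (Iff \<phi> \<psi>) \<omega> \<longleftrightarrow> (msem v \<phi> \<omega> \<longleftrightarrow> msem v \<psi> \<omega>)"
| "msem v (All x \<phi>) \<omega> \<longleftrightarrow> (if first_order \<phi> then sem (All x \<phi>) \<omega> else v (All x \<phi>))"
| "msem v (Ex x \<phi>) \<omega> \<longleftrightarrow> (if first_order \<phi> then sem (Ex x \<phi>) \<omega> else v (Ex x \<phi>))"
| "msem v (Box \<alpha> \<phi>) \<omega> \<longleftrightarrow> v (Box \<alpha> \<phi>)"
| "msem v (Dia \<alpha> \<phi>) \<omega> \<longleftrightarrow> v (Dia \<alpha> \<phi>)"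

primrec modal_atoms :: "fml \<Rightarrow> fml set" where
  "modal_atoms (Eq p q) = {}"
| "modal_atoms (Geq p q) = {}"
| "modal_atoms (Gt p q) = {}"
| "modal_atoms (Neg \<phi>) = modal_atoms \<phi>"
| "modal_atoms (And \<phi> \<psi>) = modal_atoms \<phi> \<union> modal_atoms \<psi>"
| "modal_atoms (Or \<phi> \<psi>) = modal_atoms \<phi> \<union> modal_atoms \<psi>"
| "modal_atoms (Imp \<phi> \<psi>) = modal_atoms \<phi> \<union> modal_atoms \<psi>"
| "modal_atoms (Iff \<phi> \<psi>) = modal_atoms \<phi> \<union> modal_atoms \<psi>"
| "modal_atoms (All x \<phi>) = (if first_order \<phi> then {} else {All x \<phi>})"
| "modal_atoms (Ex x \<phi>) = (if first_order \<phi> then {} else {Ex x \<phi>})"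
| "modal_atoms (Box \<alpha> \<phi>) = {Box \<alpha> \<phi>}"
| "modal_atoms (Dia \<alpha> \<phi>) = {Dia \<alpha> \<phi>}"

definition truth :: "bool \<Rightarrow> fml" where
  "truth b = (if b then TT else FF)"

text \<open>Putting truth values for the modal atoms leaves a first-order formula, to which the
  axiom \<open>Arith\<close> can be applied.\<close>

primrec decide_atoms :: "(fml \<Rightarrow> bool) \<Rightarrow> fml \<Rightarrow> fml" where
  "decide_atoms v (Eq p q) = Eq p q"
| "decide_atoms v (Geq p q) = Geq p q"
| "decide_atoms v (Gt p q) = Gt p q"
| "decide_atoms v (Neg \<phi>) = Neg (decide_atoms v \<phi>)"
| "decide_atoms v (And \<phi> \<psi>) = And (decide_atoms v \<phi>) (decide_atoms v \<psi>)"
| "decide_atoms v (Or \<phi> \<psi>) = Or (decide_atoms v \<phi>) (decide_atoms v \<psi>)"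
| "decide_atoms v (Imp \<phi> \<psi>) = Imp (decide_atoms v \<phi>) (decide_atoms v \<psi>)"
| "decide_atoms v (Iff \<phi> \<psi>) = Iff (decide_atoms v \<phi>) (decide_atoms v \<psi>)"
| "decide_atoms v (All x \<phi>) = (if first_order \<phi> then All x \<phi> else truth (v (All x \<phi>)))"
| "decide_atoms v (Ex x \<phi>) = (if first_order \<phi> then Ex x \<phi> else truth (v (Ex x \<phi>)))"
| "decide_atoms v (Box \<alpha> \<phi>) = truth (v (Box \<alpha> \<phi>))"
| "decide_atoms v (Dia \<alpha> \<phi>) = truth (v (Dia \<alpha> \<phi>))"

lemmas fml_induct = fml.induct[where ?P2.0 = "\<lambda>_. True", case_names Eq Geq Gt Neg And Or Imp Iff
    All Ex Box Dia Assign Test Ode Choice Seq Loop]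

lemma msem_first_order [simp]: "first_order \<phi> \<Longrightarrow> msem v \<phi> \<omega> \<longleftrightarrow> sem \<phi> \<omega>"
  by (induction \<phi> rule: fml_induct) simp_all

lemma first_order_truth [simp]: "first_order (truth b)" and sem_truth [simp]: "sem (truth b) \<omega> = b"
  by (simp_all add: truth_def)

lemma first_order_decide_atoms [simp]: "first_order (decide_atoms v \<phi>)"
  by (induction \<phi> rule: fml_induct) simp_all

lemma sem_decide_atoms [simp]: "sem (decide_atoms v \<phi>) \<omega> \<longleftrightarrow> msem v \<phi> \<omega>"
  by (induction \<phi> rule: fml_induct) simp_all

lemma finite_modal_atoms: "finite (modal_atoms \<phi>)"
  by (induction \<phi> rule: fml_induct) simp_all

definition literal :: "(fml \<Rightarrow> bool) \<Rightarrow> fml \<Rightarrow> fml" where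
  "literal v a = (if v a then a else Neg a)"

lemma FF_L: "FF # \<Gamma> \<turnstile>\<^bsub>H\<^esub> \<phi>"
  by (rule derives.Classical, rule derives.Id) simp

lemma TT_R: "\<Gamma> \<turnstile>\<^bsub>H\<^esub> TT"
  by (rule C0[OF Arith]) (simp_all add: valid_def)

lemma iff_truth: "literal v a \<in> set \<Gamma> \<Longrightarrow>
    a # \<Gamma> \<turnstile>\<^bsub>H\<^esub> truth (v a) \<and> truth (v a) # \<Gamma> \<turnstile>\<^bsub>H\<^esub> a"
proof (cases "v a")
  case True
  then show "literal v a \<in> set \<Gamma> \<Longrightarrow> ?thesis"
    by (auto simp: truth_def literal_def TT_R intro: derives.Id)
next
  case False
  assume "literal v a \<in> set \<Gamma>"
  then have "\<Gamma> \<turnstile>\<^bsub>H\<^esub> Neg a" by (simp add: literal_def False derives.Id)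
  moreover have "Neg a # a # \<Gamma> \<turnstile>\<^bsub>H\<^esub> FF"
    by (intro derives.NegL derives.Id) simp
  ultimately have "a # \<Gamma> \<turnstile>\<^bsub>H\<^esub> FF"
    by (blast intro: derives.Cut weaken_Cons)
  then show ?thesis by (simp add: truth_def False FF_L)
qed

lemma decide_atoms_iff:
  assumes "\<forall>a\<in>modal_atoms \<phi>. literal v a \<in> set \<Gamma>"
  shows "\<phi> # \<Gamma> \<turnstile>\<^bsub>H\<^esub> decide_atoms v \<phi> \<and> decide_atoms v \<phi> # \<Gamma> \<turnstile>\<^bsub>H\<^esub> \<phi>"
  using assms
proof (induction \<phi> rule: fml_induct)
  case (Neg \<phi>)
  then show ?case by (simp add: Neg_cong)
next
  case (And \<phi> \<psi>)
  then show ?case by (simp add: And_cong)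
next
  case (Or \<phi> \<psi>)
  then show ?case by (simp add: Or_cong)
next
  case (Imp \<phi> \<psi>)
  then show ?case by (simp add: Imp_cong)
next
  case (Iff \<phi> \<psi>)
  then show ?case by (simp add: Iff_cong)
qed (simp_all add: iff_truth derives.Id)

text \<open>Repeated excluded middle, one atom of \<open>L\<close> at a time.\<close>

lemma split_atoms:
  assumes "distinct L" "\<And>v. map (literal v) L @ \<Gamma> \<turnstile>\<^bsub>H\<^esub> \<phi>"
  shows "\<Gamma> \<turnstile>\<^bsub>H\<^esub> \<phi>"
  using assms
proof (induction L)
  case (Cons a L)
  have "map (literal v) L @ \<Gamma> \<turnstile>\<^bsub>H\<^esub> \<phi>" for v
  proof (rule provable_cases)
    have *: "map (literal (v(a := b))) L = map (literal v) L" for b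
      using Cons.prems(1) by (auto simp: literal_def)
    show "a # map (literal v) L @ \<Gamma> \<turnstile>\<^bsub>H\<^esub> \<phi>"
      using Cons.prems(2)[of "v(a := True)"] by (simp only: list.map append_Cons *) (simp add: literal_def)
    show "Neg a # map (literal v) L @ \<Gamma> \<turnstile>\<^bsub>H\<^esub> \<phi>"
      using Cons.prems(2)[of "v(a := False)"] by (simp only: list.map append_Cons *) (simp add: literal_def)
  qed
  then show ?case using Cons by simp
qed simp

lemma provable_mp_list: "\<Gamma> \<turnstile>\<^bsub>H\<^esub> foldr Imp \<Delta> \<phi> \<Longrightarrow> (\<And>\<psi>. \<psi> \<in> set \<Delta> \<Longrightarrow> \<Gamma> \<turnstile>\<^bsub>H\<^esub> \<psi>) \<Longrightarrow> \<Gamma> \<turnstile>\<^bsub>H\<^esub> \<phi>"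
proof (induction \<Delta>)
  case (Cons \<psi> \<Delta>)
  then show ?case by (auto intro: provable_mp[of _ _ \<psi>])
qed simp

lemma arith_valid_foldr: "sem (foldr Imp \<Delta> \<phi>) \<omega> \<longleftrightarrow> ((\<forall>\<psi>\<in>set \<Delta>. sem \<psi> \<omega>) \<longrightarrow> sem \<phi> \<omega>)"
  by (induction \<Delta>) auto

lemma first_order_foldr: "first_order (foldr Imp \<Delta> \<phi>) \<longleftrightarrow> (\<forall>\<psi>\<in>set \<Delta>. first_order \<psi>) \<and> first_order \<phi>"
  by (induction \<Delta>) auto

text \<open>Under a fixed assignment of the modal atoms each formula is provably equivalent to its
  first-order image, and the resulting implication between images is an instance of
  \<open>Arith\<close>.\<close>

lemma arith0:
  assumes "\<And>v \<omega>. (\<forall>\<psi>\<in>set \<Gamma>. msem v \<psi> \<omega>) \<Longrightarrow> msem v \<phi> \<omega>"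
  shows "\<Gamma> \<turnstile>\<^bsub>H\<^esub> \<phi>"
proof -
  have "finite (\<Union>\<psi>\<in>set (\<phi> # \<Gamma>). modal_atoms \<psi>)"
    by (simp add: finite_modal_atoms)
  from finite_distinct_list[OF this]
  obtain L where L: "set L = (\<Union>\<psi>\<in>set (\<phi> # \<Gamma>). modal_atoms \<psi>)" "distinct L"
    by (elim exE conjE)
  show ?thesis
  proof (rule split_atoms[OF L(2)])
    fix v
    let ?\<Gamma> = "map (literal v) L @ \<Gamma>"
    have iff: "\<psi> # ?\<Gamma> \<turnstile>\<^bsub>H\<^esub> decide_atoms v \<psi>" "decide_atoms v \<psi> # ?\<Gamma> \<turnstile>\<^bsub>H\<^esub> \<psi>"
      if "\<psi> \<in> set (\<phi> # \<Gamma>)" for \<psi>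
    proof -
      have "modal_atoms \<psi> \<subseteq> set L" using that unfolding L(1) by blast
      then have "\<forall>a\<in>modal_atoms \<psi>. literal v a \<in> set ?\<Gamma>" by auto
      note decide_atoms_iff[OF this]
      then show "\<psi> # ?\<Gamma> \<turnstile>\<^bsub>H\<^esub> decide_atoms v \<psi>"
        "decide_atoms v \<psi> # ?\<Gamma> \<turnstile>\<^bsub>H\<^esub> \<psi>" by (rule conjunct1, rule conjunct2)
    qed
    have "?\<Gamma> \<turnstile>\<^bsub>H\<^esub> foldr Imp (map (decide_atoms v) \<Gamma>) (decide_atoms v \<phi>)"
    proof (intro C0 Arith)
      show "first_order (foldr Imp (map (decide_atoms v) \<Gamma>) (decide_atoms v \<phi>))"
        by (simp add: first_order_foldr)
      show "valid (foldr Imp (map (decide_atoms v) \<Gamma>) (decide_atoms v \<phi>))"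
        unfolding valid_def arith_valid_foldr sem_decide_atoms set_map ball_simps
        by (intro allI impI assms) simp
    qed
    then have "?\<Gamma> \<turnstile>\<^bsub>H\<^esub> decide_atoms v \<phi>"
    proof (rule provable_mp_list)
      fix \<psi> assume "\<psi> \<in> set (map (decide_atoms v) \<Gamma>)"
      then obtain \<chi> where "\<chi> \<in> set \<Gamma>" "\<psi> = decide_atoms v \<chi>" by auto
      then show "?\<Gamma> \<turnstile>\<^bsub>H\<^esub> \<psi>"
        using derives.Cut[OF derives.Id iff(1)[of \<chi>]] by simp
    qed
    then show "?\<Gamma> \<turnstile>\<^bsub>H\<^esub> \<phi>"
      by (rule derives.Cut) (use iff(2)[of \<phi>] in simp)
  qed
qed

lemma arith_list:
  assumes "\<And>\<psi>. \<psi> \<in> set \<Delta> \<Longrightarrow> \<Gamma> \<turnstile>\<^bsub>H\<^esub> \<psi>"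
    and "\<And>v \<omega>. (\<forall>\<psi>\<in>set \<Delta>. msem v \<psi> \<omega>) \<Longrightarrow> (\<forall>\<psi>\<in>set \<Gamma>. msem v \<psi> \<omega>) \<Longrightarrow> msem v \<phi> \<omega>"
  shows "\<Gamma> \<turnstile>\<^bsub>H\<^esub> \<phi>"
  by (rule cut_list[OF assms(1)], assumption, rule arith0) (use assms(2) in auto)

lemma arith1:
  assumes "\<Gamma> \<turnstile>\<^bsub>H\<^esub> \<psi>1"
    and "\<And>v \<omega>. msem v \<psi>1 \<omega> \<Longrightarrow> (\<forall>\<psi>\<in>set \<Gamma>. msem v \<psi> \<omega>) \<Longrightarrow> msem v \<phi> \<omega>"
  shows "\<Gamma> \<turnstile>\<^bsub>H\<^esub> \<phi>"
  by (rule arith_list[of "[\<psi>1]"]) (use assms in auto)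

lemma arith2:
  assumes "\<Gamma> \<turnstile>\<^bsub>H\<^esub> \<psi>1" "\<Gamma> \<turnstile>\<^bsub>H\<^esub> \<psi>2"
    and "\<And>v \<omega>. msem v \<psi>1 \<omega> \<Longrightarrow> msem v \<psi>2 \<omega> \<Longrightarrow> (\<forall>\<psi>\<in>set \<Gamma>. msem v \<psi> \<omega>) \<Longrightarrow> msem v \<phi> \<omega>"
  shows "\<Gamma> \<turnstile>\<^bsub>H\<^esub> \<phi>"
  by (rule arith_list[of "[\<psi>1, \<psi>2]"]) (use assms in auto)

lemma arith3:
  assumes "\<Gamma> \<turnstile>\<^bsub>H\<^esub> \<psi>1" "\<Gamma> \<turnstile>\<^bsub>H\<^esub> \<psi>2" "\<Gamma> \<turnstile>\<^bsub>H\<^esub> \<psi>3"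
    and "\<And>v \<omega>. msem v \<psi>1 \<omega> \<Longrightarrow> msem v \<psi>2 \<omega> \<Longrightarrow> msem v \<psi>3 \<omega> \<Longrightarrow>
      (\<forall>\<psi>\<in>set \<Gamma>. msem v \<psi> \<omega>) \<Longrightarrow> msem v \<phi> \<omega>"
  shows "\<Gamma> \<turnstile>\<^bsub>H\<^esub> \<phi>"
  by (rule arith_list[of "[\<psi>1, \<psi>2, \<psi>3]"]) (use assms in auto)

lemma Disj_elim:
  assumes "\<Gamma> \<turnstile>\<^bsub>H\<^esub> Disj L" "\<And>\<phi>. \<phi> \<in> set L \<Longrightarrow> \<phi> # \<Gamma> \<turnstile>\<^bsub>H\<^esub> \<chi>"
  shows "\<Gamma> \<turnstile>\<^bsub>H\<^esub> \<chi>"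
proof -
  have "Disj L # \<Gamma> \<turnstile>\<^bsub>H\<^esub> \<chi>" using assms(2)
    by (induction L rule: Disj.induct) (auto intro: FF_L derives.OrL)
  with assms(1) show ?thesis by (rule derives.Cut)
qed


section \<open>Modal reasoning\<close>

text \<open>(G) and (K) combined. Under the box only facts known after all runs may be used, so
  \<open>\<Gamma>\<close>, which describes the state before, gives way to
  \<open>\<Delta>\<close>.\<close>

lemma box_all:
  assumes "\<And>\<psi>. \<psi> \<in> set \<Delta> \<Longrightarrow> \<Gamma> \<turnstile>\<^bsub>H\<^esub> Box \<alpha> \<psi>" "\<Delta> \<turnstile>\<^bsub>H\<^esub> \<chi>"
  shows "\<Gamma> \<turnstile>\<^bsub>H\<^esub> Box \<alpha> \<chi>"
  using assms
proof (induction \<Delta> arbitrary: \<chi>)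
  case Nil
  then show ?case by (intro derives.Goedel) simp
next
  case (Cons \<psi> \<Delta>)
  have "\<Gamma> \<turnstile>\<^bsub>H\<^esub> Box \<alpha> (Imp \<psi> \<chi>)"
    using Cons by (simp add: derives.ImpR)
  then show ?case
    by (rule provable_mp[OF provable_mp[OF C0[OF axiom_C0.K]]]) (use Cons.prems(1) in simp)
qed

lemma box_V: "\<Gamma> \<turnstile>\<^bsub>H\<^esub> \<phi> \<Longrightarrow> FV \<phi> \<inter> BV \<alpha> = {} \<Longrightarrow> \<Gamma> \<turnstile>\<^bsub>H\<^esub> Box \<alpha> \<phi>"
  by (rule provable_mp[OF C0[OF axiom_C0.V]])

lemma box_DW: "wf_ode ode \<Longrightarrow> \<Gamma> \<turnstile>\<^bsub>H\<^esub> Box (Ode ode Q) Q"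
  by (intro C0 axiom_C0.DW)

text \<open>Monotonicity in the domain comes from (DMP), in the postcondition from (K), both read
  through duality. \<open>\<Delta>\<close> collects what is known after every run, typically
  constants and invariants.\<close>

lemma dia_ode:
  assumes wf: "wf_ode ode" and dia: "\<Gamma> \<turnstile>\<^bsub>H\<^esub> Dia (Ode ode Q) \<phi>"
    and box: "\<And>\<psi>. \<psi> \<in> set \<Delta> \<Longrightarrow> \<Gamma> \<turnstile>\<^bsub>H\<^esub> Box (Ode ode Q) \<psi>"
    and R: "Q # \<Delta> \<turnstile>\<^bsub>H\<^esub> R" and \<chi>: "\<phi> # Q # \<Delta> \<turnstile>\<^bsub>H\<^esub> \<chi>"
  shows "\<Gamma> \<turnstile>\<^bsub>H\<^esub> Dia (Ode ode R) \<chi>"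
proof -
  have "\<Gamma> \<turnstile>\<^bsub>H\<^esub> Box (Ode ode Q) (Imp Q R)"
    by (rule box_all[OF _ derives.ImpR[OF R]]) (rule box)
  then have 1: "\<Gamma> \<turnstile>\<^bsub>H\<^esub> Imp (Box (Ode ode R) (Neg \<chi>)) (Box (Ode ode Q) (Neg \<chi>))"
    by (rule provable_mp[OF C0[OF axiom_C0.DMP[OF wf]]])
  have "\<Gamma> \<turnstile>\<^bsub>H\<^esub> Box (Ode ode Q) (Imp (Neg \<chi>) (Neg \<phi>))"
  proof (rule box_all[of "Q # \<Delta>"])
    show "Q # \<Delta> \<turnstile>\<^bsub>H\<^esub> Imp (Neg \<chi>) (Neg \<phi>)"
        by (rule derives.ImpR[OF Neg_cong[OF \<chi>]])
  qed (use box box_DW[OF wf] in auto)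
  then have 2: "\<Gamma> \<turnstile>\<^bsub>H\<^esub> Imp (Box (Ode ode Q) (Neg \<chi>)) (Box (Ode ode Q) (Neg \<phi>))"
    by (rule provable_mp[OF C0[OF axiom_C0.K]])
  show ?thesis
    by (rule arith_list[of "[Iff (Dia (Ode ode Q) \<phi>) (Neg (Box (Ode ode Q) (Neg \<phi>))),
          Iff (Dia (Ode ode R) \<chi>) (Neg (Box (Ode ode R) (Neg \<chi>))),
          Imp (Box (Ode ode R) (Neg \<chi>)) (Box (Ode ode Q) (Neg \<chi>)),
          Imp (Box (Ode ode Q) (Neg \<chi>)) (Box (Ode ode Q) (Neg \<phi>)), Dia (Ode ode Q) \<phi>]"])
      (use 1 2 dia C0[OF axiom_C0.Diamond] in auto)
qed

lemma dia_or_box: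
  assumes "Dia \<alpha> (Neg \<phi>) # \<Gamma> \<turnstile>\<^bsub>H\<^esub> FF"
  shows "\<Gamma> \<turnstile>\<^bsub>H\<^esub> Box \<alpha> \<phi>"
proof -
  have "\<Gamma> \<turnstile>\<^bsub>H\<^esub> Box \<alpha> (Neg (Neg \<phi>))"
    using C0[OF axiom_C0.Diamond[of \<alpha> "Neg \<phi>"]] derives.NegR[OF assms]
    by (rule arith2) auto
  then show ?thesis
    using box_all[where \<Delta> = "[Neg (Neg \<phi>)]" and \<Gamma> = \<Gamma> and \<alpha> = \<alpha> and \<chi> = \<phi> and H = H]
      arith0[where \<Gamma> = "[Neg (Neg \<phi>)]" and \<phi> = \<phi> and H = H] by simp
qed

lemma dia_uniq:
  assumes "wf_ode ode" "\<Gamma> \<turnstile>\<^bsub>H\<^esub> Dia (Ode ode Q1) \<phi>1" "\<Gamma> \<turnstile>\<^bsub>H\<^esub> Dia (Ode ode Q2) \<phi>2"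
  shows "\<Gamma> \<turnstile>\<^bsub>H\<^esub> Dia (Ode ode (And Q1 Q2)) (Or \<phi>1 \<phi>2)"
  by (rule provable_mp[OF derives.Axiom[where A = axiom_C1, OF axiom_C1.Uniq]]) (use assms in \<open>auto intro: derives.AndR\<close>)

lemma dia_False:
  assumes "wf_ode ode" "\<Gamma> \<turnstile>\<^bsub>H\<^esub> Dia (Ode ode Q) \<phi>"
    and "\<And>\<psi>. \<psi> \<in> set \<Delta> \<Longrightarrow> \<Gamma> \<turnstile>\<^bsub>H\<^esub> Box (Ode ode Q) \<psi>" "\<phi> # Q # \<Delta> \<turnstile>\<^bsub>H\<^esub> FF"
  shows "\<Gamma> \<turnstile>\<^bsub>H\<^esub> FF"
proof -
  have "\<Gamma> \<turnstile>\<^bsub>H\<^esub> Box (Ode ode Q) (Neg \<phi>)"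
    by (rule box_all[OF _ derives.NegR[OF assms(4)]]) (use assms(3) box_DW[OF assms(1)] in auto)
  from arith3[OF this assms(2) C0[OF axiom_C0.Diamond]] show ?thesis by auto
qed

text \<open>A fresh variable can be given a value in advance: the existential is arithmetic, and
  \<open>w\<close> is its own eigenvariable.\<close>

lemma fresh_eq:
  assumes "w \<notin> tvars e" "w \<notin> \<Union>(FV ` set \<Gamma>) \<union> FV \<chi>" "Eq (tvar w) e # \<Gamma> \<turnstile>\<^bsub>H\<^esub> \<chi>"
  shows "\<Gamma> \<turnstile>\<^bsub>H\<^esub> \<chi>"
proof (rule derives.Cut)
  show "\<Gamma> \<turnstile>\<^bsub>H\<^esub> Ex w (Eq (tvar w) e)"
    using assms(1) by (intro arith0) simp
  show "Ex w (Eq (tvar w) e) # \<Gamma> \<turnstile>\<^bsub>H\<^esub> \<chi>"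
    using assms(2,3) by (intro derives.ExL[where y = w]) auto
qed

abbreviation eqs :: "nat list \<Rightarrow> nat list \<Rightarrow> fml list" where
  "eqs xs ys \<equiv> map2 (\<lambda>x y. Eq (tvar x) (tvar y)) xs ys"

lemma fresh_eqs:
  assumes "length ws = length us" "distinct ws"
    and "set ws \<inter> (set us \<union> \<Union>(FV ` set \<Gamma>) \<union> FV \<chi>) = {}" "eqs ws us @ \<Gamma> \<turnstile>\<^bsub>H\<^esub> \<chi>"
  shows "\<Gamma> \<turnstile>\<^bsub>H\<^esub> \<chi>"
  using assms
proof (induction ws us rule: list_induct2)
  case (Cons w ws u us)
  have "eqs ws us @ \<Gamma> \<turnstile>\<^bsub>H\<^esub> \<chi>"
    by (rule fresh_eq[of w "tvar u"])
      (use Cons.prems in \<open>auto dest: set_zip_leftD set_zip_rightD\<close>)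
  then show ?case using Cons by auto
qed simp

lemma AllsR:
  assumes "set ys \<inter> \<Union>(FV ` set \<Gamma>) = {}" "\<Gamma> \<turnstile>\<^bsub>H\<^esub> \<phi>"
  shows "\<Gamma> \<turnstile>\<^bsub>H\<^esub> Alls ys \<phi>"
  using assms
proof (induction ys)
  case (Cons y ys)
  then show ?case
    by (auto simp: Alls_def intro!: derives.AllR[where y = y])
qed (simp add: Alls_def)

text \<open>The ghost is its own witness, as no other term can be substituted for a variable bound by an
  equation. Its initial value is fixed beforehand with \<open>fresh_eq\<close>.\<close>

lemma box_DG:
  assumes "wf_ode ode" "y \<notin> FVp (Ode ode Q) \<union> FV \<phi>" "y \<notin> tvars a \<union> tvars b"
    and "\<Gamma> \<turnstile>\<^bsub>H\<^esub> Box (Ode (ode @ [(y, a * tvar y + b)]) Q) \<phi>"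
  shows "\<Gamma> \<turnstile>\<^bsub>H\<^esub> Box (Ode ode Q) \<phi>"
proof -
  have "\<Gamma> \<turnstile>\<^bsub>H\<^esub> Ex y (Box (Ode (ode @ [(y, a * tvar y + b)]) Q) \<phi>)"
    using assms(4) by (intro derives.ExR[where e = "tvar y"]) simp_all
  with C0[OF axiom_C0.DG[OF assms(1-3)]] show ?thesis
    by (rule arith2) auto
qed

section \<open>Auxiliary facts on fresh variables, numerals and Lie derivatives\<close>

lemma exists_fresh:
  assumes "finite (V :: nat set)"
  obtains ys where "length ys = n" "distinct ys" "set ys \<inter> V = {}"
proof -
  obtain k where "\<And>x. x \<in> V \<Longrightarrow> x < k"
    using assms finite_nat_set_iff_bounded by auto
  then have "set [k..<k + n] \<inter> V = {}" by fastforce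
  then show ?thesis by (intro that[of "[k..<k + n]"]) auto
qed

lemma of_nat_const: "of_nat n = (Poly_Mapping.single 0 (of_nat n) :: trm)"
  by simp

lemma teval_of_nat [simp]: "teval (of_nat n) \<omega> = of_nat n"
  by (simp only: of_nat_const teval_simps of_rat_of_nat_eq)

lemma teval_numeral [simp]: "teval (numeral n) \<omega> = numeral n"
  using teval_of_nat[of "numeral n"] by simp

lemma lie_tvar:
  assumes "wf_ode ode" "(x, e) \<in> set ode"
  shows "lie ode (tvar x) = e"
  using assms
proof (induction ode)
  case (Cons ye ode)
  obtain y e' where [simp]: "ye = (y, e')" by (cases ye)
  show ?case
  proof (cases "x = y")
    case True
    then have "lie ode (tvar x) = 0"
      using Cons.prems(1) by (intro lie_fresh) (auto simp: wf_ode_def ode_vars_def)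
    moreover have "e = e'"
      using Cons.prems True by (force simp: wf_ode_def)
    ultimately show ?thesis using True by (simp add: lie_Cons)
  next
    case False
    then show ?thesis using Cons by (auto simp: lie_Cons wf_ode_def)
  qed
qed simp

lemma lie_snoc_fresh: "y \<notin> tvars p \<Longrightarrow> lie (ode @ [(y, e)]) p = lie ode p"
  by (simp add: lie_append lie_Cons lie_Nil partial_fresh)

lemma lie_power: "\<exists>h. lie ode (s ^ Suc j) = s ^ j * h"
proof (induction j)
  case (Suc j)
  then obtain h where h: "lie ode (s ^ Suc j) = s ^ j * h" by blast
  have "lie ode (s ^ Suc (Suc j)) = s ^ Suc j * (lie ode s + h)"
    by (subst power_Suc, subst lie_mult, subst h) (simp add: algebra_simps)
  then show ?case by blast
qed simp

text \<open>Each Lie derivative uses up at most one factor \<open>s\<close>. At a zero of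
  \<open>s\<close>, therefore, the derivatives of \<open>s ^ m\<close> of orders below
  \<open>m\<close> vanish.\<close>

lemma lie_n_power: "i \<le> m \<Longrightarrow> \<exists>h. lie_n ode i (s ^ m) = s ^ (m - i) * h"
proof (induction i)
  case (Suc i)
  then obtain h where h: "lie_n ode i (s ^ m) = s ^ (m - i) * h" by auto
  have m: "m - i = Suc (m - Suc i)" using Suc.prems by simp
  obtain h' where h': "lie ode (s ^ (m - i)) = s ^ (m - Suc i) * h'"
    using lie_power[of ode s "m - Suc i"] m by auto
  have "lie_n ode (Suc i) (s ^ m) = s ^ (m - Suc i) * (h' * h + s * lie ode h)"
    by (simp only: lie_n_Suc h lie_mult h') (simp add: m algebra_simps)
  then show ?case by blast
qed (auto intro: exI[of _ 1])

lemma sem_veq_nth: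
  "length xs = length ys \<Longrightarrow> sem (veq xs ys) \<omega> \<longleftrightarrow> (\<forall>i<length xs. \<omega> (xs ! i) = \<omega> (ys ! i))"
  by (auto simp: sem_veq set_zip)

lemma msem_eqs:
  "length xs = length ys \<Longrightarrow>
    (\<forall>\<psi>\<in>set (eqs xs ys). msem v \<psi> \<omega>) \<longleftrightarrow> (\<forall>i<length xs. \<omega> (xs ! i) = \<omega> (ys ! i))"
  by (auto simp: set_zip)


section \<open>Differential invariants\<close>

lemma C1: "axiom_C1 \<phi> \<Longrightarrow> \<Gamma> \<turnstile>\<^bsub>H\<^esub> \<phi>"
  by (rule derives.Axiom)

lemma box_DI_geq:
  assumes "wf_ode ode" "\<Gamma> \<turnstile>\<^bsub>H\<^esub> Box (Ode ode Q) (Geq (lie ode p) 0)" "\<Gamma> \<turnstile>\<^bsub>H\<^esub> Geq p 0"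
  shows "\<Gamma> \<turnstile>\<^bsub>H\<^esub> Box (Ode ode Q) (Geq p 0)"
  by (rule arith3[OF assms(2,3) C0[OF axiom_C0.DI_geq[OF assms(1), of Q p]]]) auto

lemma box_DI_eq:
  assumes "wf_ode ode" "\<Gamma> \<turnstile>\<^bsub>H\<^esub> Box (Ode ode Q) (Eq (lie ode p) 0)" "\<Gamma> \<turnstile>\<^bsub>H\<^esub> Eq p 0"
  shows "\<Gamma> \<turnstile>\<^bsub>H\<^esub> Box (Ode ode Q) (Eq p 0)"
  by (rule arith3[OF assms(2,3) C0[OF axiom_C0.DI_eq[OF assms(1), of Q p]]]) auto

lemma box_arith1:
  assumes "\<Gamma> \<turnstile>\<^bsub>H\<^esub> Box \<alpha> \<psi>1" "\<And>v \<omega>. msem v \<psi>1 \<omega> \<Longrightarrow> msem v \<phi> \<omega>"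
  shows "\<Gamma> \<turnstile>\<^bsub>H\<^esub> Box \<alpha> \<phi>"
  by (rule box_all[of "[\<psi>1]"]) (use assms in \<open>auto intro!: arith0[of "[\<psi>1]"]\<close>)

lemma box_arith2:
  assumes "\<Gamma> \<turnstile>\<^bsub>H\<^esub> Box \<alpha> \<psi>1" "\<Gamma> \<turnstile>\<^bsub>H\<^esub> Box \<alpha> \<psi>2"
    and "\<And>v \<omega>. msem v \<psi>1 \<omega> \<Longrightarrow> msem v \<psi>2 \<omega> \<Longrightarrow> msem v \<phi> \<omega>"
  shows "\<Gamma> \<turnstile>\<^bsub>H\<^esub> Box \<alpha> \<phi>"
  by (rule box_all[of "[\<psi>1, \<psi>2]"]) (use assms in \<open>auto intro!: arith0[of "[\<psi>1, \<psi>2]"]\<close>)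

text \<open>The ghost \<open>y' = - g y\<close> turns \<open>v' \<ge> g v\<close> into \<open>(v y)' \<ge> 0\<close> as long as \<open>y > 0\<close>, and
  the second ghost \<open>z' = g z / 2\<close> keeps \<open>y > 0\<close> because \<open>y z\<^sup>2 = 1\<close> is invariant.\<close>

lemma box_darboux:
  assumes wf: "wf_ode ode"
    and g: "\<And>\<omega>. teval g \<omega> * teval v \<omega> \<le> teval (lie ode v) \<omega>"
    and v: "\<Gamma> \<turnstile>\<^bsub>H\<^esub> Geq v 0"
  shows "\<Gamma> \<turnstile>\<^bsub>H\<^esub> Box (Ode ode TT) (Geq v 0)"
proof -
  have "finite (FVp (Ode ode TT) \<union> tvars v \<union> tvars g \<union> \<Union>(FV ` set \<Gamma>))"
    by (simp del: FVp.simps)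
  then obtain ws where "length ws = 2" "distinct ws" and
    ws: "set ws \<inter> (FVp (Ode ode TT) \<union> tvars v \<union> tvars g \<union> \<Union>(FV ` set \<Gamma>)) = {}"
    by (rule exists_fresh)
  then obtain y z where yz: "ws = [y, z]" "y \<noteq> z"
    by (auto simp: length_Suc_conv numeral_2_eq_2)
  \<comment> \<open>The factor 1/2 compensates for the square: \<open>y z^2\<close> has derivative
    \<open>(- g + 2 b) y z^2 = 0\<close>.\<close>
  define b where "b = Poly_Mapping.single 0 (1/2) * g"
  have b: "tvars b \<subseteq> tvars g" unfolding b_def by (rule tvars_mult) simp_all
  have tb: "teval b \<omega> = teval g \<omega> / 2" for \<omega>
    by (simp add: b_def of_rat_divide)
  define ode1 where "ode1 = ode @ [(y, (- g) * tvar y + 0)]"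
  define ode2 where "ode2 = ode1 @ [(z, b * tvar z + 0)]"
  have wf1: "wf_ode ode1" and wf2: "wf_ode ode2"
    using wf ws yz by (auto simp: wf_ode_def ode1_def ode2_def ode_vars_def)
  \<comment> \<open>Both ghosts start at \<open>1\<close>, so that \<open>y z^2 = 1\<close>
    initially and \<open>v y\<close> starts with the value of \<open>v\<close>.\<close>
  define \<Gamma>1 where "\<Gamma>1 = Eq (tvar y) 1 # \<Gamma>"
  have y1: "\<Gamma>1 \<turnstile>\<^bsub>H\<^esub> Eq (tvar y) 1"
    by (simp add: \<Gamma>1_def derives.Id)
  have rhs1: "rhs_vars ode1 \<subseteq> rhs_vars ode \<union> tvars g \<union> {y}"
  proof -
    have "tvars ((- g) * tvar y + 0) \<subseteq> tvars g \<union> {y}"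
      by (intro tvars_add tvars_mult) auto
    then show ?thesis by (auto simp: rhs_vars_def ode1_def)
  qed
  have pos: "\<Gamma>1 \<turnstile>\<^bsub>H\<^esub> Box (Ode ode1 TT) (Gt (tvar y) 0)"
  proof (rule fresh_eq[of z 1])
    show "z \<notin> tvars 1" by simp
    show "z \<notin> \<Union>(FV ` set \<Gamma>1) \<union> FV (Box (Ode ode1 TT) (Gt (tvar y) 0))"
      using ws yz rhs1 by (auto simp: \<Gamma>1_def ode_vars_def ode1_def)
    show "Eq (tvar z) 1 # \<Gamma>1 \<turnstile>\<^bsub>H\<^esub> Box (Ode ode1 TT) (Gt (tvar y) 0)"
    proof (rule box_DG[OF wf1, of z _ _ b 0])
      show "z \<notin> FVp (Ode ode1 TT) \<union> FV (Gt (tvar y) 0)"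
        using ws yz rhs1 by (auto simp: ode_vars_def ode1_def)
      show "z \<notin> tvars b \<union> tvars 0"
        using ws yz b by auto
      let ?p = "tvar y * (tvar z * tvar z) - 1"
      have l: "lie ode2 (tvar y) = - g * tvar y" "lie ode2 (tvar z) = b * tvar z"
        using lie_tvar[OF wf2, of y "(- g) * tvar y + 0"] lie_tvar[OF wf2, of z "b * tvar z + 0"]
        by (simp_all add: ode2_def ode1_def)
      have l0: "teval (lie ode2 ?p) \<omega> = 0" for \<omega>
        by (simp add: l lie_mult tb)
      have "Eq (tvar z) 1 # \<Gamma>1 \<turnstile>\<^bsub>H\<^esub> Box (Ode ode2 TT) (Eq ?p 0)"
      proof (rule box_DI_eq[OF wf2])
        show "Eq (tvar z) 1 # \<Gamma>1 \<turnstile>\<^bsub>H\<^esub> Box (Ode ode2 TT) (Eq (lie ode2 ?p) 0)"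
          by (rule box_all[of "[]"]) (simp, rule arith0, simp only: msem.simps l0 teval_simps)
        show "Eq (tvar z) 1 # \<Gamma>1 \<turnstile>\<^bsub>H\<^esub> Eq ?p 0"
          by (rule arith1[OF weaken_Cons[OF y1]]) simp
      qed
      then show "Eq (tvar z) 1 # \<Gamma>1 \<turnstile>\<^bsub>H\<^esub> Box (Ode (ode1 @ [(z, b * tvar z + 0)]) TT) (Gt (tvar y) 0)"
        unfolding ode2_def
      proof (rule box_arith1)
        fix w \<omega> assume "msem w (Eq ?p 0) \<omega>"
        then have "\<omega> y * (\<omega> z)\<^sup>2 > 0" by (simp add: power2_eq_square)
        then show "msem w (Gt (tvar y) 0) \<omega>" by (simp add: zero_less_mult_iff)
      qed
    qed
  qed
  have v1: "\<Gamma>1 \<turnstile>\<^bsub>H\<^esub> Box (Ode ode1 (Gt (tvar y) 0)) (Geq v 0)"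
  proof -
    \<comment> \<open>The ghost cancels the term \<open>g v\<close>. What remains is
      \<open>v' - g v\<close>, nonnegative by assumption, times \<open>y\<close>, which is positive
      in this domain.\<close>
    have l: "teval (lie ode1 (v * tvar y)) \<omega> =
        (teval (lie ode v) \<omega> - teval g \<omega> * teval v \<omega>) * \<omega> y" for \<omega>
    proof -
      have "lie ode1 v = lie ode v"
        unfolding ode1_def by (rule lie_snoc_fresh) (use ws yz in auto)
      moreover have "lie ode1 (tvar y) = - g * tvar y"
        using lie_tvar[OF wf1, of y "(- g) * tvar y + 0"] by (simp add: ode1_def)
      ultimately show ?thesis by (simp add: lie_mult algebra_simps)
    qed
    have "\<Gamma>1 \<turnstile>\<^bsub>H\<^esub> Box (Ode ode1 (Gt (tvar y) 0)) (Geq (v * tvar y) 0)"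
    proof (rule box_DI_geq[OF wf1])
      show "\<Gamma>1 \<turnstile>\<^bsub>H\<^esub> Box (Ode ode1 (Gt (tvar y) 0)) (Geq (lie ode1 (v * tvar y)) 0)"
        by (rule box_arith1[OF box_DW[OF wf1]]) (use g in \<open>simp add: l\<close>)
      show "\<Gamma>1 \<turnstile>\<^bsub>H\<^esub> Geq (v * tvar y) 0"
        using v y1 unfolding \<Gamma>1_def by (intro arith1[OF weaken_Cons[OF v]]) simp
    qed
    from this box_DW[OF wf1] show ?thesis
      by (rule box_arith2) (simp add: zero_le_mult_iff)
  qed
  \<comment> \<open>(DMP) trades the domain \<open>y > 0\<close> for \<open>TT\<close>, as
    \<open>pos\<close> shows that no run leaves it.\<close>
  have "\<Gamma>1 \<turnstile>\<^bsub>H\<^esub> Box (Ode ode1 TT) (Imp TT (Gt (tvar y) 0))"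
    by (rule box_arith1[OF pos]) simp
  then have main: "\<Gamma>1 \<turnstile>\<^bsub>H\<^esub> Box (Ode ode1 TT) (Geq v 0)"
    by (rule provable_mp[OF provable_mp[OF C0[OF axiom_C0.DMP[OF wf1]]] v1])
  show ?thesis
  proof (rule fresh_eq[of y 1])
    show "y \<notin> tvars 1" by simp
    show "y \<notin> \<Union>(FV ` set \<Gamma>) \<union> FV (Box (Ode ode TT) (Geq v 0))"
      using ws yz by auto
    show "Eq (tvar y) 1 # \<Gamma> \<turnstile>\<^bsub>H\<^esub> Box (Ode ode TT) (Geq v 0)"
      using main ws yz unfolding \<Gamma>1_def ode1_def by (intro box_DG[OF wf, of y _ _ "- g" 0]) auto
  qed
qed

section \<open>Literals and their progress conditions along a sequence of derivatives\<close>

fun lit_fml :: "bool \<times> (nat \<Rightarrow> trm) \<times> nat \<Rightarrow> fml" where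
  "lit_fml (strict, q, N) = (if strict then Gt (q 0) 0 else Geq (q 0) 0)"

text \<open>\<open>Prog_gt\<close> with the order \<open>k\<close> of the first nonvanishing
  derivative made explicit, so that each disjunct calls for one chain of derivatives.\<close>

definition first_pos :: "(nat \<Rightarrow> trm) \<Rightarrow> nat \<Rightarrow> fml" where
  "first_pos q N = Disj (map (\<lambda>k. Conj (Gt (q k) 0 # map (\<lambda>i. Eq (q i) 0) [0..<k])) [0..<N])"

definition all_zero :: "(nat \<Rightarrow> trm) \<Rightarrow> nat \<Rightarrow> fml" where
  "all_zero q N = Conj (map (\<lambda>i. Eq (q i) 0) [0..<N])"

fun lit_prog :: "bool \<times> (nat \<Rightarrow> trm) \<times> nat \<Rightarrow> fml" where
  "lit_prog (strict, q, N) =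
     (if strict then first_pos q N else Or (first_pos q N) (all_zero q N))"

text \<open>What the rank provides, stated for a sequence in place of \<open>lie_n\<close>: the
  derivatives of \<open>p\<close> along \<open>f\<close> can then be transported, with
  \<open>N\<close> and the cofactors, to the clocked and the reversed system.\<close>

definition lie_seq :: "ode \<Rightarrow> (nat \<Rightarrow> trm) \<Rightarrow> nat \<Rightarrow> bool" where
  "lie_seq ode q N \<longleftrightarrow> N \<ge> 1 \<and> (\<forall>i. lie ode (q i) = q (Suc i)) \<and>
     (\<exists>g. q N = (\<Sum>i<N. g i * q i))"

lemma first_order_lit_fml [simp]: "first_order (lit_fml l)"
  by (cases l) simp

lemma first_order_lit_prog [simp]: "first_order (lit_prog l)"
  by (cases l) (auto simp: first_pos_def all_zero_def)

text \<open>The sum of squares \<open>S\<close> has as derivative the sum of the products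
  \<open>2 q_i q_{i+1}\<close>, each bounded by a multiple of \<open>S\<close>; for
  \<open>i = N - 1\<close> the cofactors express \<open>q_N\<close>. The sign is turned because
  \<open>box_darboux\<close> preserves \<open>v >= 0\<close>, here \<open>S <= 0\<close>.\<close>

lemma lie_seq_darboux:
  assumes "lie_seq ode q N"
  obtains g where "\<And>\<omega>. teval g \<omega> * teval (- (\<Sum>i<N. q i * q i)) \<omega> \<le>
    teval (lie ode (- (\<Sum>i<N. q i * q i))) \<omega>"
proof -
  obtain g where N: "N \<ge> 1" and lie: "\<And>i. lie ode (q i) = q (Suc i)"
    and g: "q N = (\<Sum>i<N. g i * q i)"
    using assms by (auto simp: lie_seq_def)
  \<comment> \<open>The summand \<open>2\<close> serves the products with \<open>i + 1 < N\<close>,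
    the rest the product with \<open>q N\<close>. The factor \<open>N\<close> below counts the
    products.\<close>
  let ?c = "of_nat N + 2 + (\<Sum>i<N. g i * g i)"
  have "teval (of_nat N * ?c) \<omega> * teval (- (\<Sum>i<N. q i * q i)) \<omega> \<le>
      teval (lie ode (- (\<Sum>i<N. q i * q i))) \<omega>" for \<omega>
  proof -
    define a where "a i = teval (q i) \<omega>" for i
    define b where "b i = teval (g i) \<omega>" for i
    define S where "S = (\<Sum>i<N. (a i)\<^sup>2)"
    define C where "C = real N + 2 + (\<Sum>i<N. (b i)\<^sup>2)"
    have S: "(a i)\<^sup>2 \<le> S" if "i < N" for i
      unfolding S_def using that by (intro member_le_sum) auto
    have S0: "S \<ge> 0" unfolding S_def by (intro sum_nonneg) simp
    have b0: "(\<Sum>i<N. (b i)\<^sup>2) \<ge> 0" by (intro sum_nonneg) simp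
    have bS: "(b i)\<^sup>2 \<le> (\<Sum>i<N. (b i)\<^sup>2)" if "i < N" for i
      using that by (intro member_le_sum) auto
    have am: "2 * (x * y) \<le> x\<^sup>2 + y\<^sup>2" for x y :: real
      using sum_squares_bound[of x y] by simp
    have aN: "a N = (\<Sum>j<N. b j * a j)"
      by (simp add: a_def b_def g)
    have step: "2 * (a i * a (Suc i)) \<le> C * S" if i: "i < N" for i
    proof (cases "Suc i < N")
      case True
      have "2 * (a i * a (Suc i)) \<le> S + S"
        using am[of "a i" "a (Suc i)"] S[OF i] S[OF True] by linarith
      also have "S + S \<le> C * S"
        using mult_right_mono[of 2 C S] S0 b0 by (simp add: C_def)
      finally show ?thesis .
    next
      case False
      then have "Suc i = N" using i by simp
      then have "2 * (a i * a (Suc i)) = (\<Sum>j<N. 2 * (a i * (b j * a j)))"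
        by (simp only: aN sum_distrib_left)
      also have "\<dots> \<le> (\<Sum>j<N. (a i)\<^sup>2 + (b j)\<^sup>2 * S)"
      proof (rule sum_mono)
        fix j assume "j \<in> {..<N}"
        then have "(b j)\<^sup>2 * (a j)\<^sup>2 \<le> (b j)\<^sup>2 * S"
          by (intro mult_left_mono S) auto
        then show "2 * (a i * (b j * a j)) \<le> (a i)\<^sup>2 + (b j)\<^sup>2 * S"
          using am[of "a i" "b j * a j"] by (simp add: power_mult_distrib)
      qed
      also have "\<dots> = real N * (a i)\<^sup>2 + (\<Sum>j<N. (b j)\<^sup>2) * S"
        by (simp add: sum.distrib sum_distrib_right)
      also have "\<dots> \<le> real N * S + (\<Sum>j<N. (b j)\<^sup>2) * S"
        using S[OF i] by (simp add: mult_left_mono)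
      also have "\<dots> \<le> C * S" using S0 by (simp add: C_def distrib_right)
      finally show ?thesis .
    qed
    have "(\<Sum>i<N. 2 * (a i * a (Suc i))) \<le> (\<Sum>i<N. C * S)"
      by (rule sum_mono) (simp add: step)
    then have total: "(\<Sum>i<N. 2 * (a i * a (Suc i))) \<le> real N * C * S" by simp
    have l1: "teval (lie ode (- (\<Sum>i<N. q i * q i))) \<omega> = - (\<Sum>i<N. 2 * (a i * a (Suc i)))"
      by (simp add: lie_mult lie a_def mult.commute flip: sum_negf)
    have l2: "teval (- (\<Sum>i<N. q i * q i)) \<omega> = - S"
      by (simp add: S_def a_def power2_eq_square)
    have l3: "teval (of_nat N * ?c) \<omega> = real N * C"
      by (simp add: C_def b_def power2_eq_square)
    show ?thesis unfolding l1 l2 l3 using total by simp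
  qed
  then show ?thesis by (rule that)
qed


section \<open>Local progress\<close>

text \<open>Instantiated for the clocked system and for its reversal, both with the same
  \<open>ys\<close>, which record the state where progress starts.\<close>

locale clocked_ode =
  fixes ode :: ode and ys :: "nat list"
  assumes wf: "wf_ode ode" and clock: "has_clock ode"
    and len: "length ys = length ode" and disj: "set ys \<inter> ode_vars ode = {}"
begin

abbreviation xs :: "nat list" where "xs \<equiv> map fst ode"

abbreviation at_start :: fml where "at_start \<equiv> veq xs ys"

text \<open>When \<open>at_start\<close> holds initially, the postcondition rules out the run of
  duration \<open>0\<close>.\<close>

abbreviation progress :: "fml \<Rightarrow> fml" where
  "progress \<phi> \<equiv> Dia (Ode ode \<phi>) (Neg at_start)"

lemma len': "length xs = length ys"
  by (simp add: len)

lemma FV_at_start: "FV at_start = ode_vars ode \<union> set ys"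
  by (simp add: FV_veq len ode_vars_def)

lemma progress_mono:
  assumes "\<Gamma> \<turnstile>\<^bsub>H\<^esub> progress \<phi>" "\<And>v \<omega>. msem v \<phi> \<omega> \<Longrightarrow> msem v \<psi> \<omega>"
  shows "\<Gamma> \<turnstile>\<^bsub>H\<^esub> progress \<psi>"
  by (rule dia_ode[OF wf assms(1), of "[]"]) (use assms(2) in \<open>auto intro!: arith0\<close>)

text \<open>The variables of \<open>p\<close> may include \<open>ys\<close>, which the axiom excludes: it is used with
  further copies \<open>ws\<close> equal to \<open>ys\<close>.\<close>

lemma progress_gt:
  assumes E: "\<Gamma> \<turnstile>\<^bsub>H\<^esub> at_start" and p: "\<Gamma> \<turnstile>\<^bsub>H\<^esub> Gt p 0"
  shows "\<Gamma> \<turnstile>\<^bsub>H\<^esub> progress (Gt p 0)"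
proof -
  let ?V = "ode_vars ode \<union> rhs_vars ode \<union> set ys \<union> tvars p \<union> \<Union>(FV ` set \<Gamma>)"
  have "finite ?V" by (simp add: ode_vars_def rhs_vars_def)
  then obtain ws where ws: "length ws = length ode" "distinct ws" "set ws \<inter> ?V = {}"
    by (rule exists_fresh)
  let ?\<Gamma> = "eqs ws ys @ \<Gamma>"
  have weak: "?\<Gamma> \<turnstile>\<^bsub>H\<^esub> \<phi>" if "\<Gamma> \<turnstile>\<^bsub>H\<^esub> \<phi>" for \<phi>
    using that by (rule derives.Weaken) auto
  have eqs: "?\<Gamma> \<turnstile>\<^bsub>H\<^esub> veq xs ws"
  proof (rule arith1[OF weak[OF E]])
    fix v \<omega> assume "msem v at_start \<omega>" "\<forall>\<psi>\<in>set ?\<Gamma>. msem v \<psi> \<omega>"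
    then have "\<forall>\<psi>\<in>set (eqs ws ys). msem v \<psi> \<omega>" "sem at_start \<omega>" by auto
    then have "sem (veq xs ws) \<omega>"
      using ws(1) len by (subst (asm) msem_eqs) (auto simp: sem_veq_nth)
    then show "msem v (veq xs ws) \<omega>" by simp
  qed
  have fresh: "fresh_vars ws ode (tvars p)"
    using ws by (auto simp: fresh_vars_def)
  have "?\<Gamma> \<turnstile>\<^bsub>H\<^esub> Dia (Ode ode (Gt p 0)) (Neg (veq xs ws))"
    by (rule provable_mp[OF provable_mp[OF C1[OF axiom_C1.Cont[OF wf clock refl fresh]] eqs] weak[OF p]])
  then have "?\<Gamma> \<turnstile>\<^bsub>H\<^esub> progress (Gt p 0)"
  proof (rule dia_ode[OF wf, of _ _ _ _ "eqs ws ys"])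
    fix \<psi> assume \<psi>: "\<psi> \<in> set (eqs ws ys)"
    then obtain a b where ab: "(a, b) \<in> set (zip ws ys)" "\<psi> = Eq (tvar a) (tvar b)" by auto
    then have "a \<in> set ws" "b \<in> set ys" by (auto dest: set_zip_leftD set_zip_rightD)
    then show "?\<Gamma> \<turnstile>\<^bsub>H\<^esub> Box (Ode ode (Gt p 0)) \<psi>"
      by (intro box_V[OF derives.Id]) (use \<psi> ws(3) disj ab in auto)
  next
    show "Gt p 0 # eqs ws ys \<turnstile>\<^bsub>H\<^esub> Gt p 0" by (simp add: derives.Id)
    show "Neg (veq xs ws) # Gt p 0 # eqs ws ys \<turnstile>\<^bsub>H\<^esub> Neg at_start"
    proof (rule arith0)
      fix v \<omega> assume *: "\<forall>\<psi>\<in>set (Neg (veq xs ws) # Gt p 0 # eqs ws ys). msem v \<psi> \<omega>"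
      then have "\<forall>\<psi>\<in>set (eqs ws ys). msem v \<psi> \<omega>" "\<not> sem (veq xs ws) \<omega>" by auto
      then show "msem v (Neg at_start) \<omega>"
        using ws(1) len by (subst (asm) msem_eqs) (auto simp: sem_veq_nth)
    qed
  qed
  moreover have "set ws \<inter> (set ys \<union> \<Union>(FV ` set \<Gamma>) \<union> FV (progress (Gt p 0))) = {}"
    using ws(3) FV_at_start by auto
  moreover have "length ws = length ys" using ws(1) len by simp
  ultimately show ?thesis by (metis fresh_eqs ws(2))
qed

lemma progress_TT: "\<Gamma> \<turnstile>\<^bsub>H\<^esub> at_start \<Longrightarrow> \<Gamma> \<turnstile>\<^bsub>H\<^esub> progress TT"
  by (rule progress_mono[OF progress_gt[of _ _ 1]]) (auto intro: arith0)

lemma progress_geq_step: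
  assumes "\<Gamma> \<turnstile>\<^bsub>H\<^esub> progress (Geq (lie ode p) 0)" "\<Gamma> \<turnstile>\<^bsub>H\<^esub> Geq p 0"
  shows "\<Gamma> \<turnstile>\<^bsub>H\<^esub> progress (Geq p 0)"
  by (rule dia_ode[OF wf assms(1), of "[Geq p 0]"])
    (use box_DI_geq[OF wf box_DW[OF wf] assms(2)] in \<open>auto intro!: arith0\<close>)

lemma progress_geq_chain:
  assumes "\<And>i. i < k \<Longrightarrow> lie ode (r i) = r (Suc i)" "\<And>i. i < k \<Longrightarrow> \<Gamma> \<turnstile>\<^bsub>H\<^esub> Geq (r i) 0"
    and "\<Gamma> \<turnstile>\<^bsub>H\<^esub> Gt (r k) 0" "\<Gamma> \<turnstile>\<^bsub>H\<^esub> at_start"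
  shows "\<Gamma> \<turnstile>\<^bsub>H\<^esub> progress (Geq (r 0) 0)"
  using assms
proof (induction k arbitrary: r)
  case 0
  then show ?case by (intro progress_mono[OF progress_gt]) auto
next
  case (Suc k)
  from Suc.prems have "\<Gamma> \<turnstile>\<^bsub>H\<^esub> progress (Geq (r (Suc 0)) 0)"
    by (intro Suc.IH[of "\<lambda>i. r (Suc i)"]) auto
  with Suc.prems(1,2)[of 0] show ?case
    using progress_geq_step[where p = "r 0"] by auto
qed

definition dist_sq :: trm where
  "dist_sq = (\<Sum>i<length ys. (tvar (xs ! i) - tvar (ys ! i))\<^sup>2)"

lemma dist_sq_eq_0: "teval dist_sq \<omega> = 0 \<longleftrightarrow> sem at_start \<omega>"
  by (auto simp: dist_sq_def sum_nonneg_eq_0_iff sem_veq_nth[OF len'] len simp del: nth_map)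

lemma dist_sq_nonneg: "teval dist_sq \<omega> \<ge> 0"
  by (simp add: dist_sq_def sum_nonneg)

text \<open>Subtracting a high power of the squared distance from the start does not affect the first
  \<open>k\<close> Lie derivatives there, and makes nonnegativity later on imply positivity.\<close>

lemma progress_first_pos:
  assumes lie: "\<And>i. lie ode (q i) = q (Suc i)" and E: "\<Gamma> \<turnstile>\<^bsub>H\<^esub> at_start"
    and k: "\<Gamma> \<turnstile>\<^bsub>H\<^esub> Gt (q k) 0" and zero: "\<And>i. i < k \<Longrightarrow> \<Gamma> \<turnstile>\<^bsub>H\<^esub> Eq (q i) 0"
  shows "\<Gamma> \<turnstile>\<^bsub>H\<^esub> progress (Or (Gt (q 0) 0) at_start)"
proof -
  \<comment> \<open>With exponent \<open>Suc k\<close> a factor \<open>dist_sq\<close> survives up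
    to \<open>k\<close> derivations, so \<open>r i\<close> and \<open>q i\<close> agree at the start
    for all \<open>i \<le> k\<close>.\<close>
  define r where "r i = q i - lie_n ode i (dist_sq ^ Suc k)" for i
  have r: "teval (r i) \<omega> = teval (q i) \<omega>" if "i \<le> k" "sem at_start \<omega>" for i \<omega>
  proof -
    obtain h where "lie_n ode i (dist_sq ^ Suc k) = dist_sq ^ (Suc k - i) * h"
      using lie_n_power[of i "Suc k"] that(1) by fastforce
    moreover have "teval dist_sq \<omega> = 0" using that(2) dist_sq_eq_0 by simp
    ultimately show ?thesis using that(1) by (simp add: r_def)
  qed
  have "\<Gamma> \<turnstile>\<^bsub>H\<^esub> progress (Geq (r 0) 0)"
  proof (rule progress_geq_chain[of k])
    show "lie ode (r i) = r (Suc i)" for i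
      by (simp add: r_def lie lie_n_Suc)
    show "\<Gamma> \<turnstile>\<^bsub>H\<^esub> Geq (r i) 0" if "i < k" for i
      by (rule arith2[OF E zero[OF that]]) (use that in \<open>simp add: r\<close>)
    show "\<Gamma> \<turnstile>\<^bsub>H\<^esub> Gt (r k) 0"
      by (rule arith2[OF E k]) (simp add: r)
  qed (rule E)
  then show ?thesis
  proof (rule progress_mono)
    fix v \<omega> assume "msem v (Geq (r 0) 0) \<omega>"
    \<comment> \<open>Away from the start \<open>dist_sq\<close> is positive, which makes
      \<open>q 0\<close> positive; at the start itself \<open>q 0\<close> may vanish.\<close>
    then have "teval dist_sq \<omega> ^ Suc k \<le> teval (q 0) \<omega>" by (simp add: r_def)
    moreover have "teval dist_sq \<omega> ^ Suc k > 0" if "\<not> sem at_start \<omega>"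
      using that dist_sq_nonneg[of \<omega>] dist_sq_eq_0[of \<omega>] by (intro zero_less_power) simp
    ultimately show "msem v (Or (Gt (q 0) 0) at_start) \<omega>" by fastforce
  qed
qed

text \<open>By \<open>box_darboux\<close> the sum of squares stays nonpositive on every run, and
  \<open>progress_TT\<close> supplies a run that moves.\<close>

lemma progress_all_zero:
  assumes q: "lie_seq ode q N" and E: "\<Gamma> \<turnstile>\<^bsub>H\<^esub> at_start"
    and zero: "\<Gamma> \<turnstile>\<^bsub>H\<^esub> all_zero q N"
  shows "\<Gamma> \<turnstile>\<^bsub>H\<^esub> progress (Geq (q 0) 0)"
proof -
  let ?v = "- (\<Sum>i<N. q i * q i)"
  obtain g where "\<And>\<omega>. teval g \<omega> * teval ?v \<omega> \<le> teval (lie ode ?v) \<omega>"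
    using lie_seq_darboux[OF q] by blast
  moreover have "\<Gamma> \<turnstile>\<^bsub>H\<^esub> Geq ?v 0"
    by (rule arith1[OF zero]) (simp add: all_zero_def)
  ultimately have box: "\<Gamma> \<turnstile>\<^bsub>H\<^esub> Box (Ode ode TT) (Geq ?v 0)"
    by (rule box_darboux[OF wf])
  show ?thesis
  proof (rule dia_ode[OF wf progress_TT[OF E], of "[Geq ?v 0]"])
    show "\<Gamma> \<turnstile>\<^bsub>H\<^esub> Box (Ode ode TT) \<psi>" if "\<psi> \<in> set [Geq ?v 0]" for \<psi>
      using box that by simp
    show "Neg at_start # TT # [Geq ?v 0] \<turnstile>\<^bsub>H\<^esub> Neg at_start"
      by (rule derives.Id) simp
    show "TT # [Geq ?v 0] \<turnstile>\<^bsub>H\<^esub> Geq (q 0) 0"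
    proof (rule arith0)
      fix v \<omega> assume "\<forall>\<psi>\<in>set (TT # [Geq ?v 0]). msem v \<psi> \<omega>"
      then have "(\<Sum>i<N. (teval (q i) \<omega>)\<^sup>2) \<le> 0" by (simp add: power2_eq_square)
      moreover have "(teval (q 0) \<omega>)\<^sup>2 \<le> (\<Sum>i<N. (teval (q i) \<omega>)\<^sup>2)"
        using q by (intro member_le_sum) (auto simp: lie_seq_def)
      ultimately have "(teval (q 0) \<omega>)\<^sup>2 \<le> 0" by linarith
      then show "msem v (Geq (q 0) 0) \<omega>" by simp
    qed
  qed
qed

lemma progress_lit:
  assumes q: "lie_seq ode q N" and E: "\<Gamma> \<turnstile>\<^bsub>H\<^esub> at_start"
    and prog: "\<Gamma> \<turnstile>\<^bsub>H\<^esub> lit_prog (strict, q, N)"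
  shows "\<Gamma> \<turnstile>\<^bsub>H\<^esub> progress (Or (lit_fml (strict, q, N)) at_start)"
proof -
  have pos: "\<Delta> \<turnstile>\<^bsub>H\<^esub> progress (Or (Gt (q 0) 0) at_start)"
    if \<Delta>: "\<Delta> \<turnstile>\<^bsub>H\<^esub> at_start" "\<Delta> \<turnstile>\<^bsub>H\<^esub> first_pos q N" for \<Delta>
    using \<Delta>(2) unfolding first_pos_def
  proof (rule Disj_elim)
    fix \<phi> assume "\<phi> \<in> set (map (\<lambda>k. Conj (Gt (q k) 0 # map (\<lambda>i. Eq (q i) 0) [0..<k])) [0..<N])"
    then obtain k where \<phi>: "\<phi> = Conj (Gt (q k) 0 # map (\<lambda>i. Eq (q i) 0) [0..<k])" by auto
    show "\<phi> # \<Delta> \<turnstile>\<^bsub>H\<^esub> progress (Or (Gt (q 0) 0) at_start)"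
    proof (rule progress_first_pos)
      show "lie ode (q i) = q (Suc i)" for i using q by (simp add: lie_seq_def)
      show "\<phi> # \<Delta> \<turnstile>\<^bsub>H\<^esub> at_start" by (rule weaken_Cons[OF \<Delta>(1)])
      show "\<phi> # \<Delta> \<turnstile>\<^bsub>H\<^esub> Gt (q k) 0" by (rule arith0) (simp add: \<phi>)
      show "\<phi> # \<Delta> \<turnstile>\<^bsub>H\<^esub> Eq (q i) 0" if "i < k" for i
        by (rule arith0) (use that in \<open>simp add: \<phi>\<close>)
    qed
  qed
  show ?thesis
  proof (cases strict)
    case True
    then show ?thesis using pos[OF E] prog by simp
  next
    case False
    have "first_pos q N # \<Gamma> \<turnstile>\<^bsub>H\<^esub> progress (Or (Geq (q 0) 0) at_start)"
      by (rule progress_mono[OF pos[OF weaken_Cons[OF E]]]) (auto intro: derives.Id)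
    moreover have "all_zero q N # \<Gamma> \<turnstile>\<^bsub>H\<^esub> progress (Or (Geq (q 0) 0) at_start)"
      by (rule progress_mono[OF progress_all_zero[OF q weaken_Cons[OF E]]]) (auto intro: derives.Id)
    ultimately have "Or (first_pos q N) (all_zero q N) # \<Gamma> \<turnstile>\<^bsub>H\<^esub> progress (Or (Geq (q 0) 0) at_start)"
      by (rule derives.OrL)
    with prog False show ?thesis by (simp add: derives.Cut)
  qed
qed

text \<open>By (Uniq) the shorter of two runs stays in both domains. Since both end away from the
  start, it does not matter which one is shorter.\<close>

lemma progress_Conj:
  assumes "\<Gamma> \<turnstile>\<^bsub>H\<^esub> at_start" "\<And>\<phi>. \<phi> \<in> set L \<Longrightarrow> first_order \<phi>"
    and "\<And>\<phi>. \<phi> \<in> set L \<Longrightarrow> \<Gamma> \<turnstile>\<^bsub>H\<^esub> progress (Or \<phi> at_start)"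
  shows "\<Gamma> \<turnstile>\<^bsub>H\<^esub> progress (Or (Conj L) at_start)"
  using assms
proof (induction L)
  case Nil
  then show ?case by (intro progress_mono[OF progress_TT]) auto
next
  case (Cons \<phi> L)
  have "\<Gamma> \<turnstile>\<^bsub>H\<^esub> Dia (Ode ode (And (Or \<phi> at_start) (Or (Conj L) at_start)))
      (Or (Neg at_start) (Neg at_start))"
    using Cons by (intro dia_uniq[OF wf]) auto
  then show ?case
    by (rule dia_ode[OF wf, of _ _ _ _ "[]"]) (use Cons.prems(2) in \<open>auto intro!: arith0\<close>)
qed

text \<open>Progress is into the disjunct that satisfies its progress condition, which need not be the
  one true at the start. There, \<open>\<phi>\<close> holds because it does for the constant values \<open>ys\<close>.\<close>

lemma progress_nf:
  assumes \<phi>: "first_order \<phi>" "\<Gamma> \<turnstile>\<^bsub>H\<^esub> \<phi>" and E: "\<Gamma> \<turnstile>\<^bsub>H\<^esub> at_start"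
    and seq: "\<And>L s q N. L \<in> set D \<Longrightarrow> (s, q, N) \<in> set L \<Longrightarrow> lie_seq ode q N"
    and prog: "\<Gamma> \<turnstile>\<^bsub>H\<^esub> Disj (map (\<lambda>L. Conj (map lit_prog L)) D)"
    and D: "\<And>\<omega> L. L \<in> set D \<Longrightarrow> (\<And>l. l \<in> set L \<Longrightarrow> sem (lit_fml l) \<omega>) \<Longrightarrow> sem \<phi> \<omega>"
  shows "\<Gamma> \<turnstile>\<^bsub>H\<^esub> progress \<phi>"
  using prog
proof (rule Disj_elim)
  fix \<psi> assume "\<psi> \<in> set (map (\<lambda>L. Conj (map lit_prog L)) D)"
  then obtain L where L: "L \<in> set D" and \<psi>: "\<psi> = Conj (map lit_prog L)" by auto
  let ?\<Gamma> = "\<psi> # \<Gamma>"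
  note E' = weaken_Cons[OF E, of \<psi>]
  have prog: "?\<Gamma> \<turnstile>\<^bsub>H\<^esub> progress (Or (Conj (map lit_fml L)) at_start)"
  proof (rule progress_Conj[OF E'])
    fix \<chi> assume "\<chi> \<in> set (map lit_fml L)"
    then obtain s q N where l: "(s, q, N) \<in> set L" "\<chi> = lit_fml (s, q, N)" by auto
    have "?\<Gamma> \<turnstile>\<^bsub>H\<^esub> lit_prog (s, q, N)"
      by (rule arith0) (use l in \<open>simp add: \<psi> del: lit_prog.simps\<close>)
    then show "?\<Gamma> \<turnstile>\<^bsub>H\<^esub> progress (Or \<chi> at_start)"
      unfolding l(2) by (rule progress_lit[OF seq[OF L l(1)] E'])
  qed auto
  \<comment> \<open>The quantifiers bind \<open>xs\<close>, so \<open>?c\<close> has no free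
    variable that changes and (V) preserves it; it says that \<open>\<phi>\<close> holds at the
    values \<open>ys\<close>.\<close>
  let ?c = "Alls xs (Imp at_start \<phi>)"
  have "?\<Gamma> \<turnstile>\<^bsub>H\<^esub> ?c"
  proof (rule arith2[OF E' weaken_Cons[OF \<phi>(2)]])
    fix v \<omega> assume "msem v at_start \<omega>" "msem v \<phi> \<omega>"
    then have *: "sem at_start \<omega>" "sem \<phi> \<omega>" using \<phi>(1) by auto
    have "\<nu> = \<omega>" if \<nu>: "\<forall>x. x \<notin> set xs \<longrightarrow> \<nu> x = \<omega> x" "sem at_start \<nu>" for \<nu>
    proof
      fix x
      show "\<nu> x = \<omega> x"
      proof (cases "x \<in> set xs")
        case True
        then obtain i where i: "i < length xs" "x = xs ! i" by (metis in_set_conv_nth)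
        then have "ys ! i \<in> set ys" using len by simp
        then have "ys ! i \<notin> set xs" using disj by (auto simp: ode_vars_def)
        then show ?thesis
          using i \<nu> *(1) by (auto simp: sem_veq_nth[OF len'] simp del: nth_map)
      qed (use \<nu> in simp)
    qed
    then have "sem ?c \<omega>" using *(2) by (auto simp: sem_Alls)
    then show "msem v ?c \<omega>" using \<phi>(1) by simp
  qed
  then have box: "?\<Gamma> \<turnstile>\<^bsub>H\<^esub> Box (Ode ode Q) ?c" for Q
    by (rule box_V) (auto simp: ode_vars_def)
  show "?\<Gamma> \<turnstile>\<^bsub>H\<^esub> progress \<phi>"
  proof (rule dia_ode[OF wf prog, of "[?c]"])
    let ?Q = "Or (Conj (map lit_fml L)) at_start"
    show "?\<Gamma> \<turnstile>\<^bsub>H\<^esub> Box (Ode ode ?Q) \<chi>" if "\<chi> \<in> set [?c]" for \<chi>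
      using that box by simp
    show "Neg at_start # ?Q # [?c] \<turnstile>\<^bsub>H\<^esub> Neg at_start"
      by (rule derives.Id) simp
    show "?Q # [?c] \<turnstile>\<^bsub>H\<^esub> \<phi>"
    proof (rule arith0)
      fix v \<omega> assume "\<forall>\<psi>\<in>set (?Q # [?c]). msem v \<psi> \<omega>"
      then have *: "(\<forall>l\<in>set L. sem (lit_fml l) \<omega>) \<or> sem at_start \<omega>" "sem ?c \<omega>"
        using \<phi>(1) by auto
      from *(2) have "sem at_start \<omega> \<longrightarrow> sem \<phi> \<omega>" by (simp add: sem_Alls)
      with *(1) D[OF L, of \<omega>] have "sem \<phi> \<omega>" by blast
      then show "msem v \<phi> \<omega>" using \<phi>(1) by simp
    qed
  qed
qed

end


section \<open>Progress formulas\<close>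

lemma FV_Disj [simp]: "FV (Disj L) = \<Union>(FV ` set L)"
  by (induction L rule: Disj.induct) (auto simp: FF_def)

section \<open>Substitution in quantifier-free formulas\<close>

lemma tvars_tsubst: "tvars p \<subseteq> V \<Longrightarrow> tvars (tsubst \<sigma> p) \<subseteq> (\<Union>x\<in>V. tvars (\<sigma> x))"
proof (induction rule: trm_induct)
  case (mult x p)
  then have "tvars (\<sigma> x * tsubst \<sigma> p) \<subseteq> (\<Union>x\<in>V. tvars (\<sigma> x))"
    by (intro tvars_mult) auto
  then show ?case by simp
qed (simp_all add: tvars_add)

text \<open>Without binders every substitution is admissible, as (Dadj) demands, and agrees with its
  semantic counterpart.\<close>

primrec quantifier_free :: "fml \<Rightarrow> bool" where
  "quantifier_free (Eq p q) \<longleftrightarrow> True"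
| "quantifier_free (Geq p q) \<longleftrightarrow> True"
| "quantifier_free (Gt p q) \<longleftrightarrow> True"
| "quantifier_free (Neg \<phi>) \<longleftrightarrow> quantifier_free \<phi>"
| "quantifier_free (And \<phi> \<psi>) \<longleftrightarrow> quantifier_free \<phi> \<and> quantifier_free \<psi>"
| "quantifier_free (Or \<phi> \<psi>) \<longleftrightarrow> quantifier_free \<phi> \<and> quantifier_free \<psi>"
| "quantifier_free (Imp \<phi> \<psi>) \<longleftrightarrow> quantifier_free \<phi> \<and> quantifier_free \<psi>"
| "quantifier_free (Iff \<phi> \<psi>) \<longleftrightarrow> quantifier_free \<phi> \<and> quantifier_free \<psi>"
| "quantifier_free (All x \<phi>) \<longleftrightarrow> False"
| "quantifier_free (Ex x \<phi>) \<longleftrightarrow> False"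
| "quantifier_free (Box \<alpha> \<phi>) \<longleftrightarrow> False"
| "quantifier_free (Dia \<alpha> \<phi>) \<longleftrightarrow> False"

lemma quantifier_free_Conj [simp]: "(\<And>\<phi>. \<phi> \<in> set L \<Longrightarrow> quantifier_free \<phi>) \<Longrightarrow> quantifier_free (Conj L)"
  by (induction L rule: Conj.induct) (auto simp: TT_def)

lemma quantifier_free_Disj [simp]: "(\<And>\<phi>. \<phi> \<in> set L \<Longrightarrow> quantifier_free \<phi>) \<Longrightarrow> quantifier_free (Disj L)"
  by (induction L rule: Disj.induct) (auto simp: FF_def)

lemma quantifier_free_fadm: "quantifier_free \<phi> \<Longrightarrow> fadm \<sigma> \<phi>"
  by (induction \<phi> rule: fml_induct) auto

lemma quantifier_free_fsubst: "quantifier_free \<phi> \<Longrightarrow> quantifier_free (fsubst \<sigma> \<phi>)"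
  by (induction \<phi> rule: fml_induct) auto

lemma quantifier_free_first_order: "quantifier_free \<phi> \<Longrightarrow> first_order \<phi>"
  by (induction \<phi> rule: fml_induct) auto

lemma sem_fsubst:
  "quantifier_free \<phi> \<Longrightarrow> sem (fsubst \<sigma> \<phi>) \<omega> \<longleftrightarrow> sem \<phi> (\<lambda>x. teval (\<sigma> x) \<omega>)"
  by (induction \<phi> rule: fml_induct) auto

lemma FV_fsubst: "quantifier_free \<phi> \<Longrightarrow> FV (fsubst \<sigma> \<phi>) \<subseteq> (\<Union>x\<in>FV \<phi>. tvars (\<sigma> x))"
proof (induction \<phi> rule: fml_induct)
  case (Eq p q)
  then show ?case using tvars_tsubst[of p "tvars p" \<sigma>] tvars_tsubst[of q "tvars q" \<sigma>] by auto
next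
  case (Geq p q)
  then show ?case using tvars_tsubst[of p "tvars p" \<sigma>] tvars_tsubst[of q "tvars q" \<sigma>] by auto
next
  case (Gt p q)
  then show ?case using tvars_tsubst[of p "tvars p" \<sigma>] tvars_tsubst[of q "tvars q" \<sigma>] by auto
qed auto

lemma quantifier_free_nf_fml: "quantifier_free (nf_fml D)"
  unfolding nf_fml_def by (auto intro!: quantifier_free_Disj quantifier_free_Conj)

lemma quantifier_free_veq: "quantifier_free (veq xs ys)"
  unfolding veq_def by (auto intro!: quantifier_free_Conj)

lemma FV_nf_fml: "FV (nf_fml D) = (\<Union>(ps, qs)\<in>set D. \<Union>p\<in>set ps \<union> set qs. tvars p)"
  by (simp add: nf_fml_def case_prod_beta UN_Un)

lemma first_order_Prog: "first_order (Prog ode D)"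
  by (auto simp: Prog_def Prog_geq_def Prog_gt_def Rad_def lie_zero_def Let_def)

text \<open>The last implication forbids that all derivatives of order below the rank vanish, so
  there is a first nonvanishing one; the clause of \<open>Prog_gt\<close> for its order makes it
  positive.\<close>

lemma sem_Prog_gt:
  assumes "sem (Prog_gt ode p) \<omega>"
  obtains k where "k < lie_rank ode p" "teval (lie_n ode k p) \<omega> > 0"
    "\<And>i. i < k \<Longrightarrow> teval (lie_n ode i p) \<omega> = 0"
proof (cases "lie_rank ode p = 1")
  case True
  then show ?thesis using assms that[of 0] by (simp add: Prog_gt_def)
next
  case False
  define N where "N = lie_rank ode p"
  have N: "N \<ge> 2" using False lie_rank_ge_1[of ode p] by (simp add: N_def)
  let ?a = "\<lambda>i. teval (lie_n ode i p) \<omega>"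
  have a: "?a 0 \<ge> 0" "\<And>k. 1 \<le> k \<Longrightarrow> k < N - 1 \<Longrightarrow> (\<And>i. i < k \<Longrightarrow> ?a i = 0) \<Longrightarrow> ?a k \<ge> 0"
    "(\<And>i. i < N - 1 \<Longrightarrow> ?a i = 0) \<Longrightarrow> ?a (N - 1) > 0"
    using assms False by (auto simp: Prog_gt_def Let_def lie_zero_def N_def)
  have ex: "\<exists>i. i \<le> N - 1 \<and> ?a i \<noteq> 0"
  proof (rule ccontr)
    assume *: "\<not> ?thesis"
    then have "?a (N - 1) > 0" by (intro a(3)) auto
    then show False using * by auto
  qed
  define k where "k = (LEAST i. i \<le> N - 1 \<and> ?a i \<noteq> 0)"
  have k: "k \<le> N - 1" "?a k \<noteq> 0"
    using LeastI_ex[OF ex] by (auto simp: k_def)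
  have zero: "?a i = 0" if "i < k" for i
    using not_less_Least[of i "\<lambda>i. i \<le> N - 1 \<and> ?a i \<noteq> 0"] that k(1) unfolding k_def by auto
  have "?a k > 0"
  proof -
    consider "k = 0" | "1 \<le> k" "k < N - 1" | "k = N - 1" using k(1) by linarith
    then show ?thesis
    proof cases
      case 1
      then show ?thesis using a(1) k(2) by simp
    next
      case 2
      then show ?thesis using a(2)[of k] zero k(2) by simp
    next
      case 3
      then show ?thesis using a(3) zero by simp
    qed
  qed
  then show ?thesis using zero k(1) N by (intro that[of k]) (auto simp: N_def)
qed

text \<open>Derivatives and rank are those of the original equation; \<open>\<sigma>\<close> then
  acts on the derivatives. It is \<open>tvar\<close> for the forward system and the renaming to
  \<open>zs\<close> for the reversed one.\<close>

definition lie_lits :: "ode \<Rightarrow> (nat \<Rightarrow> trm) \<Rightarrow> trm list \<times> trm list \<Rightarrow> (bool \<times> (nat \<Rightarrow> trm) \<times> nat) list" where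
  "lie_lits ode \<sigma> = (\<lambda>(ps, qs).
     map (\<lambda>p. (False, \<lambda>i. tsubst \<sigma> (lie_n ode i p), lie_rank ode p)) ps @
     map (\<lambda>q. (True, \<lambda>i. tsubst \<sigma> (lie_n ode i q), lie_rank ode q)) qs)"

lemma sem_first_pos:
  assumes "sem (Prog_gt ode p) (\<lambda>x. teval (\<sigma> x) \<omega>)"
  shows "sem (first_pos (\<lambda>i. tsubst \<sigma> (lie_n ode i p)) (lie_rank ode p)) \<omega>"
proof -
  obtain k where "k < lie_rank ode p" "teval (lie_n ode k p) (\<lambda>x. teval (\<sigma> x) \<omega>) > 0"
    "\<And>i. i < k \<Longrightarrow> teval (lie_n ode i p) (\<lambda>x. teval (\<sigma> x) \<omega>) = 0"
    using sem_Prog_gt[OF assms] by blast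
  then show ?thesis by (auto simp: first_pos_def)
qed

lemma sem_lit_prog:
  assumes "sem (Prog ode D) (\<lambda>x. teval (\<sigma> x) \<omega>)"
  shows "sem (Disj (map (\<lambda>L. Conj (map lit_prog L)) (map (lie_lits ode \<sigma>) D))) \<omega>"
proof -
  obtain ps qs where D: "(ps, qs) \<in> set D"
    and ps: "\<And>p. p \<in> set ps \<Longrightarrow> sem (Prog_geq ode p) (\<lambda>x. teval (\<sigma> x) \<omega>)"
    and qs: "\<And>q. q \<in> set qs \<Longrightarrow> sem (Prog_gt ode q) (\<lambda>x. teval (\<sigma> x) \<omega>)"
    using assms by (auto simp: Prog_def)
  have "sem (lit_prog l) \<omega>" if "l \<in> set (lie_lits ode \<sigma> (ps, qs))" for l
    using that ps qs
    by (fastforce simp: lie_lits_def Prog_geq_def Rad_def lie_zero_def all_zero_def intro: sem_first_pos)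
  with D show ?thesis by (auto simp del: lit_prog.simps intro!: bexI[of _ "(ps, qs)"])
qed

lemma sem_lit_fml:
  assumes "L \<in> set (map (lie_lits ode \<sigma>) D)" "\<And>l. l \<in> set L \<Longrightarrow> sem (lit_fml l) \<omega>"
  shows "sem (nf_fml D) (\<lambda>x. teval (\<sigma> x) \<omega>)"
proof -
  obtain ps qs where D: "(ps, qs) \<in> set D" and L: "L = lie_lits ode \<sigma> (ps, qs)"
    using assms(1) by auto
  have "teval p (\<lambda>x. teval (\<sigma> x) \<omega>) \<ge> 0" if "p \<in> set ps" for p
    using assms(2)[of "(False, \<lambda>i. tsubst \<sigma> (lie_n ode i p), lie_rank ode p)"] that
    by (auto simp: L lie_lits_def)
  moreover have "teval q (\<lambda>x. teval (\<sigma> x) \<omega>) > 0" if "q \<in> set qs" for q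
    using assms(2)[of "(True, \<lambda>i. tsubst \<sigma> (lie_n ode i q), lie_rank ode q)"] that
    by (auto simp: L lie_lits_def)
  ultimately show ?thesis using D by (auto simp: nf_fml_def intro!: bexI[of _ "(ps, qs)"])
qed

lemma tsubst_sum [simp]: "tsubst \<sigma> (sum f S) = (\<Sum>x\<in>S. tsubst \<sigma> (f x))"
  unfolding tsubst_peval by (rule rat_hom_trm.peval_sum)

text \<open>The derivatives stay over \<open>W\<close>, where \<open>\<sigma>\<close> commutes with
  the Lie derivative. On the cofactors, whose variables are unrestricted, it only has to be a ring
  homomorphism.\<close>

lemma lie_seq_tsubst:
  assumes "\<And>u. tvars u \<subseteq> W \<Longrightarrow> lie ode' (tsubst \<sigma> u) = tsubst \<sigma> (lie ode u)"
    and "rhs_vars ode \<subseteq> W" "tvars p \<subseteq> W"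
  shows "lie_seq ode' (\<lambda>i. tsubst \<sigma> (lie_n ode i p)) (lie_rank ode p)"
proof -
  obtain g where g: "lie_n ode (lie_rank ode p) p = (\<Sum>i<lie_rank ode p. g i * lie_n ode i p)"
    using lie_rank_cofactors by blast
  have "lie ode' (tsubst \<sigma> (lie_n ode i p)) = tsubst \<sigma> (lie_n ode (Suc i) p)" for i
    using assms by (simp add: lie_n_Suc tvars_lie_n)
  moreover have "tsubst \<sigma> (lie_n ode (lie_rank ode p) p) =
      (\<Sum>i<lie_rank ode p. tsubst \<sigma> (g i) * tsubst \<sigma> (lie_n ode i p))"
    by (subst g) simp
  ultimately show ?thesis
    using lie_rank_ge_1[of ode p] unfolding lie_seq_def
    by (intro conjI allI exI[of _ "\<lambda>i. tsubst \<sigma> (g i)"]) auto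
qed

text \<open>\<open>R\<close> stands for a premise of the rule in the form in which it is available:
  the implication itself forwards, its universal closure backwards.\<close>

lemma (in clocked_ode) progress_Prog:
  assumes \<phi>: "first_order \<phi>" "\<Gamma> \<turnstile>\<^bsub>H\<^esub> \<phi>" and E: "\<Gamma> \<turnstile>\<^bsub>H\<^esub> at_start"
    and nf: "\<And>\<omega>. sem \<phi> \<omega> \<longleftrightarrow> sem (nf_fml D) (\<lambda>x. teval (\<sigma> x) \<omega>)"
    and R: "first_order R" "\<Gamma> \<turnstile>\<^bsub>H\<^esub> R"
      "\<And>\<omega>. sem R \<omega> \<Longrightarrow> sem \<phi> \<omega> \<Longrightarrow> sem (Prog ode' D) (\<lambda>x. teval (\<sigma> x) \<omega>)"
    and lie: "\<And>u. tvars u \<subseteq> W \<Longrightarrow> lie ode (tsubst \<sigma> u) = tsubst \<sigma> (lie ode' u)"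
    and W: "rhs_vars ode' \<subseteq> W" "FV (nf_fml D) \<subseteq> W"
  shows "\<Gamma> \<turnstile>\<^bsub>H\<^esub> progress \<phi>"
proof (rule progress_nf[OF \<phi> E, of "map (lie_lits ode' \<sigma>) D"])
  fix L s q N assume "L \<in> set (map (lie_lits ode' \<sigma>) D)" "(s, q, N) \<in> set L"
  then obtain p where "tvars p \<subseteq> FV (nf_fml D)"
    "q = (\<lambda>i. tsubst \<sigma> (lie_n ode' i p))" "N = lie_rank ode' p"
    by (fastforce simp: lie_lits_def FV_nf_fml)
  then show "lie_seq ode q N"
    using lie_seq_tsubst[OF lie W(1), of p] W(2) by auto
next
  show "\<Gamma> \<turnstile>\<^bsub>H\<^esub> Disj (map (\<lambda>L. Conj (map lit_prog L)) (map (lie_lits ode' \<sigma>) D))"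
  proof (rule arith2[OF \<phi>(2) R(2)])
    fix v \<omega> assume "msem v \<phi> \<omega>" "msem v R \<omega>"
    then have "sem (Prog ode' D) (\<lambda>x. teval (\<sigma> x) \<omega>)" using \<phi>(1) R by simp
    then have "sem (Disj (map (\<lambda>L. Conj (map lit_prog L)) (map (lie_lits ode' \<sigma>) D))) \<omega>"
      by (rule sem_lit_prog)
    then show "msem v (Disj (map (\<lambda>L. Conj (map lit_prog L)) (map (lie_lits ode' \<sigma>) D))) \<omega>"
      by (subst msem_first_order) auto
  qed
next
  fix \<omega> L assume "L \<in> set (map (lie_lits ode' \<sigma>) D)" "\<And>l. l \<in> set L \<Longrightarrow> sem (lit_fml l) \<omega>"
  then show "sem \<phi> \<omega>" unfolding nf by (rule sem_lit_fml)
qed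


section \<open>Time reversal and real induction\<close>

text \<open>The chain rule, with \<open>\<sigma> x\<close> as the only replacement that depends on
  \<open>z\<close>.\<close>

lemma partial_tsubst:
  assumes "tvars u \<subseteq> V" "\<sigma> x = tvar z" "\<And>y. y \<in> V \<Longrightarrow> y \<noteq> x \<Longrightarrow> z \<notin> tvars (\<sigma> y)"
  shows "partial z (tsubst \<sigma> u) = tsubst \<sigma> (partial x u)"
  using assms(1)
proof (induction rule: trm_induct)
  case (mult y p)
  have "partial z (\<sigma> y) = (if x = y then 1 else 0)"
    using assms(2,3) mult(1) by (auto simp: partial_fresh)
  then show ?case using mult(2)
    by (simp add: partial_mult partial_tvar_mult algebra_simps)
qed simp_all

lemma rename_vars_nth:
  assumes "length xs = length zs" "distinct xs" "i < length xs"
  shows "rename_vars xs zs (xs ! i) = tvar (zs ! i)"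
  using assms by (simp add: rename_vars_def map_of_zip_nth)

lemma rename_vars_other:
  assumes "length xs = length zs" "x \<notin> set xs"
  shows "rename_vars xs zs x = tvar x"
proof -
  have "map_of (zip xs zs) x = None" using assms by (simp add: map_of_zip_is_None)
  then show ?thesis by (simp add: rename_vars_def)
qed

lemma tvars_rename_vars:
  assumes "length xs = length zs" "distinct xs"
  shows "tvars (rename_vars xs zs x) \<subseteq> set zs \<union> ({x} - set xs)"
proof (cases "x \<in> set xs")
  case True
  then obtain i where "i < length xs" "x = xs ! i" by (metis in_set_conv_nth)
  then show ?thesis using assms by (simp add: rename_vars_nth)
next
  case False
  then show ?thesis using assms by (simp add: rename_vars_other)
qed

lemma teval_rename_vars_id:
  assumes "length xs = length zs" "distinct xs" "\<And>i. i < length xs \<Longrightarrow> \<omega> (xs ! i) = \<omega> (zs ! i)"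
  shows "(\<lambda>x. teval (rename_vars xs zs x) \<omega>) = \<omega>"
proof
  fix x
  show "teval (rename_vars xs zs x) \<omega> = \<omega> x"
  proof (cases "x \<in> set xs")
    case True
    then obtain i where "i < length xs" "x = xs ! i" by (metis in_set_conv_nth)
    then show ?thesis using assms by (simp add: rename_vars_nth)
  next
    case False
    then show ?thesis using assms by (simp add: rename_vars_other)
  qed
qed

definition reverse_ode :: "ode \<Rightarrow> nat list \<Rightarrow> ode" where
  "reverse_ode ode zs =
    zip zs (map (\<lambda>(x, e). - tsubst (rename_vars (map fst ode) zs) e) ode)"

text \<open>The right-hand sides match by definition, and \<open>partial_tsubst\<close> matches the
  derivatives: by freshness of \<open>zs\<close>, each of them enters only in place of its
  counterpart in \<open>ode\<close>.\<close>

lemma lie_reverse_ode: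
  assumes len: "length zs = length ode" and dist: "distinct (map fst ode)" "distinct zs"
    and u: "tvars u \<inter> set zs = {}"
  shows "lie (reverse_ode ode zs) (tsubst (rename_vars (map fst ode) zs) u) =
    tsubst (rename_vars (map fst ode) zs) (lie (neg_ode ode) u)"
proof -
  let ?xs = "map fst ode"
  let ?\<sigma> = "rename_vars ?xs zs"
  have partial: "partial (zs ! i) (tsubst ?\<sigma> u) = tsubst ?\<sigma> (partial (fst (ode ! i)) u)"
    if i: "i < length ode" for i
  proof (rule partial_tsubst[OF subset_refl])
    show "?\<sigma> (fst (ode ! i)) = tvar (zs ! i)"
      using rename_vars_nth[of ?xs zs i] len dist(1) i by simp
    fix y assume y: "y \<in> tvars u" "y \<noteq> fst (ode ! i)"
    show "zs ! i \<notin> tvars (?\<sigma> y)"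
    proof (cases "y \<in> set ?xs")
      case True
      then obtain j where j: "j < length ode" "y = ?xs ! j"
        by (metis in_set_conv_nth length_map)
      then have "i \<noteq> j" using y(2) by auto
      then show ?thesis
        using rename_vars_nth[of ?xs zs j] len dist i j by (simp add: nth_eq_iff_index_eq)
    next
      case False
      have "zs ! i \<in> set zs" using len i by simp
      then have "y \<noteq> zs ! i" using u y(1) by auto
      then show ?thesis using False len by (simp add: rename_vars_other)
    qed
  qed
  have "lie (reverse_ode ode zs) (tsubst ?\<sigma> u) =
      (\<Sum>i<length ode. partial (zs ! i) (tsubst ?\<sigma> u) * - tsubst ?\<sigma> (snd (ode ! i)))"
    using len by (simp add: lie_def reverse_ode_def sum_list_sum_nth case_prod_beta atLeast0LessThan)
  also have "\<dots> = (\<Sum>i<length ode. tsubst ?\<sigma> (partial (fst (ode ! i)) u) * - tsubst ?\<sigma> (snd (ode ! i)))"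
    by (rule sum.cong) (simp_all add: partial)
  also have "\<dots> = tsubst ?\<sigma> (lie (neg_ode ode) u)"
    by (simp add: lie_def neg_ode_def sum_list_sum_nth case_prod_beta atLeast0LessThan)
  finally show ?thesis .
qed

theorem theorem16:
  fixes ode :: ode and P NP :: nform
  assumes "distinct (map fst ode)"
    and "\<And>x e. (x, e) \<in> set ode \<Longrightarrow> tvars e \<subseteq> set (map fst ode)"
    and "wf_nform P"
    and "nform_of NP (Neg (nf_fml P))"
  shows "derives axiom_C1
           {([nf_fml P], Prog ode P),
            ([Neg (nf_fml P)], Prog (neg_ode ode) NP)}
           [nf_fml P] (Box (Ode ode TT) (nf_fml P))"
proof -
  let ?H = "{([nf_fml P], Prog ode P), ([Neg (nf_fml P)], Prog (neg_ode ode) NP)}"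
  let ?P = "nf_fml P"
  define U where "U = ode_vars ode \<union> FV ?P \<union> FV (nf_fml NP)"
  have rhs: "rhs_vars ode \<subseteq> ode_vars ode"
    using assms(2) by (fastforce simp: rhs_vars_def ode_vars_def)
  have "finite U" by (simp add: U_def ode_vars_def)
  then obtain ts where "length ts = 2" "distinct ts" and ts: "set ts \<inter> U = {}"
    by (rule exists_fresh)
  then obtain t s where ts': "ts = [t, s]" "t \<noteq> s"
    by (auto simp: length_Suc_conv numeral_2_eq_2)
  define ode2 where "ode2 = ode @ [(t, 1), (s, - 1)]"
  have fresh: "t \<notin> U" "s \<notin> U" using ts ts' by auto
  have wf: "wf_ode ode" using assms(1) by (simp add: wf_ode_def)
  have wf2: "wf_ode ode2"
    using assms(1) fresh ts' by (auto simp: wf_ode_def ode2_def U_def ode_vars_def)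
  have vars2: "ode_vars ode2 = ode_vars ode \<union> {t, s}" "rhs_vars ode2 = rhs_vars ode"
    by (auto simp: ode2_def ode_vars_def rhs_vars_def)
  have clock2: "has_clock ode2" by (auto simp: has_clock_def ode2_def)
  let ?xs = "map fst ode2"
  have set_xs: "set ?xs = ode_vars ode2" by (simp add: ode_vars_def)
  have dxs: "distinct ?xs" using wf2 by (simp add: wf_ode_def)
  \<comment> \<open>The clocks do not occur in these terms, so the premises about \<open>ode\<close>
    also describe \<open>ode2\<close>.\<close>
  have lie2: "lie ode2 u = lie ode u" "lie (neg_ode ode2) u = lie (neg_ode ode) u" if "tvars u \<subseteq> U" for u
  proof -
    have "partial t u = 0" "partial s u = 0" using that fresh by (auto intro!: partial_fresh)
    then show "lie ode2 u = lie ode u" "lie (neg_ode ode2) u = lie (neg_ode ode) u"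
      by (simp_all add: ode2_def neg_ode_def lie_append lie_Cons lie_Nil)
  qed
  have finU: "finite (U \<union> ode_vars ode2)" by (simp add: U_def ode_vars_def)
  \<comment> \<open>\<open>ys\<close> name the state examined by (RI); \<open>zs\<close>, chosen
    next, are the state variables of the reversed system.\<close>
  then obtain ys where ys: "length ys = length ode2" "distinct ys" "set ys \<inter> (U \<union> ode_vars ode2) = {}"
    by (rule exists_fresh)
  have "finite (U \<union> ode_vars ode2 \<union> set ys)" using finU by simp
  then obtain zs where zs: "length zs = length ode2" "distinct zs"
      "set zs \<inter> (U \<union> ode_vars ode2 \<union> set ys) = {}"
    by (rule exists_fresh)
  let ?\<sigma> = "rename_vars ?xs zs"
  let ?E = "veq ?xs ys"
  define rode where "rode = reverse_ode ode2 zs"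
  have fst_rode: "map fst rode = zs"
    using zs(1) by (simp add: rode_def reverse_ode_def)
  have len_rode: "length rode = length ode2"
    using zs(1) by (simp add: rode_def reverse_ode_def)
  have vars_rode: "ode_vars rode = set zs"
    unfolding ode_vars_def fst_rode ..
  interpret fwd: clocked_ode ode2 ys
    using wf2 clock2 ys by unfold_locales auto
  interpret bwd: clocked_ode rode ys
  proof
    show "wf_ode rode" unfolding wf_ode_def fst_rode by (rule zs)
    \<comment> \<open>The position of \<open>s\<close>: reversal turns \<open>s' = - 1\<close> into
      a clock.\<close>
    have "(zs ! Suc (length ode), 1) \<in> set rode"
      using zs(1) by (auto simp: rode_def reverse_ode_def set_zip ode2_def nth_append
          intro!: exI[of _ "Suc (length ode)"])
    then show "has_clock rode" by (auto simp: has_clock_def)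
    show "length ys = length rode" using ys len_rode by simp
    show "set ys \<inter> ode_vars rode = {}" using zs(3) vars_rode by auto
  qed
  have qfP: "quantifier_free ?P" by (rule quantifier_free_nf_fml)
  note foP = quantifier_free_first_order[OF qfP]
  let ?Pz = "fsubst ?\<sigma> ?P"
  have foPz: "first_order ?Pz"
    by (intro quantifier_free_first_order quantifier_free_fsubst qfP)
  have sem_Pz: "sem ?Pz \<omega> \<longleftrightarrow> sem ?P (\<lambda>x. teval (?\<sigma> x) \<omega>)" for \<omega>
    by (rule sem_fsubst[OF qfP])
  have FV_Pz: "FV ?Pz \<subseteq> set zs \<union> (FV ?P - set ?xs)"
    using FV_fsubst[OF qfP, of ?\<sigma>] tvars_rename_vars[of ?xs zs] zs(1) dxs by fastforce
  have \<sigma>_id: "(\<lambda>x. teval (?\<sigma> x) \<omega>) = \<omega>" if "\<And>i. i < length ode2 \<Longrightarrow> \<omega> (?xs ! i) = \<omega> (zs ! i)" for \<omega>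
    using teval_rename_vars_id[of ?xs zs \<omega>] zs(1) dxs that by simp

  have forward: "[?E, ?P] \<turnstile>\<^bsub>?H\<^esub> fwd.progress ?P"
  proof (rule fwd.progress_Prog[where R = "Imp ?P (Prog ode P)" and \<sigma> = tvar and W = U])
    show "[?E, ?P] \<turnstile>\<^bsub>?H\<^esub> Imp ?P (Prog ode P)"
      by (rule derives.Weaken[of _ _ "[]"], rule derives.ImpR, rule derives.Premise) auto
  qed (use foP lie2 rhs first_order_Prog in \<open>auto simp: U_def derives.Id\<close>)

  have backward: "[veq zs ys, Neg ?Pz] \<turnstile>\<^bsub>?H\<^esub> bwd.progress (Neg ?Pz)"
  proof (rule bwd.progress_Prog[where \<sigma> = ?\<sigma> and W = U])
    \<comment> \<open>The second premise speaks of \<open>xs\<close> but is needed at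
      \<open>zs\<close>. As an implication derived from no context it may be closed universally, and
      the closure is then read at the values of \<open>zs\<close>.\<close>
    let ?R = "Alls ?xs (Imp (Neg ?P) (Prog (neg_ode ode) NP))"
    have "[] \<turnstile>\<^bsub>?H\<^esub> Imp (Neg ?P) (Prog (neg_ode ode) NP)"
      by (rule derives.ImpR, rule derives.Premise) simp
    then have "[] \<turnstile>\<^bsub>?H\<^esub> ?R" by (intro AllsR) auto
    then show "[veq zs ys, Neg ?Pz] \<turnstile>\<^bsub>?H\<^esub> ?R"
      by (rule derives.Weaken) simp
    show "first_order ?R" using foP first_order_Prog by simp
    fix \<omega>
    show "sem (Neg ?Pz) \<omega> \<longleftrightarrow> sem (nf_fml NP) (\<lambda>x. teval (?\<sigma> x) \<omega>)"
      using assms(4) by (auto simp: nform_of_def valid_def sem_Pz)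
    assume R: "sem ?R \<omega>" and "sem (Neg ?Pz) \<omega>"
    then have "\<not> sem ?P (\<lambda>x. teval (?\<sigma> x) \<omega>)" by (simp add: sem_Pz)
    moreover have "teval (?\<sigma> x) \<omega> = \<omega> x" if "x \<notin> set ?xs" for x
      using rename_vars_other[of ?xs zs x] zs(1) that by simp
    ultimately show "sem (Prog (neg_ode ode) NP) (\<lambda>x. teval (?\<sigma> x) \<omega>)"
      using R unfolding sem_Alls by (auto simp del: set_map)
  next
    fix u assume u: "tvars u \<subseteq> U"
    then have "tvars u \<inter> set zs = {}" using zs(3) by auto
    then show "lie rode (tsubst ?\<sigma> u) = tsubst ?\<sigma> (lie (neg_ode ode) u)"
      using lie_reverse_ode[OF zs(1) dxs zs(2)] lie2(2)[OF u] by (simp add: rode_def)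
  next
    have "rhs_vars (neg_ode ode) = rhs_vars ode"
      by (auto simp: rhs_vars_def neg_ode_def case_prod_beta)
    then show "rhs_vars (neg_ode ode) \<subseteq> U" using rhs by (auto simp: U_def)
  qed (use foPz in \<open>auto simp: U_def fst_rode derives.Id\<close>)

  \<comment> \<open>The domain of (RI): \<open>P\<close> may fail at most at the state
    \<open>ys\<close>.\<close>
  let ?Q = "Or ?P ?E"
  have stay: "[?P] \<turnstile>\<^bsub>?H\<^esub> Box (Ode ode2 ?Q) (Imp ?E ?P)"
  proof (rule dia_or_box, rule fresh_eqs[OF _ zs(2), of ys])
    show "length zs = length ys" using zs ys by simp
    let ?exit = "Dia (Ode ode2 ?Q) (Neg (Imp ?E ?P))"
    show "set zs \<inter> (set ys \<union> \<Union> (FV ` set [?exit, ?P]) \<union> FV FF) = {}"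
      using zs(3) rhs vars2 by (auto simp: U_def FF_def FV_veq ys(1) ode_vars_def)
    let ?\<Gamma> = "eqs zs ys @ [?exit, ?P]"
    have eqs_box: "\<Delta> \<turnstile>\<^bsub>?H\<^esub> Box (Ode ode2 Q) \<psi>"
      if \<psi>: "\<psi> \<in> set (eqs zs ys)" "set ?\<Gamma> \<subseteq> set \<Delta>" for \<psi> \<Delta> Q
    proof -
      obtain a b where ab: "(a, b) \<in> set (zip zs ys)" "\<psi> = Eq (tvar a) (tvar b)"
        using \<psi>(1) by auto
      then have "a \<in> set zs" "b \<in> set ys" by (auto dest: set_zip_leftD set_zip_rightD)
      then have "FV \<psi> \<inter> BV (Ode ode2 Q) = {}" using ab zs(3) ys(3) by auto
      then show ?thesis using \<psi> by (intro box_V[OF derives.Id]) auto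
    qed
    have zs_ys: "\<omega> (zs ! i) = \<omega> (ys ! i)"
      if "\<forall>\<psi>\<in>set (eqs zs ys). msem v \<psi> \<omega>" "i < length ode2" for v \<omega> i
      using that msem_eqs[of zs ys v \<omega>] zs(1) ys(1) by simp
    show "?\<Gamma> \<turnstile>\<^bsub>?H\<^esub> FF"
    \<comment> \<open>The question is whether \<open>P\<close> holds at \<open>ys\<close>. It is
      asked about the copies \<open>zs\<close>, which no run of \<open>ode2\<close> changes; if the
      answer is yes, \<open>P\<close> holds at the alleged exit.\<close>
    proof (rule provable_cases[where \<phi> = ?Pz])
      show "?Pz # ?\<Gamma> \<turnstile>\<^bsub>?H\<^esub> FF"
      proof (rule dia_False[OF wf2, where \<Delta> = "?Pz # eqs zs ys"])
        show "?Pz # ?\<Gamma> \<turnstile>\<^bsub>?H\<^esub> ?exit" by (rule derives.Id) simp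
        fix \<psi> assume "\<psi> \<in> set (?Pz # eqs zs ys)"
        then consider "\<psi> = ?Pz" | "\<psi> \<in> set (eqs zs ys)" by (auto simp only: list.set)
        then show "?Pz # ?\<Gamma> \<turnstile>\<^bsub>?H\<^esub> Box (Ode ode2 ?Q) \<psi>"
        proof cases
          case 1
          show ?thesis
            unfolding 1 by (rule box_V[OF derives.Id]) (use FV_Pz zs(3) set_xs in auto)
        next
          case 2
          then show ?thesis by (rule eqs_box) auto
        qed
      next
        show "Neg (Imp ?E ?P) # ?Q # ?Pz # eqs zs ys \<turnstile>\<^bsub>?H\<^esub> FF"
        proof (rule arith0)
          fix v \<omega>
          assume "\<forall>\<psi>\<in>set (Neg (Imp ?E ?P) # ?Q # ?Pz # eqs zs ys). msem v \<psi> \<omega>"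
          then have *: "sem ?E \<omega>" "\<not> sem ?P \<omega>" "sem ?Pz \<omega>" "\<forall>\<psi>\<in>set (eqs zs ys). msem v \<psi> \<omega>"
            using foP foPz by auto
          have "(\<lambda>x. teval (?\<sigma> x) \<omega>) = \<omega>"
            using *(1) zs_ys[OF *(4)] by (intro \<sigma>_id) (simp add: sem_veq_nth ys(1))
          then show "msem v FF \<omega>" using *(2,3) by (simp add: sem_Pz)
        qed
      qed
      let ?\<Gamma>' = "Neg ?Pz # ?\<Gamma>"
      \<comment> \<open>(Dadj) wants the end state named by variables that do not occur in the
        domain. As \<open>ys\<close> occur in \<open>?Q\<close>, the end condition is restated with
        \<open>zs\<close>.\<close>
      have "?\<Gamma>' \<turnstile>\<^bsub>?H\<^esub> Dia (Ode ode2 ?Q) (veq ?xs zs)"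
      proof (rule dia_ode[OF wf2, where \<Delta> = "eqs zs ys"])
        show "?\<Gamma>' \<turnstile>\<^bsub>?H\<^esub> ?exit" by (rule derives.Id) simp
        show "?\<Gamma>' \<turnstile>\<^bsub>?H\<^esub> Box (Ode ode2 ?Q) \<psi>" if "\<psi> \<in> set (eqs zs ys)" for \<psi>
          by (rule eqs_box[OF that]) auto
        show "?Q # eqs zs ys \<turnstile>\<^bsub>?H\<^esub> ?Q" by (rule derives.Id) simp
        show "Neg (Imp ?E ?P) # ?Q # eqs zs ys \<turnstile>\<^bsub>?H\<^esub> veq ?xs zs"
        proof (rule arith0)
          fix v \<omega>
          assume "\<forall>\<psi>\<in>set (Neg (Imp ?E ?P) # ?Q # eqs zs ys). msem v \<psi> \<omega>"
          then have *: "sem ?E \<omega>" "\<forall>\<psi>\<in>set (eqs zs ys). msem v \<psi> \<omega>" by auto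
          have "sem (veq ?xs zs) \<omega>"
            using *(1) zs_ys[OF *(2)] by (simp add: sem_veq_nth ys(1) zs(1))
          then show "msem v (veq ?xs zs) \<omega>" by simp
        qed
      qed
      moreover have "?\<Gamma>' \<turnstile>\<^bsub>?H\<^esub> Iff (Dia (Ode ode2 ?Q) (veq ?xs zs))
          (Dia (Ode rode (fsubst ?\<sigma> ?Q)) (veq zs ?xs))"
        unfolding rode_def reverse_ode_def
      proof (rule C1, rule axiom_C1.Dadj[OF wf2 refl _ refl])
        show "fresh_vars zs ode2 (FV ?Q)"
          using zs rhs vars2 by (auto simp: fresh_vars_def U_def FV_veq ys(1) ode_vars_def)
        show "fadm ?\<sigma> ?Q"
          by (simp add: quantifier_free_fadm qfP quantifier_free_veq)
      qed
      ultimately have "?\<Gamma>' \<turnstile>\<^bsub>?H\<^esub> Dia (Ode rode (fsubst ?\<sigma> ?Q)) (veq zs ?xs)"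
        by (rule arith2) simp
      \<comment> \<open>The reversed system also has a run that moves away from \<open>ys\<close>
        outside \<open>P\<close>.\<close>
      moreover have "?\<Gamma>' \<turnstile>\<^bsub>?H\<^esub> Dia (Ode rode (Neg ?Pz)) (Neg (veq zs ys))"
      proof (rule cut_list[of "[veq zs ys, Neg ?Pz]"])
        have "?\<Gamma>' \<turnstile>\<^bsub>?H\<^esub> veq zs ys"
        proof (rule arith0)
          fix v \<omega> assume "\<forall>\<psi>\<in>set ?\<Gamma>'. msem v \<psi> \<omega>"
          then have "\<forall>\<psi>\<in>set (eqs zs ys). msem v \<psi> \<omega>" by auto
          from zs_ys[OF this] have "sem (veq zs ys) \<omega>" by (simp add: sem_veq_nth ys(1) zs(1))
          then show "msem v (veq zs ys) \<omega>" by simp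
        qed
        then show "?\<Gamma>' \<turnstile>\<^bsub>?H\<^esub> \<psi>" if "\<psi> \<in> set [veq zs ys, Neg ?Pz]" for \<psi>
          using that by (auto intro: derives.Id)
        show "[veq zs ys, Neg ?Pz] @ ?\<Gamma>' \<turnstile>\<^bsub>?H\<^esub> Dia (Ode rode (Neg ?Pz)) (Neg (veq zs ys))"
          using backward unfolding fst_rode by (rule derives.Weaken) auto
      qed
      ultimately have "?\<Gamma>' \<turnstile>\<^bsub>?H\<^esub> Dia (Ode rode (And (fsubst ?\<sigma> ?Q) (Neg ?Pz)))
          (Or (veq zs ?xs) (Neg (veq zs ys)))"
        by (rule dia_uniq[OF bwd.wf])
      then show "?\<Gamma>' \<turnstile>\<^bsub>?H\<^esub> FF"
      proof (rule dia_False[OF bwd.wf, where \<Delta> = "[?P]"])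
        \<comment> \<open>In this domain \<open>zs\<close> satisfies \<open>?Q\<close> but not
          \<open>P\<close>, so \<open>zs = ys\<close> and the run has not moved. Its end must then
          be \<open>xs\<close>, where \<open>P\<close> holds; since \<open>xs\<close> are constant
          in the reversed system, this contradicts the failure of \<open>P\<close> at
          \<open>zs\<close>.\<close>
        let ?D = "And (fsubst ?\<sigma> ?Q) (Neg ?Pz)"
        have "?\<Gamma>' \<turnstile>\<^bsub>?H\<^esub> Box (Ode rode ?D) ?P"
          by (rule box_V[OF derives.Id]) (use vars_rode zs(3) in \<open>auto simp: U_def\<close>)
        then show "?\<Gamma>' \<turnstile>\<^bsub>?H\<^esub> Box (Ode rode ?D) \<psi>" if "\<psi> \<in> set [?P]" for \<psi>
          using that by simp
        show "Or (veq zs ?xs) (Neg (veq zs ys)) # ?D # [?P] \<turnstile>\<^bsub>?H\<^esub> FF"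
        proof (rule arith0)
          fix v \<omega>
          assume "\<forall>\<psi>\<in>set (Or (veq zs ?xs) (Neg (veq zs ys)) # ?D # [?P]). msem v \<psi> \<omega>"
          then have *: "sem (veq zs ?xs) \<omega> \<or> \<not> sem (veq zs ys) \<omega>" "sem ?P \<omega>" "\<not> sem ?Pz \<omega>"
              "sem ?Pz \<omega> \<or> sem (fsubst ?\<sigma> ?E) \<omega>"
            using foP foPz quantifier_free_first_order[OF quantifier_free_fsubst[OF quantifier_free_veq]]
            by auto
          then have "sem ?E (\<lambda>x. teval (?\<sigma> x) \<omega>)"
            by (simp add: sem_fsubst[OF quantifier_free_veq])
          moreover have "teval (?\<sigma> (?xs ! i)) \<omega> = \<omega> (zs ! i)" "teval (?\<sigma> (ys ! i)) \<omega> = \<omega> (ys ! i)"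
            if i: "i < length ode2" for i
          proof -
            show "teval (?\<sigma> (?xs ! i)) \<omega> = \<omega> (zs ! i)"
              using rename_vars_nth[of ?xs zs i] zs(1) dxs i by (simp del: nth_map)
            have "ys ! i \<in> set ys" using ys(1) i by simp
            then have "ys ! i \<notin> set ?xs" using ys(3) set_xs by auto
            then show "teval (?\<sigma> (ys ! i)) \<omega> = \<omega> (ys ! i)"
              using rename_vars_other[of ?xs zs "ys ! i"] zs(1) by simp
          qed
          ultimately have "sem (veq zs ys) \<omega>"
            using ys(1) zs(1) by (simp add: sem_veq_nth del: nth_map)
          with *(1) have "sem (veq zs ?xs) \<omega>" by simp
          then have "(\<lambda>x. teval (?\<sigma> x) \<omega>) = \<omega>"
            using zs(1) by (intro \<sigma>_id) (simp add: sem_veq_nth)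
          then show "msem v FF \<omega>" using *(2,3) by (simp add: sem_Pz)
        qed
      qed
    qed
  qed

  \<comment> \<open>\<open>forward\<close> uses nothing about the initial state, so it may be boxed
    by (G).\<close>
  have "[] \<turnstile>\<^bsub>?H\<^esub> Imp ?E (Imp ?P (fwd.progress ?P))"
    by (rule derives.ImpR, rule derives.ImpR) (use forward in \<open>auto intro: exchange\<close>)
  then have "[?P] \<turnstile>\<^bsub>?H\<^esub> Box (Ode ode2 ?Q) (Imp ?E (Imp ?P (fwd.progress ?P)))"
    by (rule derives.Goedel)
  with stay have "[?P] \<turnstile>\<^bsub>?H\<^esub> Box (Ode ode2 ?Q) (Imp ?E (And ?P (fwd.progress ?P)))"
    by (rule box_arith2) auto
  then have "[?P] \<turnstile>\<^bsub>?H\<^esub> Alls ys (Box (Ode ode2 ?Q) (Imp ?E (And ?P (fwd.progress ?P))))"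
    by (intro AllsR) (use ys(3) in \<open>auto simp: U_def\<close>)
  moreover have "fresh_vars ys ode2 (FV ?P)"
    using ys rhs vars2 by (auto simp: fresh_vars_def U_def)
  then have "[?P] \<turnstile>\<^bsub>?H\<^esub> Iff (Box (Ode ode2 TT) ?P)
      (Alls ys (Box (Ode ode2 ?Q) (Imp ?E (And ?P (fwd.progress ?P)))))"
    by (intro C1 axiom_C1.RI[OF wf2 clock2 refl])
  ultimately have main: "[?P] \<turnstile>\<^bsub>?H\<^esub> Box (Ode ode2 TT) ?P"
    by (rule arith2) simp
  \<comment> \<open>(DG) removes the clocks one at a time, with linear coefficient
    \<open>0\<close>.\<close>
  show ?thesis
  proof (rule box_DG[OF wf, of t _ _ 0 1])
    show "t \<notin> FVp (Ode ode TT) \<union> FV ?P" using fresh rhs by (auto simp: U_def)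
    have wf1: "wf_ode (ode @ [(t, 0 * tvar t + 1)])"
      using assms(1) fresh by (auto simp: wf_ode_def U_def ode_vars_def)
    show "[?P] \<turnstile>\<^bsub>?H\<^esub> Box (Ode (ode @ [(t, 0 * tvar t + 1)]) TT) ?P"
    proof (rule box_DG[OF wf1, of s _ _ 0 "- 1"])
      show "s \<notin> FVp (Ode (ode @ [(t, 0 * tvar t + 1)]) TT) \<union> FV ?P"
        using fresh rhs ts' by (auto simp: U_def ode_vars_def rhs_vars_def)
    qed (use main in \<open>simp_all add: ode2_def\<close>)
  qed simp
qed

end
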